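(* Let $W=\Omega\ltimes\tilde W$ be a twisted Coxeter group and let $w,w'\in W$. (i) If $w\overset{\times}{\sim}w'$ via a sequence of conjugators $\tau_n,\ldots,\tau_0$, then $(\tau_n\cdots\tau_0)(\mathfrak R^{w}_{\mathrm{st}})=\mathfrak R^{w'}_{\mathrm{st}}$. In particular, if $w\overset{\times}{\sim}w'$, both $w$ and $w'$ are convex and one of them is firmly convex, then so is the other one. (ii) Let $W'\subseteq\tilde W$ be a standard parabolic subgroup. If $\tilde W$ is finite, then sending a sequence of conjugators $(\tau_n,\ldots,\tau_0)\in\mathrm{Tran}^{\times}_{W'}(w,w')$ to the braid $b_{\tau_n}\cdots b_{\tau_0}$ surjects onto $$\mathrm{Tran}_{W'}(b_w,b_{w'}):=\{\tau\in\mathrm{Br}^+_{W'}:\tau b_w=b_{w'}\tau\},$$ i.e. every element of $\mathrm{Tran}_{W'}(b_w,b_{w'})$ is of the form $b_{\tau_n}\cdots b_{\tau_0}$ for some sequence $(\tau_n,\ldots,\tau_0)$ in $\mathrm{Tran}^{\times}_{W'}(w,w')$. In particular, $w\overset{\times}{\sim}w'$ by $W'$ if and only if $b_w$ and $b_{w'}$ are conjugate under the braid subgroup $\mathrm{Br}_{W'}$.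
   Context: Twisted Coxeter groups. $(\tilde W,\{s_1,\ldots,s_n\})$ is a Coxeter system and $W=\Omega\ltimes\tilde W$, where $\Omega$ is a group of automorphisms of $\tilde W$ each of which permutes the simple reflections (elements of $\Omega$ are called twists). $W$ acts on the real reflection representation $V$ of $\tilde W$ (Tits' geometric representation, with basis the simple roots $\alpha_i$), where $\Omega$ permutes the simple roots as it permutes the $s_i$. $\mathfrak R$ is the set of roots (the $\tilde W$-orbits of the simple roots), $\mathfrak R_+$ and $\mathfrak R_-=-\mathfrak R_+$ the positive and negative roots. For $w\in W$ put $\mathfrak R_w=\{\beta\in\mathfrak R_+: w(\beta)\in\mathfrak R_-\}$ and $\ell(w)=|\mathfrak R_w|$. A standard parabolic subgroup of $\tilde W$ is one generated by a subset of the simple reflections. Stable roots and convexity. $\mathfrak R^w$ is the set of roots fixed by $w$. $\mathfrak R^w_{\mathrm{st}}$ is the set of stable roots: those roots whose orbit under $\langle w\rangle$ consists solely of positive or solely of negative roots. $w$ is convex if $\mathfrak R^w_{\mathrm{st}}$ is a standard parabolic subsystem (the roots in the span of some subset of the simple roots); $w$ is firmly convex if it is convex and $\mathfrak R^w=\mathfrak R^w_{\mathrm{st}}$. Shifts. Write $w\overset{\times}{\sim}w'$ (mixed shifts) if there are (possibly zero) $\tau_0,\ldots,\tau_n\in\tilde W$ with $w_0=w$, $w_{j+1}=\tau_jw_j\tau_j^{-1}$, $w_{n+1}=w'$, $\ell(w_j)=\ell(w_{j+1})$ for all $j$, and such that each step is either a strong conjugation ($\ell(\tau_jw_j)=\ell(w_j)+\ell(\tau_j)$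 or $\ell(w_j\tau_j^{-1})=\ell(w_j)+\ell(\tau_j)$) or a cyclic shift ($\ell(\tau_jw_j)=\ell(w_j)-\ell(\tau_j)$ or $\ell(w_j\tau_j^{-1})=\ell(w_j)-\ell(\tau_j)$). It is "by $W'$" if all $\tau_j\in W'$. $\mathrm{Tran}^\times_{W'}(w,w')$ denotes the set of such sequences $(\tau_n,\ldots,\tau_0)$ with all $\tau_j\in W'$. Braids. $\mathrm{Br}_{\tilde W}^+\subseteq\mathrm{Br}_{\tilde W}$ are the Artin–Tits braid monoid and group of $\tilde W$; $\mathrm{Br}^+=\Omega\ltimes\mathrm{Br}^+_{\tilde W}$ and $\mathrm{Br}=\Omega\ltimes\mathrm{Br}_{\tilde W}$. For $w=\delta\tilde w$ with $\delta\in\Omega,\tilde w\in\tilde W$, $b_w=\delta b_{\tilde w}$, where $b_{\tilde w}$ is the positive lift of any reduced expression of $\tilde w$. $\mathrm{Br}_{W'}^+$ and $\mathrm{Br}_{W'}$ are the submonoid and subgroup generated by the braid generators of the simple reflections in $W'$. *)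

theory Defs
  imports Complex_Main "HOL-Algebra.Bij" "HOL-Algebra.Generated_Groups" "HOL-Algebra.Multiplicative_Group"
begin

section \<open>Monoids and groups given by generators and relations\<close>

definition lprod :: "('m, 'z) monoid_scheme \<Rightarrow> 'm list \<Rightarrow> 'm" where
  "lprod M xs = foldr (mult M) xs (one M)"

inductive word_cong :: "('g list \<times> 'g list) set \<Rightarrow> 'g list \<Rightarrow> 'g list \<Rightarrow> bool"
  for R :: "('g list \<times> 'g list) set" where
  rel: "(u, v) \<in> R \<Longrightarrow> word_cong R u v"
| refl: "word_cong R u u"
| sym: "word_cong R u v \<Longrightarrow> word_cong R v u"
| trans: "word_cong R u v \<Longrightarrow> word_cong R v w \<Longrightarrow> word_cong R u w"
| append: "word_cong R u u' \<Longrightarrow> word_cong R v v' \<Longrightarrow> word_cong R (u @ v) (u' @ v')"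

definition word_class :: "('g list \<times> 'g list) set \<Rightarrow> 'g list \<Rightarrow> 'g list set" where
  "word_class R u = {v. word_cong R u v}"

definition pres_monoid ::
  "'g set \<Rightarrow> ('g list \<times> 'g list) set \<Rightarrow> 'g list set monoid" where
  "pres_monoid A R =
     \<lparr>carrier = word_class R ` lists A,
      mult = (\<lambda>C D. {w. \<exists>u\<in>C. \<exists>v\<in>D. word_cong R (u @ v) w}),
      one = word_class R []\<rparr>"

text \<open>A letter \<open>(a, True)\<close> of a group word stands for the generator \<open>a\<close>, and \<open>(a, False)\<close>
  for its formal inverse.\<close>

abbreviation pos_word :: "'g list \<Rightarrow> ('g \<times> bool) list" where
  "pos_word u \<equiv> map (\<lambda>a. (a, True)) u"

definition group_relations ::
  "'g set \<Rightarrow> ('g list \<times> 'g list) set \<Rightarrow> (('g \<times> bool) list \<times> ('g \<times> bool) list) set" where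
  "group_relations A R =
     {([(a, e), (a, \<not> e)], []) | a e. a \<in> A} \<union> {(pos_word u, pos_word v) | u v. (u, v) \<in> R}"

definition pres_group ::
  "'g set \<Rightarrow> ('g list \<times> 'g list) set \<Rightarrow> ('g \<times> bool) list set monoid" where
  "pres_group A R = pres_monoid (A \<times> UNIV) (group_relations A R)"

definition eval_word :: "('a, 'z) monoid_scheme \<Rightarrow> ('a \<times> bool) list \<Rightarrow> 'a" where
  "eval_word G u = lprod G (map (\<lambda>(s, e). if e then s else inv\<^bsub>G\<^esub> s) u)"

definition is_presentation ::
  "('a, 'z) monoid_scheme \<Rightarrow> 'a set \<Rightarrow> ('a list \<times> 'a list) set \<Rightarrow> bool" where
  "is_presentation G A R \<longleftrightarrow>
     A \<subseteq> carrier G \<and> generate G A = carrier G \<and>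
     (\<forall>u \<in> lists (A \<times> UNIV). \<forall>v \<in> lists (A \<times> UNIV).
        eval_word G u = eval_word G v \<longleftrightarrow> word_cong (group_relations A R) u v)"

section \<open>Semidirect products\<close>

text \<open>The pair \<open>(k, x)\<close> stands for the product \<open>k x\<close>, with \<open>k x k\<inverse> = \<phi> k x\<close>; hence
  \<open>(k x) (l y) = (k l) (\<phi> (l\<inverse>) x y)\<close>.\<close>

definition semidirect ::
  "('k, 'y) monoid_scheme \<Rightarrow> ('k \<Rightarrow> 'n \<Rightarrow> 'n) \<Rightarrow> ('n, 'z) monoid_scheme \<Rightarrow> ('k \<times> 'n) monoid" where
  "semidirect K \<phi> N =
     \<lparr>carrier = carrier K \<times> carrier N,
      mult = (\<lambda>(k, x) (l, y). (k \<otimes>\<^bsub>K\<^esub> l, \<phi> (inv\<^bsub>K\<^esub> l) x \<otimes>\<^bsub>N\<^esub> y)),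
      one = (\<one>\<^bsub>K\<^esub>, \<one>\<^bsub>N\<^esub>)\<rparr>"

section \<open>Twisted Coxeter groups\<close>

text \<open>\<open>group.ord\<close> is \<open>0\<close> for elements of infinite order.\<close>

definition cox_relations :: "('a, 'z) monoid_scheme \<Rightarrow> 'a set \<Rightarrow> ('a list \<times> 'a list) set" where
  "cox_relations G S =
     {(concat (replicate (group.ord G (s \<otimes>\<^bsub>G\<^esub> t)) [s, t]), []) | s t.
        s \<in> S \<and> t \<in> S \<and> group.ord G (s \<otimes>\<^bsub>G\<^esub> t) \<noteq> 0}"

definition coxeter_system :: "('a, 'z) monoid_scheme \<Rightarrow> 'a set \<Rightarrow> bool" where
  "coxeter_system G S \<longleftrightarrow>
     group G \<and> finite S \<and> S \<subseteq> carrier G \<and> (\<forall>s\<in>S. group.ord G s = 2) \<and>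
     is_presentation G S (cox_relations G S)"

definition twisted_coxeter ::
  "('a, 'z) monoid_scheme \<Rightarrow> 'a set \<Rightarrow> ('a \<Rightarrow> 'a) set \<Rightarrow> bool" where
  "twisted_coxeter G S \<Omega> \<longleftrightarrow>
     coxeter_system G S \<and> subgroup \<Omega> (AutoGroup G) \<and> (\<forall>\<delta>\<in>\<Omega>. \<delta> ` S = S)"

definition twist_group :: "('a, 'z) monoid_scheme \<Rightarrow> ('a \<Rightarrow> 'a) set \<Rightarrow> ('a \<Rightarrow> 'a) monoid" where
  "twist_group G \<Omega> = (AutoGroup G)\<lparr>carrier := \<Omega>\<rparr>"

definition tw_group ::
  "('a, 'z) monoid_scheme \<Rightarrow> ('a \<Rightarrow> 'a) set \<Rightarrow> (('a \<Rightarrow> 'a) \<times> 'a) monoid" where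
  "tw_group G \<Omega> = semidirect (twist_group G \<Omega>) (\<lambda>\<delta> x. \<delta> x) G"

definition untwisted :: "('a, 'z) monoid_scheme \<Rightarrow> 'a \<Rightarrow> ('a \<Rightarrow> 'a) \<times> 'a" where
  "untwisted G x = (\<one>\<^bsub>AutoGroup G\<^esub>, x)"

definition standard_parabolic :: "('a, 'z) monoid_scheme \<Rightarrow> 'a set \<Rightarrow> 'a set \<Rightarrow> bool" where
  "standard_parabolic G S P \<longleftrightarrow> (\<exists>J\<subseteq>S. P = generate G J)"

section \<open>The reflection representation and roots\<close>

text \<open>A vector is given by its coordinates with respect to the simple roots, that is, as a
  function vanishing outside \<open>S\<close>.\<close>

definition simple_root :: "'a \<Rightarrow> 'a \<Rightarrow> real" where
  "simple_root s = (\<lambda>t. if t = s then 1 else 0)"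

definition cox_form ::
  "('a, 'z) monoid_scheme \<Rightarrow> 'a set \<Rightarrow> ('a \<Rightarrow> real) \<Rightarrow> ('a \<Rightarrow> real) \<Rightarrow> real" where
  "cox_form G S u v =
     (\<Sum>s\<in>S. \<Sum>t\<in>S. u s * v t *
        (if group.ord G (s \<otimes>\<^bsub>G\<^esub> t) = 0 then - 1
         else - cos (pi / real (group.ord G (s \<otimes>\<^bsub>G\<^esub> t)))))"

definition simple_reflection ::
  "('a, 'z) monoid_scheme \<Rightarrow> 'a set \<Rightarrow> 'a \<Rightarrow> ('a \<Rightarrow> real) \<Rightarrow> ('a \<Rightarrow> real)" where
  "simple_reflection G S s v =
     (\<lambda>t. v t - 2 * cox_form G S (simple_root s) v * simple_root s t)"

text \<open>The action on vectors does not depend on the chosen word, because the simple reflections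
  satisfy the Coxeter relations.\<close>

definition cox_act ::
  "('a, 'z) monoid_scheme \<Rightarrow> 'a set \<Rightarrow> 'a \<Rightarrow> ('a \<Rightarrow> real) \<Rightarrow> ('a \<Rightarrow> real)" where
  "cox_act G S x v =
     foldr (simple_reflection G S) (SOME u. u \<in> lists S \<and> lprod G u = x) v"

definition twist_act :: "'a set \<Rightarrow> ('a \<Rightarrow> 'a) \<Rightarrow> ('a \<Rightarrow> real) \<Rightarrow> ('a \<Rightarrow> real)" where
  "twist_act S \<delta> v = (\<lambda>t. \<Sum>s\<in>S. v s * simple_root (\<delta> s) t)"

definition tw_act ::
  "('a, 'z) monoid_scheme \<Rightarrow> 'a set \<Rightarrow> ('a \<Rightarrow> 'a) \<times> 'a \<Rightarrow> ('a \<Rightarrow> real) \<Rightarrow> ('a \<Rightarrow> real)" where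
  "tw_act G S w v = twist_act S (fst w) (cox_act G S (snd w) v)"

definition roots :: "('a, 'z) monoid_scheme \<Rightarrow> 'a set \<Rightarrow> ('a \<Rightarrow> real) set" where
  "roots G S = {cox_act G S x (simple_root s) | x s. x \<in> carrier G \<and> s \<in> S}"

definition pos_roots :: "('a, 'z) monoid_scheme \<Rightarrow> 'a set \<Rightarrow> ('a \<Rightarrow> real) set" where
  "pos_roots G S = {\<beta> \<in> roots G S. \<forall>s\<in>S. 0 \<le> \<beta> s}"

definition neg_roots :: "('a, 'z) monoid_scheme \<Rightarrow> 'a set \<Rightarrow> ('a \<Rightarrow> real) set" where
  "neg_roots G S = (\<lambda>\<beta> t. - \<beta> t) ` pos_roots G S"

definition inversions ::
  "('a, 'z) monoid_scheme \<Rightarrow> 'a set \<Rightarrow> ('a \<Rightarrow> 'a) \<times> 'a \<Rightarrow> ('a \<Rightarrow> real) set" where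
  "inversions G S w = {\<beta> \<in> pos_roots G S. tw_act G S w \<beta> \<in> neg_roots G S}"

definition tw_length :: "('a, 'z) monoid_scheme \<Rightarrow> 'a set \<Rightarrow> ('a \<Rightarrow> 'a) \<times> 'a \<Rightarrow> nat" where
  "tw_length G S w = card (inversions G S w)"

definition fixed_roots ::
  "('a, 'z) monoid_scheme \<Rightarrow> 'a set \<Rightarrow> ('a \<Rightarrow> 'a) \<times> 'a \<Rightarrow> ('a \<Rightarrow> real) set" where
  "fixed_roots G S w = {\<beta> \<in> roots G S. tw_act G S w \<beta> = \<beta>}"

definition root_orbit ::
  "('a, 'z) monoid_scheme \<Rightarrow> 'a set \<Rightarrow> ('a \<Rightarrow> 'a) set \<Rightarrow> ('a \<Rightarrow> 'a) \<times> 'a \<Rightarrow> ('a \<Rightarrow> real)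
     \<Rightarrow> ('a \<Rightarrow> real) set" where
  "root_orbit G S \<Omega> w \<beta> = (\<lambda>g. tw_act G S g \<beta>) ` generate (tw_group G \<Omega>) {w}"

definition stable_roots ::
  "('a, 'z) monoid_scheme \<Rightarrow> 'a set \<Rightarrow> ('a \<Rightarrow> 'a) set \<Rightarrow> ('a \<Rightarrow> 'a) \<times> 'a \<Rightarrow> ('a \<Rightarrow> real) set" where
  "stable_roots G S \<Omega> w =
     {\<beta> \<in> roots G S. root_orbit G S \<Omega> w \<beta> \<subseteq> pos_roots G S \<or> root_orbit G S \<Omega> w \<beta> \<subseteq> neg_roots G S}"

definition parabolic_subsystem ::
  "('a, 'z) monoid_scheme \<Rightarrow> 'a set \<Rightarrow> 'a set \<Rightarrow> ('a \<Rightarrow> real) set" where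
  "parabolic_subsystem G S J =
     {\<beta> \<in> roots G S. \<exists>c. \<beta> = (\<lambda>t. \<Sum>s\<in>J. c s * simple_root s t)}"

definition convex_elt ::
  "('a, 'z) monoid_scheme \<Rightarrow> 'a set \<Rightarrow> ('a \<Rightarrow> 'a) set \<Rightarrow> ('a \<Rightarrow> 'a) \<times> 'a \<Rightarrow> bool" where
  "convex_elt G S \<Omega> w \<longleftrightarrow> (\<exists>J\<subseteq>S. stable_roots G S \<Omega> w = parabolic_subsystem G S J)"

definition firmly_convex ::
  "('a, 'z) monoid_scheme \<Rightarrow> 'a set \<Rightarrow> ('a \<Rightarrow> 'a) set \<Rightarrow> ('a \<Rightarrow> 'a) \<times> 'a \<Rightarrow> bool" where
  "firmly_convex G S \<Omega> w \<longleftrightarrow>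
     convex_elt G S \<Omega> w \<and> fixed_roots G S w = stable_roots G S \<Omega> w"

section \<open>Mixed shifts\<close>

definition strong_conj_step ::
  "('a, 'z) monoid_scheme \<Rightarrow> 'a set \<Rightarrow> ('a \<Rightarrow> 'a) set \<Rightarrow> 'a \<Rightarrow> ('a \<Rightarrow> 'a) \<times> 'a \<Rightarrow> bool" where
  "strong_conj_step G S \<Omega> \<tau> w \<longleftrightarrow>
     (let W = tw_group G \<Omega>; t = untwisted G \<tau>; l = tw_length G S
      in l (t \<otimes>\<^bsub>W\<^esub> w) = l w + l t \<or> l (w \<otimes>\<^bsub>W\<^esub> inv\<^bsub>W\<^esub> t) = l w + l t)"

text \<open>The difference of lengths is written additively, since subtraction on \<open>nat\<close> truncates.\<close>

definition cyclic_shift_step ::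
  "('a, 'z) monoid_scheme \<Rightarrow> 'a set \<Rightarrow> ('a \<Rightarrow> 'a) set \<Rightarrow> 'a \<Rightarrow> ('a \<Rightarrow> 'a) \<times> 'a \<Rightarrow> bool" where
  "cyclic_shift_step G S \<Omega> \<tau> w \<longleftrightarrow>
     (let W = tw_group G \<Omega>; t = untwisted G \<tau>; l = tw_length G S
      in l (t \<otimes>\<^bsub>W\<^esub> w) + l t = l w \<or> l (w \<otimes>\<^bsub>W\<^esub> inv\<^bsub>W\<^esub> t) + l t = l w)"

definition mixed_step ::
  "('a, 'z) monoid_scheme \<Rightarrow> 'a set \<Rightarrow> ('a \<Rightarrow> 'a) set \<Rightarrow> 'a \<Rightarrow>
     ('a \<Rightarrow> 'a) \<times> 'a \<Rightarrow> ('a \<Rightarrow> 'a) \<times> 'a \<Rightarrow> bool" where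
  "mixed_step G S \<Omega> \<tau> w w' \<longleftrightarrow>
     w' = untwisted G \<tau> \<otimes>\<^bsub>tw_group G \<Omega>\<^esub> w \<otimes>\<^bsub>tw_group G \<Omega>\<^esub> inv\<^bsub>tw_group G \<Omega>\<^esub> (untwisted G \<tau>) \<and>
     tw_length G S w = tw_length G S w' \<and>
     (strong_conj_step G S \<Omega> \<tau> w \<or> cyclic_shift_step G S \<Omega> \<tau> w)"

text \<open>Sequences of conjugators are the lists \<open>[\<tau>\<^sub>n, \<dots>, \<tau>\<^sub>0]\<close>: the head is applied last.\<close>

inductive_set tran_mixed ::
  "('a, 'z) monoid_scheme \<Rightarrow> 'a set \<Rightarrow> ('a \<Rightarrow> 'a) set \<Rightarrow> 'a set \<Rightarrow> ('a \<Rightarrow> 'a) \<times> 'a \<Rightarrow>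
     ('a list \<times> (('a \<Rightarrow> 'a) \<times> 'a)) set"
  for G :: "('a, 'z) monoid_scheme" and S :: "'a set" and \<Omega> :: "('a \<Rightarrow> 'a) set"
    and P :: "'a set" and w :: "('a \<Rightarrow> 'a) \<times> 'a" where
  Nil: "([], w) \<in> tran_mixed G S \<Omega> P w"
| Cons: "(\<tau>s, v) \<in> tran_mixed G S \<Omega> P w \<Longrightarrow> \<tau> \<in> P \<Longrightarrow> mixed_step G S \<Omega> \<tau> v v' \<Longrightarrow>
    (\<tau> # \<tau>s, v') \<in> tran_mixed G S \<Omega> P w"

definition Tran_mixed ::
  "('a, 'z) monoid_scheme \<Rightarrow> 'a set \<Rightarrow> ('a \<Rightarrow> 'a) set \<Rightarrow> 'a set \<Rightarrow>
     ('a \<Rightarrow> 'a) \<times> 'a \<Rightarrow> ('a \<Rightarrow> 'a) \<times> 'a \<Rightarrow> 'a list set" where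
  "Tran_mixed G S \<Omega> P w w' = {\<tau>s. (\<tau>s, w') \<in> tran_mixed G S \<Omega> P w}"

definition mixed_shift_by ::
  "('a, 'z) monoid_scheme \<Rightarrow> 'a set \<Rightarrow> ('a \<Rightarrow> 'a) set \<Rightarrow> 'a set \<Rightarrow>
     ('a \<Rightarrow> 'a) \<times> 'a \<Rightarrow> ('a \<Rightarrow> 'a) \<times> 'a \<Rightarrow> bool" where
  "mixed_shift_by G S \<Omega> P w w' \<longleftrightarrow> (\<exists>\<tau>s. \<tau>s \<in> Tran_mixed G S \<Omega> P w w')"

abbreviation mixed_shift ::
  "('a, 'z) monoid_scheme \<Rightarrow> 'a set \<Rightarrow> ('a \<Rightarrow> 'a) set \<Rightarrow>
     ('a \<Rightarrow> 'a) \<times> 'a \<Rightarrow> ('a \<Rightarrow> 'a) \<times> 'a \<Rightarrow> bool" where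
  "mixed_shift G S \<Omega> \<equiv> mixed_shift_by G S \<Omega> (carrier G)"

section \<open>Braids\<close>

primrec alternating :: "nat \<Rightarrow> 'g \<Rightarrow> 'g \<Rightarrow> 'g list" where
  "alternating 0 s t = []"
| "alternating (Suc n) s t = s # alternating n t s"

definition braid_relations :: "('a, 'z) monoid_scheme \<Rightarrow> 'a set \<Rightarrow> ('a list \<times> 'a list) set" where
  "braid_relations G S =
     {(alternating (group.ord G (s \<otimes>\<^bsub>G\<^esub> t)) s t, alternating (group.ord G (s \<otimes>\<^bsub>G\<^esub> t)) t s) | s t.
        s \<in> S \<and> t \<in> S \<and> s \<noteq> t \<and> group.ord G (s \<otimes>\<^bsub>G\<^esub> t) \<noteq> 0}"

text \<open>A twist acts on the braid monoid and group by permuting the letters of words, and sends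
  congruence classes to congruence classes.\<close>

definition Br_plus ::
  "('a, 'z) monoid_scheme \<Rightarrow> 'a set \<Rightarrow> ('a \<Rightarrow> 'a) set \<Rightarrow> (('a \<Rightarrow> 'a) \<times> 'a list set) monoid" where
  "Br_plus G S \<Omega> =
     semidirect (twist_group G \<Omega>) (\<lambda>\<delta> C. map \<delta> ` C) (pres_monoid S (braid_relations G S))"

definition Br ::
  "('a, 'z) monoid_scheme \<Rightarrow> 'a set \<Rightarrow> ('a \<Rightarrow> 'a) set \<Rightarrow>
     (('a \<Rightarrow> 'a) \<times> ('a \<times> bool) list set) monoid" where
  "Br G S \<Omega> =
     semidirect (twist_group G \<Omega>) (\<lambda>\<delta> C. map (apfst \<delta>) ` C) (pres_group S (braid_relations G S))"

definition reduced_expr :: "('a, 'z) monoid_scheme \<Rightarrow> 'a set \<Rightarrow> 'a \<Rightarrow> 'a list \<Rightarrow> bool" where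
  "reduced_expr G S x u \<longleftrightarrow>
     u \<in> lists S \<and> lprod G u = x \<and> (\<forall>v \<in> lists S. lprod G v = x \<longrightarrow> length u \<le> length v)"

text \<open>By Matsumoto's theorem the two lifts below do not depend on the chosen reduced expression;
  the first takes values in the braid monoid and the second in the braid group.\<close>

definition braid_plus ::
  "('a, 'z) monoid_scheme \<Rightarrow> 'a set \<Rightarrow> ('a \<Rightarrow> 'a) \<times> 'a \<Rightarrow> ('a \<Rightarrow> 'a) \<times> 'a list set" where
  "braid_plus G S w =
     (fst w, word_class (braid_relations G S) (SOME u. reduced_expr G S (snd w) u))"

definition braid ::
  "('a, 'z) monoid_scheme \<Rightarrow> 'a set \<Rightarrow> ('a \<Rightarrow> 'a) \<times> 'a \<Rightarrow> ('a \<Rightarrow> 'a) \<times> ('a \<times> bool) list set" where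
  "braid G S w =
     (fst w, word_class (group_relations S (braid_relations G S))
               (pos_word (SOME u. reduced_expr G S (snd w) u)))"

definition monoid_generate :: "('m, 'z) monoid_scheme \<Rightarrow> 'm set \<Rightarrow> 'm set" where
  "monoid_generate M A = \<Inter>{H. submonoid H M \<and> A \<subseteq> H}"

definition Br_plus_sub ::
  "('a, 'z) monoid_scheme \<Rightarrow> 'a set \<Rightarrow> ('a \<Rightarrow> 'a) set \<Rightarrow> 'a set \<Rightarrow> (('a \<Rightarrow> 'a) \<times> 'a list set) set" where
  "Br_plus_sub G S \<Omega> P =
     monoid_generate (Br_plus G S \<Omega>)
       ((\<lambda>s. (\<one>\<^bsub>AutoGroup G\<^esub>, word_class (braid_relations G S) [s])) ` (S \<inter> P))"

definition Br_sub ::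
  "('a, 'z) monoid_scheme \<Rightarrow> 'a set \<Rightarrow> ('a \<Rightarrow> 'a) set \<Rightarrow> 'a set \<Rightarrow>
     (('a \<Rightarrow> 'a) \<times> ('a \<times> bool) list set) set" where
  "Br_sub G S \<Omega> P =
     generate (Br G S \<Omega>)
       ((\<lambda>s. (\<one>\<^bsub>AutoGroup G\<^esub>, word_class (group_relations S (braid_relations G S)) [(s, True)]))
          ` (S \<inter> P))"

definition Tran_braid ::
  "('a, 'z) monoid_scheme \<Rightarrow> 'a set \<Rightarrow> ('a \<Rightarrow> 'a) set \<Rightarrow> 'a set \<Rightarrow>
     ('a \<Rightarrow> 'a) \<times> 'a list set \<Rightarrow> ('a \<Rightarrow> 'a) \<times> 'a list set \<Rightarrow> (('a \<Rightarrow> 'a) \<times> 'a list set) set" where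
  "Tran_braid G S \<Omega> P b b' =
     {\<tau> \<in> Br_plus_sub G S \<Omega> P. \<tau> \<otimes>\<^bsub>Br_plus G S \<Omega>\<^esub> b = b' \<otimes>\<^bsub>Br_plus G S \<Omega>\<^esub> \<tau>}"

end

theory Submission
  imports Defs
begin

text \<open>
  Two ideas carry the proof, one for each part.

  \<^bold>\<open>Stable roots.\<close> Let \<open>w' = \<tau> w \<tau>\<inverse>\<close> have the same length as \<open>w\<close>, and let \<open>O\<close> be a \<open>w\<close>-orbit of positive
  roots. The orbit of a translated root under \<open>w'\<close> lies in \<open>\<tau>(O)\<close>, so it is enough that \<open>\<tau>\<close> inverts
  either no root of \<open>O\<close> or all of them. If \<open>\<tau>\<close> cancels against \<open>w\<close>, every root inverted by \<open>\<tau>\<close> has a negative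
  preimage under \<open>w\<close>, hence none lies in \<open>O\<close>. If the lengths of \<open>\<tau>\<close> and \<open>w\<close> add up, then so do those of \<open>w'\<close>
  and \<open>\<tau>\<close>, and \<open>w\<close> maps the finite set of roots of \<open>O\<close> inverted by \<open>\<tau>\<close> into itself; it permutes this set,
  which is therefore empty or equal to \<open>O\<close> (\<open>positive_orbit\<close>). Multiplication on the other side follows by
  inverting \<open>w\<close>, negative orbits by changing signs, and the opposite inclusion by reversing the shift.

  \<^bold>\<open>Braids.\<close> Let \<open>\<phi>\<close> be conjugation by the inverse of the twist of \<open>w\<close>. A positive braid \<open>t\<close> conjugates the
  simple braid \<open>x\<close> to the simple braid \<open>x'\<close> when \<open>\<phi>(t) x = x' t\<close>. The largest simple right divisor of
  \<open>\<phi>(t) x\<close> has the form \<open>\<phi>(c) x\<close>, where \<open>c\<close> right divides \<open>t\<close>. Being simple, \<open>c\<close> right divides \<open>\<phi>(c) x = y c\<close>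
  by maximality, so \<open>c\<close> is a strong conjugation from \<open>x\<close> to another simple braid \<open>y\<close>, and it can be split off from
  \<open>t\<close> (\<open>greedy_step\<close>). If \<open>c\<close> is trivial, each letter that right divides \<open>t\<close> also right divides \<open>x\<close>; then the same
  argument for the complement \<open>x\<inverse> \<Delta>\<close> in the Garside element \<open>\<Delta>\<close> gives a nontrivial \<open>c\<close>, and it is a cyclic shift
  for \<open>x\<close> (\<open>conjugation_step\<close>). Induction on the length of \<open>t\<close> yields the surjectivity (\<open>tran_exists\<close>).

  For conjugation by an arbitrary element of the braid subgroup, write it as \<open>p q\<inverse>\<close> with positive \<open>p, q\<close>
  without common right divisor. Then \<open>\<phi>(q)\<inverse> x q = \<phi>(p)\<inverse> x' p\<close> is a fraction with two coprime denominators and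
  so is positive; the same applies to its complement in \<open>\<Delta>\<close>, so it is a simple braid \<open>k\<close>
  (\<open>simple_between\<close>). The positive braids \<open>q\<close> and \<open>p\<close> conjugate \<open>k\<close> to \<open>x\<close> and to \<open>x'\<close>, and mixed shifts are reversible.

  The prerequisites are developed from the presentation: Tits' theorem that every root is positive or negative
  (\<open>act_simple_nonneg\<close>), which yields the exchange condition, Matsumoto's theorem and the count of inversions;
  and for a finite Coxeter group the Garside structure of the braid monoid. The latter rests on meets in the
  weak order: they define an action of words on pairs of a simple head and a tail, from which
  cancellation and the largest simple divisor are read off, and then greatest common divisors follow by Newman's
  confluence argument.
\<close>


section \<open>Words in the simple reflections\<close>

locale coxeter = group G for G :: "('a, 'z) monoid_scheme" (structure) +
  fixes S :: "'a set"
  assumes coxeter_system: "coxeter_system G S"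
begin

abbreviation lp :: "'a list \<Rightarrow> 'a" where "lp \<equiv> lprod G"
abbreviation m :: "'a \<Rightarrow> 'a \<Rightarrow> nat" where "m s t \<equiv> ord (s \<otimes> t)"

lemma S_finite: "finite S"
  and S_carrier: "S \<subseteq> carrier G"
  and S_ord: "s \<in> S \<Longrightarrow> ord s = 2"
  and presentation: "is_presentation G S (cox_relations G S)"
  using coxeter_system by (auto simp: coxeter_system_def)

lemma S_closed [simp, intro]: "s \<in> S \<Longrightarrow> s \<in> carrier G"
  using S_carrier by auto

lemma S_square [simp]: "s \<in> S \<Longrightarrow> s \<otimes> s = \<one>"
  using pow_ord_eq_1[of s] S_ord[of s] by (simp add: numeral_2_eq_2)

lemma S_inv [simp]: "s \<in> S \<Longrightarrow> inv s = s"
  by (simp add: inv_equality)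

lemma S_neq_one: "s \<in> S \<Longrightarrow> s \<noteq> \<one>"
  using S_ord[of \<one>] ord_id by auto

lemma S_cancel [simp]: "s \<in> S \<Longrightarrow> x \<in> carrier G \<Longrightarrow> s \<otimes> (s \<otimes> x) = x"
  by (simp add: m_assoc[symmetric])

lemma S_cancel_right [simp]: "s \<in> S \<Longrightarrow> x \<in> carrier G \<Longrightarrow> x \<otimes> s \<otimes> s = x"
  by (simp add: m_assoc)

lemma lists_carrier: "set u \<subseteq> S \<Longrightarrow> set u \<subseteq> carrier G"
  using S_carrier by auto

lemma lp_Nil [simp]: "lp [] = \<one>"
  and lp_Cons [simp]: "lp (x # xs) = x \<otimes> lp xs"
  by (simp_all add: lprod_def)

lemma lp_closed' [simp]: "set u \<subseteq> carrier G \<Longrightarrow> lp u \<in> carrier G"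
  by (induct u) auto

lemma lp_closed [simp, intro]: "set u \<subseteq> S \<Longrightarrow> lp u \<in> carrier G"
  by (simp add: lists_carrier)

lemma lp_append': "set u \<subseteq> carrier G \<Longrightarrow> set v \<subseteq> carrier G \<Longrightarrow> lp (u @ v) = lp u \<otimes> lp v"
  by (induct u) (auto simp: m_assoc)

lemma lp_append [simp]: "set u \<subseteq> S \<Longrightarrow> set v \<subseteq> S \<Longrightarrow> lp (u @ v) = lp u \<otimes> lp v"
  by (simp add: lp_append' lists_carrier)

lemma lp_rev: "set u \<subseteq> S \<Longrightarrow> lp (rev u) = inv (lp u)"
  by (induct u) (simp_all add: inv_mult_group)

lemma lp_replicate: "x \<in> carrier G \<Longrightarrow> y \<in> carrier G \<Longrightarrow>
    lp (concat (replicate n [x, y])) = (x \<otimes> y) [^] n"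
proof (induct n)
  case (Suc n)
  have "(x \<otimes> y) \<otimes> (x \<otimes> y) [^] n = (x \<otimes> y) [^] Suc n"
    using Suc.prems by (simp only: nat_pow_Suc2 m_closed)
  then show ?case using Suc by (simp add: m_assoc)
qed simp

lemma eval_pos_word: "set u \<subseteq> S \<Longrightarrow> eval_word G (pos_word u) = lp u"
  by (simp add: eval_word_def o_def)

text \<open>The simple reflections are involutions, so words without inverses suffice.\<close>

lemma word_exists:
  assumes "J \<subseteq> S" "x \<in> generate G J" obtains u where "set u \<subseteq> J" "lp u = x"
proof -
  have "\<exists>u. set u \<subseteq> J \<and> lp u = x" using assms(2)
  proof induct
    case one show ?case by (rule exI[of _ "[]"]) auto
  next
    case (incl h) then show ?case using assms by (intro exI[of _ "[h]"]) auto
  next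
    case (inv h) then show ?case using assms by (intro exI[of _ "[h]"]) auto
  next
    case (eng h1 h2)
    then obtain u v where "set u \<subseteq> J" "lp u = h1" "set v \<subseteq> J" "lp v = h2" by auto
    moreover from this have "set u \<subseteq> S" "set v \<subseteq> S" using assms(1) by auto
    ultimately show ?case by (intro exI[of _ "u @ v"]) auto
  qed
  then show thesis using that by auto
qed

lemma word_ex: "x \<in> carrier G \<Longrightarrow> \<exists>u. set u \<subseteq> S \<and> lp u = x"
  using word_exists[of S x] presentation by (auto simp: is_presentation_def)

lemma lp_in_generate: "set u \<subseteq> J \<Longrightarrow> J \<subseteq> S \<Longrightarrow> lp u \<in> generate G J"
  by (induct u) (auto intro: generate.intros)

text \<open>A family of involutions satisfying the Coxeter relations factors through the group. This gives
  the sign character and the geometric representation.\<close>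

lemma foldr_word_invariant:
  fixes K :: "'a \<Rightarrow> 'b \<Rightarrow> 'b"
  assumes inv: "\<And>s b. s \<in> S \<Longrightarrow> K s (K s b) = b"
    and rel: "\<And>s t b. s \<in> S \<Longrightarrow> t \<in> S \<Longrightarrow> m s t \<noteq> 0 \<Longrightarrow>
        foldr K (concat (replicate (m s t) [s, t])) b = b"
    and u: "set u \<subseteq> S" and v: "set v \<subseteq> S" and eq: "lp u = lp v"
  shows "foldr K u b = foldr K v b"
proof -
  have "word_cong (group_relations S (cox_relations G S)) (pos_word u) (pos_word v)"
  proof -
    have "eval_word G (pos_word u) = eval_word G (pos_word v)"
      using u v eq by (simp only: eval_pos_word)
    moreover have "pos_word u \<in> lists (S \<times> UNIV)" "pos_word v \<in> lists (S \<times> UNIV)"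
      using u v by auto
    ultimately show ?thesis using presentation by (simp add: is_presentation_def)
  qed
  then have "foldr K (map fst (pos_word u)) b = foldr K (map fst (pos_word v)) b"
  proof (induct arbitrary: b)
    case (rel u v)
    then consider (inverse) a e where "u = [(a, e), (a, \<not> e)]" "v = []" "a \<in> S"
      | (relation) s t where "u = pos_word (concat (replicate (m s t) [s, t]))" "v = []"
          "s \<in> S" "t \<in> S" "m s t \<noteq> 0"
      unfolding group_relations_def cox_relations_def by blast
    then show ?case
    proof cases
      case inverse then show ?thesis by (simp add: inv)
    next
      case relation
      have "map fst u = concat (replicate (m s t) [s, t])" by (simp add: relation(1) o_def)
      then show ?thesis using assms(2)[OF relation(3-5)] relation(2) by simp
    qed
  qed auto
  then show ?thesis by (simp add: o_def)
qed

section \<open>Length\<close>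

definition len :: "'a \<Rightarrow> nat" where
  "len x = (LEAST n. \<exists>u. set u \<subseteq> S \<and> lp u = x \<and> length u = n)"

abbreviation reduced :: "'a list \<Rightarrow> bool" where
  "reduced u \<equiv> set u \<subseteq> S \<and> length u = len (lp u)"

lemma len_ex: assumes "x \<in> carrier G" obtains u where "set u \<subseteq> S" "lp u = x" "length u = len x"
proof -
  have "\<exists>n. \<exists>u. set u \<subseteq> S \<and> lp u = x \<and> length u = n" using word_ex[OF assms] by auto
  from LeastI_ex[OF this] show thesis using that by (auto simp: len_def)
qed

lemma len_le: "set u \<subseteq> S \<Longrightarrow> len (lp u) \<le> length u"
  unfolding len_def by (rule Least_le) auto

lemma len_one [simp]: "len \<one> = 0"
  using len_le[of "[]"] by simp

lemma len_eq_0: "x \<in> carrier G \<Longrightarrow> len x = 0 \<longleftrightarrow> x = \<one>"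
  by (metis len_ex len_one length_0_conv lp_Nil)

lemma len_mult: "x \<in> carrier G \<Longrightarrow> y \<in> carrier G \<Longrightarrow> len (x \<otimes> y) \<le> len x + len y"
  by (metis len_ex len_le length_append lp_append set_append Un_least)

lemma len_inv [simp]: assumes "x \<in> carrier G" shows "len (inv x) = len x"
proof -
  have le: "len (inv y) \<le> len y" if "y \<in> carrier G" for y
  proof -
    obtain u where u: "set u \<subseteq> S" "lp u = y" "length u = len y" using len_ex \<open>y \<in> carrier G\<close> by metis
    then have "set (rev u) \<subseteq> S" by simp
    then show ?thesis using u len_le[of "rev u"] by (simp add: lp_rev)
  qed
  show ?thesis using le[OF assms] le[of "inv x"] assms by simp
qed

text \<open>The Coxeter relations have even length, whence a sign character.\<close>

lemma length_parity:
  assumes "set u \<subseteq> S" "set v \<subseteq> S" "lp u = lp v" shows "even (length u) = even (length v)"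
proof -
  have *: "foldr (\<lambda>s. Not) w b = (if even (length w) then b else \<not> b)" for w :: "'a list" and b
    by (induct w) auto
  have "foldr (\<lambda>s. Not) u True = foldr (\<lambda>s. Not) v True"
    by (rule foldr_word_invariant[OF _ _ assms]) (auto simp: * length_concat sum_list_replicate)
  then show ?thesis by (auto simp: * split: if_splits)
qed

lemma len_S [simp]: "s \<in> S \<Longrightarrow> len s = 1"
  using len_le[of "[s]"] len_eq_0[of s] S_neq_one[of s] by simp

lemma len_mult_parity:
  assumes "x \<in> carrier G" "y \<in> carrier G" shows "even (len (x \<otimes> y)) = even (len x + len y)"
proof -
  obtain u v w where *: "set u \<subseteq> S" "lp u = x" "length u = len x"
      "set v \<subseteq> S" "lp v = y" "length v = len y"
      "set w \<subseteq> S" "lp w = x \<otimes> y" "length w = len (x \<otimes> y)"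
    using len_ex assms m_closed by metis
  then have "even (length w) = even (length (u @ v))" using length_parity[of w "u @ v"] by simp
  with * show ?thesis by simp
qed

lemma len_mult_S:
  assumes "x \<in> carrier G" "s \<in> S" shows "len (x \<otimes> s) = len x + 1 \<or> len (x \<otimes> s) + 1 = len x"
proof -
  have "len (x \<otimes> s) \<le> len x + 1" using len_mult[of x s] assms by simp
  moreover have "len x \<le> len (x \<otimes> s) + 1" using len_mult[of "x \<otimes> s" s] assms by simp
  moreover have "even (len (x \<otimes> s)) \<noteq> even (len x)" using len_mult_parity[of x s] assms by simp
  ultimately show ?thesis by presburger
qed

lemma len_S_mult:
  assumes "x \<in> carrier G" "s \<in> S" shows "len (s \<otimes> x) = len x + 1 \<or> len (s \<otimes> x) + 1 = len x"
proof -
  have "len (s \<otimes> x) = len (inv x \<otimes> s)" using assms len_inv[of "s \<otimes> x"]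
    by (simp add: inv_mult_group)
  then show ?thesis using len_mult_S[of "inv x" s] assms by simp
qed

lemma reduced_append:
  assumes "reduced (u @ v)" shows "reduced u" "reduced v"
proof -
  have uv: "set u \<subseteq> S" "set v \<subseteq> S" using assms by auto
  have "length u + length v \<le> len (lp u) + len (lp v)"
    using len_mult[of "lp u" "lp v"] uv assms by simp
  then show "reduced u" "reduced v" using len_le[of u] len_le[of v] uv by simp_all
qed

lemma reduced_ConsD: "reduced (s # u) \<Longrightarrow> reduced u"
  using reduced_append(2)[of "[s]" u] unfolding append_Cons append_Nil .

lemma reduced_rev: "reduced (rev u) = reduced u"
  by (cases "set u \<subseteq> S") (simp_all add: lp_rev)

lemma reduced_expr_iff: "reduced_expr G S x u \<longleftrightarrow> reduced u \<and> lp u = x"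
proof
  assume "reduced_expr G S x u"
  then have u: "set u \<subseteq> S" "lp u = x" "\<And>v. set v \<subseteq> S \<Longrightarrow> lp v = x \<Longrightarrow> length u \<le> length v"
    by (auto simp: reduced_expr_def lists_eq_set)
  obtain v where "set v \<subseteq> S" "lp v = x" "length v = len x" using len_ex[of x] u by blast
  then have "length u = len x" using u(3)[of v] len_le[of u] u(1,2) by simp
  then show "reduced u \<and> lp u = x" using u by simp
next
  assume u: "reduced u \<and> lp u = x"
  then have "length u \<le> length v" if "set v \<subseteq> S" "lp v = x" for v using len_le[of v] that by simp
  then show "reduced_expr G S x u" using u unfolding reduced_expr_def lists_eq_set by blast
qed

section \<open>The geometric representation\<close>

definition cf :: "'a \<Rightarrow> 'a \<Rightarrow> real" where
  "cf s t = (if m s t = 0 then - 1 else - cos (pi / real (m s t)))"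

abbreviation B :: "('a \<Rightarrow> real) \<Rightarrow> ('a \<Rightarrow> real) \<Rightarrow> real" where "B \<equiv> cox_form G S"
abbreviation \<alpha> :: "'a \<Rightarrow> 'a \<Rightarrow> real" where "\<alpha> \<equiv> simple_root"
abbreviation \<sigma> :: "'a \<Rightarrow> ('a \<Rightarrow> real) \<Rightarrow> ('a \<Rightarrow> real)" where "\<sigma> \<equiv> simple_reflection G S"
abbreviation act :: "'a \<Rightarrow> ('a \<Rightarrow> real) \<Rightarrow> ('a \<Rightarrow> real)" where "act \<equiv> cox_act G S"

lemma B_cf: "B u v = (\<Sum>s\<in>S. \<Sum>t\<in>S. u s * v t * cf s t)"
  by (simp add: cox_form_def cf_def)

lemma ord_swap: "s \<in> S \<Longrightarrow> t \<in> S \<Longrightarrow> m s t = m t s"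
  using ord_inv[of "s \<otimes> t"] by (simp add: inv_mult_group)

lemma cf_sym: "s \<in> S \<Longrightarrow> t \<in> S \<Longrightarrow> cf s t = cf t s"
  by (simp add: cf_def ord_swap)

lemma cf_self [simp]: "s \<in> S \<Longrightarrow> cf s s = 1"
  by (simp add: cf_def)

lemma B_sym: "B u v = B v u"
proof -
  have "B u v = (\<Sum>t\<in>S. \<Sum>s\<in>S. u s * v t * cf s t)" unfolding B_cf by (rule sum.swap)
  also have "\<dots> = B v u" unfolding B_cf
    by (rule sum.cong[OF HOL.refl], rule sum.cong[OF HOL.refl]) (metis cf_sym mult.commute)
  finally show ?thesis .
qed

lemma B_lin: "B u (\<lambda>t. a * v t + b * w t) = a * B u v + b * B u w"
  by (simp add: B_cf algebra_simps sum.distrib sum_distrib_left)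

lemma B_lin1: "B (\<lambda>t. a * v t + b * w t) u = a * B v u + b * B w u"
  using B_lin B_sym by metis

lemma B_simple: assumes "s \<in> S" shows "B (\<alpha> s) v = (\<Sum>t\<in>S. v t * cf s t)"
proof -
  have "B (\<alpha> s) v = (\<Sum>s'\<in>S. if s' = s then \<Sum>t\<in>S. v t * cf s t else 0)"
    unfolding B_cf simple_root_def by (intro sum.cong HOL.refl) auto
  then show ?thesis using assms S_finite by simp
qed

lemma B_simple_simple: "s \<in> S \<Longrightarrow> t \<in> S \<Longrightarrow> B (\<alpha> s) (\<alpha> t) = cf s t"
  by (simp add: B_simple) (simp add: simple_root_def S_finite if_distrib[of "\<lambda>x. x * _"] cong: if_cong)

lemma \<sigma>_def: "\<sigma> s v = (\<lambda>t. 1 * v t + (- 2 * B (\<alpha> s) v) * \<alpha> s t)"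
  by (simp add: simple_reflection_def)

lemma \<sigma>_lin: "\<sigma> s (\<lambda>t. a * v t + b * w t) = (\<lambda>t. a * \<sigma> s v t + b * \<sigma> s w t)"
  by (simp add: simple_reflection_def B_lin algebra_simps)

lemma \<sigma>_\<sigma>: "s \<in> S \<Longrightarrow> \<sigma> s (\<sigma> s v) = v"
  unfolding \<sigma>_def B_lin by (auto simp: B_simple_simple algebra_simps)

lemma B_\<sigma>: "s \<in> S \<Longrightarrow> B (\<sigma> s u) (\<sigma> s v) = B u v"
  unfolding \<sigma>_def B_lin B_lin1 by (simp add: B_simple_simple B_sym[of u "\<alpha> s"] algebra_simps)

lemma foldr_\<sigma>_lin:
  "foldr \<sigma> u (\<lambda>t. a * v t + b * w t) = (\<lambda>t. a * foldr \<sigma> u v t + b * foldr \<sigma> u w t)"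
  by (induct u) (auto simp: \<sigma>_lin)

subsection \<open>Dihedral subgroups\<close>

lemma alternating_nth: "alternating n s t = map (\<lambda>i. if even i then s else t) [0..<n]"
proof (induct n arbitrary: s t)
  case (Suc n)
  have "map (\<lambda>i. if even i then s else t) [0..<Suc n] =
      s # map (\<lambda>i. if even i then t else s) [0..<n]"
    by (simp add: upt_conv_Cons map_Suc_upt[symmetric] o_def del: upt_Suc)
  then show ?case using Suc by simp
qed simp

lemma length_alternating [simp]: "length (alternating n s t) = n"
  by (simp add: alternating_nth)

lemma set_alternating_subset: "s \<in> J \<Longrightarrow> t \<in> J \<Longrightarrow> set (alternating n s t) \<subseteq> J"
  by (auto simp: alternating_nth)

lemma alternating_snoc: "alternating (Suc n) s t = alternating n s t @ [if even n then s else t]"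
  by (simp add: alternating_nth)

lemma set_alternating: "2 \<le> n \<Longrightarrow> set (alternating n s t) = {s, t}"
proof -
  assume "2 \<le> n"
  then obtain k where "n = Suc (Suc k)" by (metis add_2_eq_Suc le_Suc_ex)
  moreover have "set (alternating k s t) \<subseteq> {s, t}" by (auto simp: alternating_nth)
  ultimately show ?thesis by auto
qed

lemma alternating_split:
  "alternating (i + j) s t = alternating i s t @ (if even i then alternating j s t else alternating j t s)"
  by (induct i arbitrary: s t) auto

lemma rev_alternating:
  "rev (alternating n s t) = (if even n then alternating n t s else alternating n s t)"
  by (rule nth_equalityI) (auto simp: alternating_nth rev_nth)

lemma alternating_double: "alternating (2 * n) s t = concat (replicate n [s, t])"
  by (induct n) auto

text \<open>Why the braid relation holds: the second half of a full period, read backwards, is the other side of the braid relation.\<close>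

lemma lp_alternating_eq:
  assumes "s \<in> S" "t \<in> S" "m s t \<noteq> 0"
  shows "lp (alternating (m s t) s t) = lp (alternating (m s t) t s)"
proof -
  let ?n = "m s t"
  note al = set_alternating_subset[of _ S]
  have "alternating (?n + ?n) s t = alternating ?n s t @ rev (alternating ?n t s)"
    by (auto simp: alternating_split rev_alternating)
  then have "lp (alternating ?n s t) \<otimes> inv (lp (alternating ?n t s)) = lp (alternating (2 * ?n) s t)"
    using assms al[of t s ?n]
    by (simp add: mult_2 lp_append lp_rev set_alternating_subset)
  also have "\<dots> = \<one>" using assms by (simp add: alternating_double lp_replicate pow_ord_eq_1)
  finally show ?thesis using assms al by (metis inv_closed inv_equality inv_inv lp_closed)
qed

lemma m_ge_2: "s \<in> S \<Longrightarrow> t \<in> S \<Longrightarrow> s \<noteq> t \<Longrightarrow> m s t \<noteq> 0 \<Longrightarrow> 2 \<le> m s t"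
proof (rule ccontr)
  assume *: "s \<in> S" "t \<in> S" "s \<noteq> t" "m s t \<noteq> 0" "\<not> 2 \<le> m s t"
  then have "m s t = 1" by simp
  then have "s \<otimes> t = \<one>" using * ord_eq_1[of "s \<otimes> t"] by simp
  then have "inv t = s" using * by (intro inv_equality) auto
  then show False using * by simp
qed

text \<open>The coefficients of the roots of the dihedral group of \<open>s, t\<close> in terms of the two simple roots: the values of
  the Chebyshev polynomials of the second kind at \<open>cos (\<pi>/m)\<close>, or at \<open>1\<close> if the product has infinite order.\<close>

definition dih :: "'a \<Rightarrow> 'a \<Rightarrow> nat \<Rightarrow> real" where
  "dih s t k = (if m s t = 0 then real k else sin (real k * pi / real (m s t)) / sin (pi / real (m s t)))"

lemma sin_pi_m: assumes "s \<in> S" "t \<in> S" "s \<noteq> t" "m s t \<noteq> 0" shows "sin (pi / real (m s t)) > 0"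
proof (rule sin_gt_zero)
  have "2 \<le> m s t" using m_ge_2 assms by simp
  then have "pi / real (m s t) \<le> pi / 2" by (intro divide_left_mono) auto
  then show "pi / real (m s t) < pi" using pi_gt_zero by linarith
qed (use assms in auto)

lemma dih_0 [simp]: "dih s t 0 = 0" by (simp add: dih_def)

lemma dih_1: "s \<in> S \<Longrightarrow> t \<in> S \<Longrightarrow> s \<noteq> t \<Longrightarrow> dih s t (Suc 0) = 1"
  using sin_pi_m[of s t] by (cases "m s t = 0") (simp_all add: dih_def)

lemma dih_rec: assumes "s \<in> S" "t \<in> S" "s \<noteq> t"
  shows "dih s t (Suc (Suc k)) = - 2 * cf s t * dih s t (Suc k) - dih s t k"
proof (cases "m s t = 0")
  case True then show ?thesis by (simp add: dih_def cf_def)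
next
  case False
  let ?x = "pi / real (m s t)"
  have 1: "real (Suc (Suc k)) * pi / real (m s t) = real (Suc k) * ?x + ?x"
    and 2: "real k * pi / real (m s t) = real (Suc k) * ?x - ?x"
    and 3: "real (Suc k) * pi / real (m s t) = real (Suc k) * ?x"
    by (simp_all add: algebra_simps add_divide_distrib)
  have "sin (real (Suc k) * ?x + ?x) + sin (real (Suc k) * ?x - ?x) = 2 * cos ?x * sin (real (Suc k) * ?x)"
    by (simp add: sin_add sin_diff del: of_nat_Suc)
  then have "sin (real (Suc k) * ?x + ?x) = 2 * cos ?x * sin (real (Suc k) * ?x) - sin (real (Suc k) * ?x - ?x)"
    by linarith
  then show ?thesis using False unfolding dih_def 1 2 3 cf_def by (simp add: diff_divide_distrib)
qed

lemma dih_nonneg: assumes "s \<in> S" "t \<in> S" "s \<noteq> t" "m s t = 0 \<or> k \<le> m s t" shows "0 \<le> dih s t k"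
proof (cases "m s t = 0")
  case True then show ?thesis by (simp add: dih_def)
next
  case False
  then have "real k * pi / real (m s t) \<le> pi" using assms by (simp add: field_simps)
  then have "0 \<le> sin (real k * pi / real (m s t))" by (intro sin_ge_zero) auto
  then show ?thesis using False sin_pi_m[OF assms(1,2,3) False] by (simp add: dih_def)
qed

lemma dih_full: assumes "s \<in> S" "t \<in> S" "s \<noteq> t" "m s t \<noteq> 0"
  shows "dih s t (2 * m s t) = 0" "dih s t (Suc (2 * m s t)) = 1" "dih s t (2 * m s t - 1) = - 1"
proof -
  let ?x = "pi / real (m s t)"
  have 1: "real (2 * m s t) * pi / real (m s t) = 2 * pi"
    "real (Suc (2 * m s t)) * pi / real (m s t) = ?x + 2 * pi"
    "real (2 * m s t - 1) * pi / real (m s t) = 2 * pi - ?x"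
    using assms by (simp_all add: field_simps of_nat_diff)
  have 2: "sin (2 * pi - ?x) = - sin ?x" by (simp add: sin_diff)
  show "dih s t (2 * m s t) = 0" unfolding dih_def 1 using assms by simp
  show "dih s t (Suc (2 * m s t)) = 1" unfolding dih_def 1(2) sin_periodic
    using sin_pi_m[OF assms] assms by simp
  show "dih s t (2 * m s t - 1) = - 1" unfolding dih_def 1(3) 2 using sin_pi_m[OF assms] assms by simp
qed

text \<open>Each new letter reflects one of the two simple roots into the combination, which is the
  recursion of the coefficients.\<close>

lemma foldr_\<sigma>_alternating:
  assumes "s \<in> S" "t \<in> S" "s \<noteq> t"
  shows "foldr \<sigma> (rev (alternating k t s)) (\<alpha> s) =
    (if even k then (\<lambda>r. dih s t (Suc k) * \<alpha> s r + dih s t k * \<alpha> t r)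
     else (\<lambda>r. dih s t (Suc k) * \<alpha> t r + dih s t k * \<alpha> s r))"
proof (induct k)
  case 0 then show ?case using assms by (simp add: dih_1)
next
  case (Suc k)
  have r: "\<sigma> a (\<alpha> a) = (\<lambda>r. - \<alpha> a r)" if "a \<in> S" for a
    using that by (simp add: \<sigma>_def B_simple_simple)
  have rt: "\<sigma> t (\<alpha> s) = (\<lambda>r. \<alpha> s r - 2 * cf s t * \<alpha> t r)"
    using assms by (simp add: \<sigma>_def B_simple_simple cf_sym)
  have rs: "\<sigma> s (\<alpha> t) = (\<lambda>r. \<alpha> t r - 2 * cf s t * \<alpha> s r)"
    using assms by (simp add: \<sigma>_def B_simple_simple cf_sym)
  show ?case
  proof (cases "even k")
    case True
    then have "foldr \<sigma> (rev (alternating (Suc k) t s)) (\<alpha> s) =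
        \<sigma> t (\<lambda>r. dih s t (Suc k) * \<alpha> s r + dih s t k * \<alpha> t r)"
      using Suc by (simp add: alternating_snoc del: alternating.simps)
    also have "\<dots> = (\<lambda>r. dih s t (Suc (Suc k)) * \<alpha> t r + dih s t (Suc k) * \<alpha> s r)"
      unfolding \<sigma>_lin rt r[OF assms(2)] dih_rec[OF assms] by (rule ext) (simp add: algebra_simps)
    finally show ?thesis using True by simp
  next
    case False
    then have "foldr \<sigma> (rev (alternating (Suc k) t s)) (\<alpha> s) =
        \<sigma> s (\<lambda>r. dih s t (Suc k) * \<alpha> t r + dih s t k * \<alpha> s r)"
      using Suc by (simp add: alternating_snoc del: alternating.simps)
    also have "\<dots> = (\<lambda>r. dih s t (Suc (Suc k)) * \<alpha> s r + dih s t (Suc k) * \<alpha> t r)"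
      unfolding \<sigma>_lin rs r[OF assms(1)] dih_rec[OF assms] by (rule ext) (simp add: algebra_simps)
    finally show ?thesis using False by simp
  qed
qed

text \<open>For \<open>m s t\<close> finite the form is nondegenerate on the plane spanned by the two simple roots, so
  a vector splits into a part in that plane and a part fixed by both reflections.\<close>

lemma foldr_\<sigma>_relation:
  assumes st: "s \<in> S" "t \<in> S" and m: "m s t \<noteq> 0"
  shows "foldr \<sigma> (concat (replicate (m s t) [s, t])) v = v"
proof (cases "s = t")
  case True
  then show ?thesis using st by (simp add: \<sigma>_\<sigma>)
next
  case False
  let ?n = "m s t" and ?c = "cf s t"
  let ?w = "alternating (2 * ?n) s t"
  have w: "?w = rev (alternating (2 * ?n) t s)" by (simp add: rev_alternating)
  have S1: "foldr \<sigma> ?w (\<alpha> s) = \<alpha> s"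
    unfolding w foldr_\<sigma>_alternating[OF st False] using dih_full[OF st False m] by simp
  have n: "2 * ?n = Suc (2 * ?n - 1)" using m by simp
  have o: "odd (2 * ?n - 1)" using m by auto
  have ts: "m t s = m s t" using ord_swap st by simp
  have "?w = rev (alternating (2 * ?n - 1) s t) @ [t]"
    using o unfolding n[symmetric] by (metis alternating_snoc n rev_alternating)
  moreover have "\<sigma> t (\<alpha> t) = (\<lambda>r. (-1) * \<alpha> t r + 0 * \<alpha> t r)" using st by (simp add: \<sigma>_def B_simple_simple)
  ultimately have "foldr \<sigma> ?w (\<alpha> t) = foldr \<sigma> (rev (alternating (2 * ?n - 1) s t)) (\<lambda>r. (-1) * \<alpha> t r + 0 * \<alpha> t r)"
    by simp
  moreover have "foldr \<sigma> (rev (alternating (2 * ?n - 1) s t)) (\<alpha> t) = (\<lambda>r. - \<alpha> t r)"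
    unfolding foldr_\<sigma>_alternating[OF st(2,1) False[symmetric]] n[symmetric]
    using dih_full[OF st(2,1) False[symmetric]] m o by (simp add: ts)
  ultimately have S2: "foldr \<sigma> ?w (\<alpha> t) = \<alpha> t" by (simp only: foldr_\<sigma>_lin) simp
  have c: "?c * ?c \<noteq> 1"
  proof -
    have "sin (pi / real ?n) ^ 2 > 0" using sin_pi_m[OF st False m] by simp
    then have "cos (pi / real ?n) ^ 2 < 1" using sin_cos_squared_add[of "pi / real ?n"] by linarith
    moreover have "?c * ?c = cos (pi / real ?n) ^ 2" using m by (simp add: cf_def power2_eq_square)
    ultimately show ?thesis by linarith
  qed
  define p q where "p = B (\<alpha> s) v" and "q = B (\<alpha> t) v"
  (* x, y solve the two equations saying that v0 is orthogonal to both simple roots *)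
  define d where "d = 1 - ?c * ?c"
  define x y where "x = (p - ?c * q) / d" and "y = (q - ?c * p) / d"
  define v0 where "v0 = (\<lambda>r. 1 * v r + (-1) * (x * \<alpha> s r + y * \<alpha> t r))"
  have "d \<noteq> 0" using c by (simp add: d_def)
  then have "x + y * ?c = p" "x * ?c + y = q"
    by (simp_all add: x_def y_def divide_simps) (simp_all add: d_def algebra_simps)
  then have fix0: "\<sigma> s v0 = v0" "\<sigma> t v0 = v0"
    unfolding \<sigma>_def[of s v0] \<sigma>_def[of t v0] unfolding v0_def B_lin
    using st by (simp_all add: B_simple_simple p_def q_def cf_sym algebra_simps)
  have "foldr \<sigma> u v0 = v0" if "set u \<subseteq> {s, t}" for u using that by (induct u) (auto simp: fix0)
  moreover have "set ?w \<subseteq> {s, t}" by (auto simp: alternating_nth)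
  ultimately have F: "foldr \<sigma> ?w v0 = v0" by blast
  have "v = (\<lambda>r. 1 * v0 r + 1 * (x * \<alpha> s r + y * \<alpha> t r))" by (simp add: v0_def)
  then have "foldr \<sigma> ?w v = foldr \<sigma> ?w (\<lambda>r. 1 * v0 r + 1 * (x * \<alpha> s r + y * \<alpha> t r))" by simp
  also have "\<dots> = v" unfolding foldr_\<sigma>_lin F S1 S2 by (simp add: v0_def)
  finally show ?thesis by (simp add: alternating_double)
qed

subsection \<open>The action of the group\<close>

lemma foldr_\<sigma>_cong: "set u \<subseteq> S \<Longrightarrow> set v \<subseteq> S \<Longrightarrow> lp u = lp v \<Longrightarrow> foldr \<sigma> u = foldr \<sigma> v"
  by (rule ext, rule foldr_word_invariant) (auto simp: \<sigma>_\<sigma> foldr_\<sigma>_relation)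

lemma act_lp: assumes "set u \<subseteq> S" shows "act (lp u) = foldr \<sigma> u"
proof -
  let ?w = "SOME w. w \<in> lists S \<and> lp w = lp u"
  have "?w \<in> lists S \<and> lp ?w = lp u" by (rule someI[of _ u]) (use assms in \<open>simp add: lists_eq_set\<close>)
  then have "foldr \<sigma> ?w = foldr \<sigma> u" using assms foldr_\<sigma>_cong[of ?w u] by (simp add: lists_eq_set)
  then show ?thesis by (intro ext) (simp add: cox_act_def)
qed

lemma act_one [simp]: "act \<one> v = v"
  using act_lp[of "[]"] by simp

lemma act_S: "s \<in> S \<Longrightarrow> act s = \<sigma> s"
  using act_lp[of "[s]"] by (auto simp: fun_eq_iff)

lemma act_mult: assumes "x \<in> carrier G" "y \<in> carrier G" shows "act (x \<otimes> y) v = act x (act y v)"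
proof -
  obtain u u' where "set u \<subseteq> S" "lp u = x" "set u' \<subseteq> S" "lp u' = y" using word_ex assms by metis
  then show ?thesis using act_lp[of "u @ u'"] act_lp[of u] act_lp[of u'] by auto
qed

lemma act_word:
  assumes "x \<in> carrier G" obtains u where "set u \<subseteq> S" "act x = foldr \<sigma> u"
  using word_ex[OF assms] act_lp that by auto

lemma act_lin: "x \<in> carrier G \<Longrightarrow> act x (\<lambda>t. a * v t + b * w t) = (\<lambda>t. a * act x v t + b * act x w t)"
  by (erule act_word) (simp add: foldr_\<sigma>_lin)

lemma act_neg: "x \<in> carrier G \<Longrightarrow> act x (\<lambda>t. - v t) = (\<lambda>t. - act x v t)"
  using act_lin[of x "-1" v 0 v] by simp

lemma act_inv: "x \<in> carrier G \<Longrightarrow> act (inv x) (act x v) = v" "x \<in> carrier G \<Longrightarrow> act x (act (inv x) v) = v"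
  by (simp_all add: act_mult[symmetric])

lemma B_act: assumes "x \<in> carrier G" shows "B (act x v) (act x w) = B v w"
proof -
  have "B (foldr \<sigma> u v) (foldr \<sigma> u w) = B v w" if "set u \<subseteq> S" for u using that
    by (induct u) (auto simp: B_\<sigma>)
  then show ?thesis by (metis act_word[OF assms])
qed

lemma act_simple_neg: "x \<in> carrier G \<Longrightarrow> s \<in> S \<Longrightarrow> act (x \<otimes> s) (\<alpha> s) = (\<lambda>t. - act x (\<alpha> s) t)"
  by (simp add: act_mult act_S act_neg[symmetric]) (simp add: \<sigma>_def B_simple_simple)

section \<open>Positive and negative roots\<close>

text \<open>Splitting off the longest possible alternating word on the right leaves the shortest element of
  the coset of the dihedral subgroup; if a letter shortened it further, the alternating word could be
  prolonged, or the whole product would be shorter than it is.\<close>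

lemma dihedral_decomposition:
  assumes x: "x \<in> carrier G" and st: "s \<in> S" "t \<in> S" "s \<noteq> t"
  obtains v k p q where "v \<in> carrier G" "{p, q} = {s, t}" "x = v \<otimes> lp (rev (alternating k p q))"
    "len x = len v + k" "len (v \<otimes> s) > len v" "len (v \<otimes> t) > len v"
proof -
  define D where "D k \<longleftrightarrow> (\<exists>v p q. v \<in> carrier G \<and> {p, q} = {s, t} \<and>
      x = v \<otimes> lp (rev (alternating k p q)) \<and> len x = len v + k)" for k
  have "D 0" using x unfolding D_def by (intro exI[of _ x] exI[of _ s] exI[of _ t]) simp
  moreover have "\<forall>k. D k \<longrightarrow> k \<le> len x" by (auto simp: D_def)
  ultimately obtain k where k: "D k" "\<And>j. D j \<Longrightarrow> j \<le> k" using Nat.ex_has_greatest_nat[of D] by metis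
  then obtain v p q where v: "v \<in> carrier G" "{p, q} = {s, t}"
      "x = v \<otimes> lp (rev (alternating k p q))" "len x = len v + k" by (auto simp: D_def)
  have pq: "p \<in> S" "q \<in> S" "p \<noteq> q" using v(2) st by (auto simp: doubleton_eq_iff)
  have extend: False if "k = 0 \<and> {p', q'} = {s, t} \<or> p' = p \<and> q' = q"
    "r = (if even k then p' else q')" "len (v \<otimes> r) < len v" for p' q' r
  proof -
    have r: "p' \<in> S" "q' \<in> S" "r \<in> S" using that pq st by (auto simp: doubleton_eq_iff)
    have al: "set (rev (alternating k p' q')) \<subseteq> S"
      using r set_alternating_subset[of p' S q'] by simp
    have "rev (alternating (Suc k) p' q') = r # rev (alternating k p' q')"
      using that by (simp add: alternating_snoc del: alternating.simps)
    moreover have "x = v \<otimes> lp (rev (alternating k p' q'))" using that v by auto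
    ultimately have "x = (v \<otimes> r) \<otimes> lp (rev (alternating (Suc k) p' q'))"
      using v r al by (simp add: m_assoc del: alternating.simps)
    moreover have "len (v \<otimes> r) + 1 = len v" using len_mult_S[OF v(1) r(3)] that(3) by linarith
    then have "len x = len (v \<otimes> r) + Suc k" using v(4) by simp
    moreover have "{p', q'} = {s, t}" using that v by auto
    moreover have "v \<otimes> r \<in> carrier G" using v(1) r by simp
    ultimately have "D (Suc k)" unfolding D_def by blast
    from k(2)[OF this] show False by simp
  qed
  have shrink: False if j: "k = Suc j" and r: "r = (if even j then p else q)" "len (v \<otimes> r) < len v" for j r
  proof -
    have rS: "r \<in> S" using r pq by auto
    have al: "set (rev (alternating j p q)) \<subseteq> S"
      using pq set_alternating_subset[of p S q] by simp
    have "x = (v \<otimes> r) \<otimes> lp (rev (alternating j p q))"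
      using v rS al r(1) unfolding j by (simp add: alternating_snoc m_assoc del: alternating.simps)
    then have "len x \<le> len (v \<otimes> r) + len (lp (rev (alternating j p q)))"
      using len_mult[of "v \<otimes> r" "lp (rev (alternating j p q))"] v(1) rS al by simp
    also have "\<dots> \<le> len (v \<otimes> r) + j" using len_le[OF al] by simp
    finally show False using v r j by simp
  qed
  have up: "len (v \<otimes> r) > len v" if "r \<in> {p, q}" for r
  proof (rule ccontr)
    assume "\<not> len (v \<otimes> r) > len v"
    moreover have r: "r = p \<or> r = q" using that by blast
    moreover from r have "r \<in> S" using pq by blast
    ultimately have less: "len (v \<otimes> r) < len v" using len_mult_S[OF v(1)] by force
    show False
    proof (cases k)
      case 0
      have "{q, p} = {s, t}" using v(2) by (simp add: insert_commute)
      then show ?thesis using 0 extend[of p q p] extend[of q p q] less r v(2) by auto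
    next
      case (Suc j)
      then show ?thesis using extend[of p q r] shrink[of j r] less r
        by (cases "even j") auto
    qed
  qed
  have "len (v \<otimes> s) > len v" "len (v \<otimes> t) > len v" using up v(2) by auto
  then show thesis using that v by blast
qed

lemma dihedral_root:
  assumes "s \<in> S" "t \<in> S" "s \<noteq> t" "m s t = 0 \<or> k < m s t"
  obtains a b where "0 \<le> a" "0 \<le> b"
    "foldr \<sigma> (rev (alternating k t s)) (\<alpha> s) = (\<lambda>r. a * \<alpha> s r + b * \<alpha> t r)"
proof -
  have "0 \<le> dih s t k" "0 \<le> dih s t (Suc k)" using dih_nonneg[OF assms(1-3)] assms(4) by auto
  then show thesis using that foldr_\<sigma>_alternating[OF assms(1-3), of k]
    by (cases "even k") (auto simp: add.commute)
qed

text \<open>An alternating word of length at least \<open>m\<close> can be rewritten to end with the other letter.\<close>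

lemma long_alternating:
  assumes "s \<in> S" "t \<in> S" "m s t \<noteq> 0" "m s t \<le> k"
  obtains u where "set u \<subseteq> S" "length u + 1 = k" "lp (rev (alternating k t s)) = lp (u @ [s])"
proof -
  let ?n = "m s t"
  have n: "?n = m t s" using ord_swap assms by simp
  let ?r = "if even ?n then alternating (k - ?n) t s else alternating (k - ?n) s t"
  have r: "set (rev ?r) \<subseteq> S" using assms set_alternating_subset[of _ S]
    by auto
  have a: "set (rev (alternating i a b)) \<subseteq> S" if "a \<in> S" "b \<in> S" for i a b
    using set_alternating_subset[OF that, of i] by simp
  obtain i where i: "?n = Suc i" using assms by (cases ?n) auto
  have "rev (alternating k t s) = rev ?r @ rev (alternating ?n t s)"
    using alternating_split[of ?n "k - ?n" t s] assms by simp
  moreover have "lp (rev (alternating ?n t s)) = lp (rev (alternating ?n s t))"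
    using lp_alternating_eq[of s t] assms set_alternating_subset[of _ S] by (simp add: lp_rev)
  ultimately have "lp (rev (alternating k t s)) = lp (rev ?r @ rev (alternating ?n s t))"
    using a[of s t] a[of t s] r assms lp_append by metis
  moreover have "rev (alternating ?n s t) = rev (alternating i t s) @ [s]" unfolding i by simp
  ultimately show thesis
    using that[of "rev ?r @ rev (alternating i t s)"] r a[of t s i] assms i by auto
qed

text \<open>Tits' theorem, by induction on the length. Write \<open>x = v a\<close> with \<open>a\<close> the longest alternating tail in \<open>s\<close> and a
  right descent \<open>t\<close>. As \<open>s\<close> is no right descent, \<open>a\<close> ends with \<open>t\<close> and is shorter than the braid relation, so it
  maps the simple root of \<open>s\<close> to a nonnegative combination of the two simple roots, and these are
  mapped to positive roots by the shorter element \<open>v\<close>.\<close>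

theorem act_simple_nonneg:
  assumes "x \<in> carrier G" "s \<in> S" "len (x \<otimes> s) > len x"
  shows "0 \<le> act x (\<alpha> s) r"
  using assms
proof (induct "len x" arbitrary: x s r rule: less_induct)
  case less
  show ?case
  proof (cases "len x = 0")
    case True
    then show ?thesis using less.prems len_eq_0 by (simp add: simple_root_def)
  next
    case False
    obtain u where u: "set u \<subseteq> S" "lp u = x" "length u = len x" using len_ex less.prems by blast
    then obtain u' t where ut: "u = u' @ [t]" using False by (metis list.size(3) rev_exhaust)
    then have t: "t \<in> S" "set u' \<subseteq> S" using u by auto
    then have "x \<otimes> t = lp u'" using u ut by auto
    then have xt: "len (x \<otimes> t) < len x" using len_le[OF t(2)] u ut by simp
    then have "s \<noteq> t" using less.prems by auto
    then obtain v k p q where v: "v \<in> carrier G" "{p, q} = {s, t}"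
        "x = v \<otimes> lp (rev (alternating k p q))" "len x = len v + k"
        "len (v \<otimes> s) > len v" "len (v \<otimes> t) > len v"
      using dihedral_decomposition[of x s t] less.prems t by metis
    have pq: "p \<in> S" "q \<in> S" "p \<noteq> q" using v(2) t \<open>s \<noteq> t\<close> less.prems by (auto simp: doubleton_eq_iff)
  have k0: "k \<noteq> 0"
    proof
      assume "k = 0"
      then have "x = v" using v by simp
      then show False using xt v by simp
    qed
    have pos: "0 \<le> act v (\<alpha> s) r" "0 \<le> act v (\<alpha> t) r"
      using less.hyps[of v] v k0 less.prems t by auto
    have short: False if "x = v \<otimes> lp (y @ [s])" "set y \<subseteq> S" "length y + 1 = k" for y
    proof -
      have "x \<otimes> s = v \<otimes> lp y" using that v less.prems by (simp add: m_assoc)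
      then have "len (x \<otimes> s) \<le> len v + length y"
        using len_mult[of v "lp y"] len_le[of y] v that by simp
      then show False using that v less.prems by linarith
    qed
    have "p \<noteq> s"
    proof
      assume "p = s"
      moreover obtain j where j: "k = Suc j" using k0 by (cases k) auto
      moreover have "set (rev (alternating j q p)) \<subseteq> S"
        using pq set_alternating_subset[of q S p] by simp
      ultimately show False using short[of "rev (alternating j q p)"] v by simp
    qed
    then have [simp]: "p = t" "q = s" using v(2) by (auto simp: doubleton_eq_iff)
    have "m s t = 0 \<or> k < m s t"
    proof (rule ccontr)
      assume "\<not> ?thesis"
      then obtain y where "set y \<subseteq> S" "length y + 1 = k" "lp (rev (alternating k t s)) = lp (y @ [s])"
        using long_alternating[of s t k] less.prems t by auto
      then show False using short v by auto
    qed
    then obtain a b where ab: "0 \<le> a" "0 \<le> b"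
        "foldr \<sigma> (rev (alternating k t s)) (\<alpha> s) = (\<lambda>r. a * \<alpha> s r + b * \<alpha> t r)"
      using dihedral_root[of s t k] \<open>s \<noteq> t\<close> less.prems t by metis
    have al: "set (rev (alternating k t s)) \<subseteq> S"
      using pq set_alternating_subset[of t S s] by simp
    have "act x (\<alpha> s) = act v (\<lambda>r. a * \<alpha> s r + b * \<alpha> t r)"
      using v al ab by (simp add: act_mult act_lp)
    then show ?thesis using ab pos v by (simp add: act_lin)
  qed
qed

end

context coxeter
begin

abbreviation Phi :: "('a \<Rightarrow> real) set" where "Phi \<equiv> roots G S"
abbreviation Pos :: "('a \<Rightarrow> real) set" where "Pos \<equiv> pos_roots G S"
abbreviation Neg :: "('a \<Rightarrow> real) set" where "Neg \<equiv> neg_roots G S"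

definition neg :: "('a \<Rightarrow> real) \<Rightarrow> 'a \<Rightarrow> real" where "neg v = (\<lambda>t. - v t)"

lemma neg_neg [simp]: "neg (neg v) = v" by (simp add: neg_def)

lemma act_neg': "x \<in> carrier G \<Longrightarrow> act x (neg v) = neg (act x v)"
  by (simp add: neg_def act_neg)

lemma foldr_\<sigma>_support:
  "set u \<subseteq> J \<Longrightarrow> (\<And>r. r \<notin> J \<Longrightarrow> v r = 0) \<Longrightarrow> r \<notin> J \<Longrightarrow> foldr \<sigma> u v r = 0"
proof (induct u)
  case (Cons s u)
  then have "\<alpha> s r = 0" by (auto simp: simple_root_def)
  then show ?case using Cons by (simp add: simple_reflection_def)
qed simp

lemma simple_root_support: "s \<in> J \<Longrightarrow> r \<notin> J \<Longrightarrow> \<alpha> s r = 0"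
  by (auto simp: simple_root_def)

lemma root_support: "\<beta> \<in> Phi \<Longrightarrow> r \<notin> S \<Longrightarrow> \<beta> r = 0"
proof -
  assume "\<beta> \<in> Phi" "r \<notin> S"
  then obtain x s where xs: "x \<in> carrier G" "s \<in> S" "\<beta> = act x (\<alpha> s)" by (auto simp: roots_def)
  from xs(1) obtain u where "set u \<subseteq> S" "act x = foldr \<sigma> u" by (rule act_word)
  then show ?thesis using xs \<open>r \<notin> S\<close> foldr_\<sigma>_support[of u S "\<alpha> s" r]
    by (simp add: simple_root_support)
qed

lemma simple_root_in [simp]: "s \<in> S \<Longrightarrow> \<alpha> s \<in> Phi"
  unfolding roots_def using act_one by (metis (mono_tags, lifting) mem_Collect_eq one_closed)

lemma act_root [simp]: "x \<in> carrier G \<Longrightarrow> \<beta> \<in> Phi \<Longrightarrow> act x \<beta> \<in> Phi"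
  unfolding roots_def using act_mult by (smt (verit, best) m_closed mem_Collect_eq)

lemma root_norm: "\<beta> \<in> Phi \<Longrightarrow> B \<beta> \<beta> = 1"
  by (auto simp: roots_def B_act B_simple_simple)

lemma root_nonzero: "\<beta> \<in> Phi \<Longrightarrow> \<exists>r\<in>S. \<beta> r \<noteq> 0"
proof (rule ccontr)
  assume "\<beta> \<in> Phi" "\<not> (\<exists>r\<in>S. \<beta> r \<noteq> 0)"
  then have "B \<beta> \<beta> = 0" by (simp add: B_cf)
  then show False using root_norm \<open>\<beta> \<in> Phi\<close> by simp
qed

lemma neg_root: "\<beta> \<in> Phi \<Longrightarrow> neg \<beta> \<in> Phi"
proof -
  assume "\<beta> \<in> Phi"
  then obtain x s where xs: "x \<in> carrier G" "s \<in> S" "\<beta> = act x (\<alpha> s)" by (auto simp: roots_def)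
  then have "neg \<beta> = act (x \<otimes> s) (\<alpha> s)" by (simp add: act_simple_neg neg_def)
  then show ?thesis using xs by simp
qed

lemma Pos_root: "\<beta> \<in> Pos \<Longrightarrow> \<beta> \<in> Phi" by (simp add: pos_roots_def)

lemma Neg_iff: "\<beta> \<in> Neg \<longleftrightarrow> neg \<beta> \<in> Pos"
  unfolding neg_roots_def neg_def[symmetric] image_iff by (metis neg_neg)

lemma Neg_root: "\<beta> \<in> Neg \<Longrightarrow> \<beta> \<in> Phi"
  by (metis Neg_iff Pos_root neg_neg neg_root)

lemma Neg_neg: "neg \<beta> \<in> Neg \<longleftrightarrow> \<beta> \<in> Pos" by (simp add: Neg_iff)

lemma not_Pos_Neg: "\<beta> \<in> Pos \<Longrightarrow> \<beta> \<notin> Neg"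
proof
  assume "\<beta> \<in> Pos" "\<beta> \<in> Neg"
  then have "\<forall>r\<in>S. \<beta> r = 0" unfolding Neg_iff by (fastforce simp: pos_roots_def neg_def)
  then show False using root_nonzero Pos_root \<open>\<beta> \<in> Pos\<close> by blast
qed

lemma act_simple_Pos: "x \<in> carrier G \<Longrightarrow> s \<in> S \<Longrightarrow> len (x \<otimes> s) > len x \<Longrightarrow> act x (\<alpha> s) \<in> Pos"
  by (simp add: pos_roots_def act_simple_nonneg)

lemma act_simple_Neg:
  assumes "x \<in> carrier G" "s \<in> S" "\<not> len (x \<otimes> s) > len x" shows "act x (\<alpha> s) \<in> Neg"
proof -
  have "len (x \<otimes> s \<otimes> s) > len (x \<otimes> s)" using assms len_mult_S[of x s] by auto
  then have "act (x \<otimes> s) (\<alpha> s) \<in> Pos" using assms by (intro act_simple_Pos) auto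
  then show ?thesis using assms by (simp add: act_simple_neg Neg_iff neg_def)
qed

lemma act_simple_Neg_iff: "x \<in> carrier G \<Longrightarrow> s \<in> S \<Longrightarrow> act x (\<alpha> s) \<in> Neg \<longleftrightarrow> len (x \<otimes> s) < len x"
  using act_simple_Neg act_simple_Pos not_Pos_Neg len_mult_S[of x s] by (metis less_add_one linorder_neqE_nat not_less_iff_gr_or_eq)

lemma Pos_or_Neg: "\<beta> \<in> Phi \<Longrightarrow> \<beta> \<in> Pos \<or> \<beta> \<in> Neg"
  using act_simple_Neg act_simple_Pos by (auto simp: roots_def)

lemma simple_root_Pos [simp]: "s \<in> S \<Longrightarrow> \<alpha> s \<in> Pos"
  using act_simple_Pos[of \<one> s] by simp

text \<open>A simple reflection changes only one coordinate, and the simple root is the only positive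
  root that has no other nonzero coordinate.\<close>

lemma \<sigma>_Pos:
  assumes "s \<in> S" "\<beta> \<in> Pos" "\<beta> \<noteq> \<alpha> s" shows "\<sigma> s \<beta> \<in> Pos"
proof (rule ccontr)
  have R: "\<sigma> s \<beta> \<in> Phi" using act_root[of s \<beta>] assms by (simp add: act_S Pos_root)
  assume "\<sigma> s \<beta> \<notin> Pos"
  then have "\<sigma> s \<beta> \<in> Neg" using Pos_or_Neg R by blast
  then have "\<sigma> s \<beta> r \<le> 0" if "r \<in> S" for r using that unfolding Neg_iff by (auto simp: pos_roots_def neg_def)
  then have "\<beta> r \<le> 0" if "r \<in> S" "r \<noteq> s" for r using that by (force simp: simple_reflection_def simple_root_def)
  then have "\<beta> r = 0" if "r \<noteq> s" for r using that assms(2) root_support[OF Pos_root[OF assms(2)], of r]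
    by (cases "r \<in> S") (force simp: pos_roots_def)+
  then have eq: "\<beta> = (\<lambda>r. \<beta> s * \<alpha> s r + 0 * \<alpha> s r)" by (auto simp: simple_root_def fun_eq_iff)
  have "B \<beta> \<beta> = \<beta> s * \<beta> s"
    by (subst (1 2) eq, subst B_lin, subst B_lin1, use assms(1) in \<open>simp add: B_simple_simple\<close>)
  moreover have "0 \<le> \<beta> s" using assms by (auto simp: pos_roots_def)
  ultimately have "\<beta> s = 1" using root_norm[OF Pos_root[OF assms(2)]]
    by (metis power2_eq_1_iff power2_eq_square le_minus_one_simps(3))
  then show False using eq assms(3) by simp
qed

definition Inv :: "'a \<Rightarrow> ('a \<Rightarrow> real) set" where
  "Inv x = {\<beta> \<in> Pos. act x \<beta> \<in> Neg}"

lemma Inv_mult_S: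
  assumes "x \<in> carrier G" "s \<in> S" "len (x \<otimes> s) > len x"
  shows "Inv (x \<otimes> s) = insert (\<alpha> s) (\<sigma> s ` Inv x)" "\<alpha> s \<notin> \<sigma> s ` Inv x" "inj_on (\<sigma> s) A"
proof -
  have xs: "act x (\<alpha> s) \<in> Pos" using act_simple_Pos assms by simp
  have ss: "\<sigma> s (\<alpha> s) = neg (\<alpha> s)" using assms by (simp add: \<sigma>_def B_simple_simple neg_def)
  have ax: "act (x \<otimes> s) \<beta> = act x (\<sigma> s \<beta>)" for \<beta> using assms by (simp add: act_mult act_S)
  have ns: "\<alpha> s \<notin> Inv x" using xs not_Pos_Neg by (auto simp: Inv_def)
  show "inj_on (\<sigma> s) A" using \<sigma>_\<sigma>[OF assms(2)] by (metis inj_on_inverseI)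
  show "\<alpha> s \<notin> \<sigma> s ` Inv x"
  proof
    assume "\<alpha> s \<in> \<sigma> s ` Inv x"
    then have "neg (\<alpha> s) \<in> Inv x" using \<sigma>_\<sigma>[OF assms(2)] ss by auto
    then have "\<alpha> s \<in> Neg" by (auto simp: Inv_def Neg_iff)
    then show False using not_Pos_Neg assms by simp
  qed
  show "Inv (x \<otimes> s) = insert (\<alpha> s) (\<sigma> s ` Inv x)"
  proof (intro equalityI subsetI)
    fix \<beta> assume b: "\<beta> \<in> Inv (x \<otimes> s)"
    show "\<beta> \<in> insert (\<alpha> s) (\<sigma> s ` Inv x)"
    proof (cases "\<beta> = \<alpha> s")
      case False
      then have "\<sigma> s \<beta> \<in> Inv x" using b ax \<sigma>_Pos[OF assms(2)] by (auto simp: Inv_def)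
      then show ?thesis using \<sigma>_\<sigma>[OF assms(2)] by (metis image_eqI insertI2)
    qed simp
  next
    fix \<beta> assume "\<beta> \<in> insert (\<alpha> s) (\<sigma> s ` Inv x)"
    then consider "\<beta> = \<alpha> s" | \<gamma> where "\<beta> = \<sigma> s \<gamma>" "\<gamma> \<in> Inv x" by blast
    then show "\<beta> \<in> Inv (x \<otimes> s)"
    proof cases
      case 1
      then show ?thesis using xs assms ss by (simp add: Inv_def ax act_neg' Neg_neg)
    next
      case 2
      then show ?thesis using \<sigma>_Pos[OF assms(2), of \<gamma>] ns \<sigma>_\<sigma>[OF assms(2)] by (auto simp: Inv_def ax)
    qed
  qed
qed

text \<open>Every letter of a reduced word contributes exactly one inversion.\<close>

theorem card_Inv: "x \<in> carrier G \<Longrightarrow> finite (Inv x) \<and> card (Inv x) = len x"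
proof (induct "len x" arbitrary: x)
  case 0
  then have "x = \<one>" using len_eq_0 by simp
  then have "Inv x = {}" using not_Pos_Neg by (auto simp: Inv_def)
  then show ?case using 0 by simp
next
  case (Suc n)
  obtain u where u: "set u \<subseteq> S" "lp u = x" "length u = len x" using len_ex Suc by blast
  then obtain u' s where us: "u = u' @ [s]" using Suc by (metis length_0_conv nat.distinct(1) rev_exhaust)
  let ?y = "lp u'"
  have s: "s \<in> S" "set u' \<subseteq> S" using u us by auto
  have x: "x = ?y \<otimes> s" using u us s by simp
  have "reduced u'" using reduced_append(1)[of u' "[s]"] u us by simp
  then have y: "len ?y = n" using u us Suc by simp
  then have up: "len (?y \<otimes> s) > len ?y" using x Suc by simp
  note I = Inv_mult_S[OF _ s(1) up, OF lp_closed[OF s(2)]]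
  have "finite (Inv ?y)" "card (Inv ?y) = n" using Suc(1)[of ?y] y s by auto
  then show ?case using I card_image[OF I(3)] Suc(2) x by simp
qed

section \<open>Exchange and parabolic subgroups\<close>

text \<open>The geometric representation is faithful, since a nontrivial element makes some simple root negative.\<close>

lemma act_eq_one:
  assumes "x \<in> carrier G" "\<And>s. s \<in> S \<Longrightarrow> act x (\<alpha> s) = \<alpha> s" shows "x = \<one>"
proof (rule ccontr)
  assume "x \<noteq> \<one>"
  then have "len x \<noteq> 0" using len_eq_0 assms by simp
  obtain u where u: "set u \<subseteq> S" "lp u = x" "length u = len x" using len_ex assms by blast
  then obtain u' s where us: "u = u' @ [s]" using \<open>len x \<noteq> 0\<close> by (metis length_0_conv rev_exhaust)
  then have s: "s \<in> S" "set u' \<subseteq> S" using u by auto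
  then have "len (x \<otimes> s) < len x" using u us len_le[of u'] by auto
  then have "act x (\<alpha> s) \<in> Neg" using act_simple_Neg_iff[OF assms(1) s(1)] by blast
  then show False using assms(2)[OF s(1)] s not_Pos_Neg[of "\<alpha> s"] by simp
qed

text \<open>If \<open>x\<close> moves one simple root to another, it conjugates the corresponding reflections.\<close>

lemma conj_simple:
  assumes x: "x \<in> carrier G" and st: "s \<in> S" "t \<in> S" and eq: "act x (\<alpha> s) = \<alpha> t"
  shows "x \<otimes> s = t \<otimes> x"
proof -
  have B1: "B (\<alpha> s) (act (inv x) v) = B (\<alpha> t) v" for v
    using B_act[OF x, of "\<alpha> s" "act (inv x) v"] eq x by (simp add: act_inv)
  have "act (x \<otimes> s \<otimes> inv x) v = \<sigma> t v" for v
  proof -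
    have "act (x \<otimes> s \<otimes> inv x) v = act x (\<sigma> s (act (inv x) v))" using x st by (simp add: act_mult act_S)
    also have "\<dots> = \<sigma> t v" unfolding \<sigma>_def act_lin[OF x] B1 eq using x by (simp add: act_inv)
    finally show ?thesis .
  qed
  then have "act (x \<otimes> s \<otimes> inv x \<otimes> t) v = v" for v
    using x st act_mult[of "x \<otimes> s \<otimes> inv x" t v] by (simp add: act_S \<sigma>_\<sigma>)
  then have "x \<otimes> s \<otimes> inv x \<otimes> t = \<one>" using x st by (intro act_eq_one) auto
  then have "x \<otimes> s \<otimes> inv x = t" using inv_equality[of "x \<otimes> s \<otimes> inv x" t] x st by simp
  then have "x \<otimes> s \<otimes> inv x \<otimes> x = t \<otimes> x" by simp
  then show ?thesis using x st by (simp add: m_assoc)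
qed

text \<open>Reading the word from the right, the root of \<open>s\<close> turns negative at some letter \<open>t\<close>, and just before it is the
  simple root of \<open>t\<close>. Hence the part of the word to the right of \<open>t\<close> carries \<open>s\<close> to \<open>t\<close>, and multiplying by \<open>s\<close>
  deletes this letter.\<close>

lemma exchange:
  assumes "set u \<subseteq> S" "s \<in> S" "act (lp u) (\<alpha> s) \<in> Neg"
  obtains a t b where "u = a @ [t] @ b" "lp u \<otimes> s = lp (a @ b)"
proof -
  have "\<exists>a t b. u = a @ [t] @ b \<and> lp u \<otimes> s = lp (a @ b)" using assms
  proof (induct u)
    case Nil then show ?case using not_Pos_Neg by simp
  next
    case (Cons t u)
    have c: "t \<in> S" "set u \<subseteq> S" using Cons by auto
    show ?case
    proof (cases "act (lp u) (\<alpha> s) \<in> Neg")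
      case True
      then obtain a t' b where ab: "u = a @ [t'] @ b" "lp u \<otimes> s = lp (a @ b)" using Cons c by blast
      then have "lp (t # u) \<otimes> s = lp ((t # a) @ b)" using c Cons.prems by (simp add: m_assoc)
      then show ?thesis using ab by (intro exI[of _ "t # a"] exI[of _ t'] exI[of _ b]) simp
    next
      case False
      then have P: "act (lp u) (\<alpha> s) \<in> Pos" using Pos_or_Neg[of "act (lp u) (\<alpha> s)"] c Cons.prems by simp
      have "act (lp (t # u)) (\<alpha> s) = \<sigma> t (act (lp u) (\<alpha> s))" using c by (simp add: act_mult act_S)
      then have "act (lp u) (\<alpha> s) = \<alpha> t" using \<sigma>_Pos[OF c(1) P] not_Pos_Neg Cons.prems by auto
      then have "lp u \<otimes> s = t \<otimes> lp u" using conj_simple c Cons.prems by simp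
      then have "lp (t # u) \<otimes> s = lp ([] @ u)" using c Cons.prems by (simp add: m_assoc)
      then show ?thesis by (intro exI[of _ "[]"] exI[of _ t] exI[of _ u]) simp
    qed
  qed
  then show thesis using that by blast
qed

lemma reduced_subword:
  "set u \<subseteq> S \<Longrightarrow> \<exists>v. reduced v \<and> set v \<subseteq> set u \<and> lp v = lp u"
proof (induct u rule: rev_induct)
  case Nil then show ?case by (intro exI[of _ "[]"]) simp
next
  case (snoc s u)
  then obtain v where v: "reduced v" "set v \<subseteq> set u" "lp v = lp u" by auto
  have s: "s \<in> S" "set u \<subseteq> S" using snoc by auto
  show ?case
  proof (cases "len (lp v \<otimes> s) > len (lp v)")
    case True
    then have "len (lp v \<otimes> s) = len (lp v) + 1" using len_mult_S[of "lp v" s] s v by auto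
    then show ?thesis using v s by (intro exI[of _ "v @ [s]"]) auto
  next
    case False
    then have "act (lp v) (\<alpha> s) \<in> Neg" using act_simple_Neg s v by auto
    then obtain a t b where ab: "v = a @ [t] @ b" "lp v \<otimes> s = lp (a @ b)" using exchange[of v s] v s by metis
    have "len (lp v \<otimes> s) + 1 = len (lp v)" using False len_mult_S[of "lp v" s] s v by auto
    moreover have "length v = length (a @ b) + 1" using ab by simp
    ultimately have "length (a @ b) = len (lp (a @ b))" unfolding ab(2)[symmetric] using v(1) by linarith
    then show ?thesis using ab v s by (intro exI[of _ "a @ b"]) auto
  qed
qed

lemma parabolic_reduced:
  assumes "J \<subseteq> S" "x \<in> generate G J" obtains u where "reduced u" "set u \<subseteq> J" "lp u = x"
proof -
  obtain u where "set u \<subseteq> J" "lp u = x" using word_exists assms by metis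
  then show thesis using reduced_subword[of u] that assms by fastforce
qed

lemma len_inv_mult: assumes "x \<in> carrier G" "y \<in> carrier G" shows "len (inv x \<otimes> inv y) = len (y \<otimes> x)"
  using len_inv[of "y \<otimes> x"] assms by (simp add: inv_mult_group)

text \<open>Two left descents \<open>s, t\<close> of \<open>x\<close> force the longest element of their dihedral group to be a prefix of \<open>x\<close>:
  if the alternating initial part of \<open>x\<close> were shorter, the inverse of \<open>x\<close> would keep one of the two simple roots
  positive.\<close>

theorem two_descents:
  assumes x: "x \<in> carrier G" and st: "s \<in> S" "t \<in> S" "s \<noteq> t"
    and desc: "len (s \<otimes> x) < len x" "len (t \<otimes> x) < len x"
  obtains v where "m s t \<noteq> 0" "v \<in> carrier G" "x = lp (alternating (m s t) s t) \<otimes> v" "len x = m s t + len v"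
proof -
  have d: "len (inv x \<otimes> r) < len (inv x)" if "r \<in> {s, t}" for r
    using that desc st x len_inv_mult[of x r] by auto
  obtain v k p q where v: "v \<in> carrier G" "{p, q} = {s, t}" "inv x = v \<otimes> lp (rev (alternating k p q))"
    "len (inv x) = len v + k" "len (v \<otimes> s) > len v" "len (v \<otimes> t) > len v"
    using dihedral_decomposition[of "inv x" s t] x st by (metis inv_closed)
  have pq: "p \<in> S" "q \<in> S" "p \<noteq> q" "m p q = m s t" using v(2) st ord_swap by (auto simp: doubleton_eq_iff)
  have vp: "len (v \<otimes> p) > len v" "len (v \<otimes> q) > len v" using v(2,5,6) by (auto simp: doubleton_eq_iff)
  have al: "set (alternating i p q) \<subseteq> S" "set (alternating i q p) \<subseteq> S" for i
    using set_alternating_subset[of p S q i] set_alternating_subset[of q S p i] pq by simp_all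
  have km: "m s t \<noteq> 0 \<and> m s t \<le> k"
  proof (rule ccontr)
    assume "\<not> ?thesis"
    then have "m q p = 0 \<or> k < m q p" using pq ord_swap[of p q] by auto
    then obtain a b where ab: "0 \<le> a" "0 \<le> b"
        "foldr \<sigma> (rev (alternating k p q)) (\<alpha> q) = (\<lambda>r. a * \<alpha> q r + b * \<alpha> p r)"
      using dihedral_root[of q p k] pq by metis
    have "act (inv x) (\<alpha> q) = act v (\<lambda>r. a * \<alpha> q r + b * \<alpha> p r)"
      unfolding v(3) ab(3)[symmetric] using v(1) al by (simp add: act_mult act_lp)
    then have "0 \<le> act (inv x) (\<alpha> q) r" for r
      using ab act_simple_nonneg[OF v(1)] pq vp by (simp add: act_lin v(1))
    then have "act (inv x) (\<alpha> q) \<in> Pos" using x pq by (simp add: pos_roots_def)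
    moreover have "len (inv x \<otimes> q) < len (inv x)" using d v(2) by blast
    then have "act (inv x) (\<alpha> q) \<in> Neg" using act_simple_Neg_iff x pq by simp
    ultimately show False using not_Pos_Neg by blast
  qed
  let ?n = "m s t"
  have as: "set (alternating ?n s t) \<subseteq> S" using set_alternating_subset[of s S t] st by blast
  obtain r where r: "alternating k p q = alternating ?n p q @ r" "set r \<subseteq> S" "length r = k - ?n"
    using alternating_split[of ?n "k - ?n" p q] km al[of "k - ?n"] by fastforce
  have "lp (alternating ?n p q) = lp (alternating ?n s t)"
    using v(2) lp_alternating_eq[of s t] st km by (auto simp: doubleton_eq_iff)
  moreover have "x = lp (alternating k p q) \<otimes> inv v"
  proof -
    have "x = inv (inv x)" using x by simp
    also have "\<dots> = lp (alternating k p q) \<otimes> inv v"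
      unfolding v(3) using v(1) al by (simp add: inv_mult_group lp_rev)
    finally show ?thesis .
  qed
  ultimately have X: "x = lp (alternating ?n s t) \<otimes> (lp r \<otimes> inv v)"
    using r(1,2) al v(1) by (simp add: m_assoc as)
  have "len (lp r \<otimes> inv v) \<le> (k - ?n) + len v"
    using len_mult[of "lp r" "inv v"] len_le[of r] r v(1) by simp
  moreover have "len x \<le> ?n + len (lp r \<otimes> inv v)"
    using X len_mult[of "lp (alternating ?n s t)" "lp r \<otimes> inv v"] len_le[OF as] lp_closed[OF as] r v(1) by simp
  ultimately have "len x = ?n + len (lp r \<otimes> inv v)" using v(4) len_inv[OF x] km by linarith
  then show thesis using that[of "lp r \<otimes> inv v"] X km r v(1) by simp
qed

text \<open>A longest element of a finite parabolic subgroup makes every simple root of that subgroup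
  negative, hence every positive root supported there; so each reduced word can be split off.\<close>

lemma longest_element:
  assumes J: "J \<subseteq> S" and fin: "finite (carrier G)"
  obtains d where "d \<in> generate G J" "\<And>x. x \<in> generate G J \<Longrightarrow> len (d \<otimes> x) + len x = len d"
proof -
  let ?P = "generate G J"
  have sub: "?P \<subseteq> carrier G" "subgroup ?P G" using generate_incl generate_is_subgroup J S_carrier
    by (meson subset_trans)+
  have finP: "finite (len ` ?P)" "len ` ?P \<noteq> {}" using fin sub(1) finite_subset generate.one[of G J] by auto
  obtain d where d: "d \<in> ?P" "len d = Max (len ` ?P)" using Max_in[OF finP] by auto
  have max: "len x \<le> len d" if "x \<in> ?P" for x using d finP that by simp
  have dc: "d \<in> carrier G" using d sub by auto
  have dneg: "act d (\<alpha> s) \<in> Neg" if "s \<in> J" for s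
  proof (rule act_simple_Neg)
    have "d \<otimes> s \<in> ?P" using d that by (simp add: generate.eng generate.incl)
    then show "\<not> len d < len (d \<otimes> s)" using max by force
  qed (use that J dc in auto)
  have "set u \<subseteq> J \<Longrightarrow> reduced u \<Longrightarrow> len (d \<otimes> inv (lp u)) + length u = len d" for u
  proof (induct u)
    case Nil then show ?case using dc by simp
  next
    case (Cons s u)
    have s: "s \<in> S" "s \<in> J" "set u \<subseteq> S" "set u \<subseteq> J" using Cons J by auto
    have "reduced u" using reduced_append(2)[of "[s]" u] Cons by simp
    then have IH: "len (d \<otimes> inv (lp u)) + length u = len d" using Cons s by simp
    let ?\<beta> = "act (inv (lp u)) (\<alpha> s)"
    have "len (inv (lp u) \<otimes> s) = len (lp (s # u))" using s len_inv_mult[of "lp u" s] by simp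
    then have "len (inv (lp u) \<otimes> s) > len (inv (lp u))" using Cons \<open>reduced u\<close> s by simp
    then have P: "?\<beta> \<in> Pos" using act_simple_Pos s by simp
    have supp: "?\<beta> r = 0" if "r \<notin> J" for r
    proof -
      have "act (inv (lp u)) = foldr \<sigma> (rev u)" using s act_lp[of "rev u"] by (simp add: lp_rev)
      then show ?thesis using foldr_\<sigma>_support[of "rev u" J "\<alpha> s" r] s that
        by (simp add: simple_root_support)
    qed
    have dle: "act d v r \<le> 0" if "\<And>r. 0 \<le> v r" "\<And>r. r \<notin> J \<Longrightarrow> v r = 0" for v r
    proof -
      have fJ: "finite J" using J S_finite finite_subset by blast
      have "act d (\<lambda>r. if r \<in> A then v r else 0) r \<le> 0" if "finite A" "A \<subseteq> J" for A
        using that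
      proof (induct A)
        case empty
        have "act d (\<lambda>r. 0 * v r + 0 * v r) r = 0" by (simp only: act_lin[OF dc])
        then show ?case by simp
      next
        case (insert a A)
        have "(\<lambda>r. if r \<in> insert a A then v r else 0) =
            (\<lambda>r. v a * \<alpha> a r + 1 * (if r \<in> A then v r else 0))"
          using insert by (auto simp: simple_root_def fun_eq_iff)
        then have "act d (\<lambda>r. if r \<in> insert a A then v r else 0) r =
            v a * act d (\<alpha> a) r + act d (\<lambda>r. if r \<in> A then v r else 0) r"
          by (simp only: act_lin[OF dc])
        moreover have "act d (\<alpha> a) r \<le> 0"
          using dneg[of a] insert root_support[OF Neg_root, of "act d (\<alpha> a)" r]
          by (cases "r \<in> S") (auto simp: Neg_iff pos_roots_def neg_def)
        then have "v a * act d (\<alpha> a) r \<le> 0" using \<open>0 \<le> v a\<close> by (simp add: mult_nonneg_nonpos)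
        ultimately show ?case using insert by simp
      qed
      from this[OF fJ] have "act d (\<lambda>r. if r \<in> J then v r else 0) r \<le> 0" by simp
      moreover have "(\<lambda>r. if r \<in> J then v r else 0) = v" using that by (auto simp: fun_eq_iff)
      ultimately show ?thesis by simp
    qed
    have "0 \<le> ?\<beta> r" for r using P root_support[OF Pos_root[OF P], of r]
      by (cases "r \<in> S") (auto simp: pos_roots_def)
    then have "act d ?\<beta> r \<le> 0" for r using dle supp by blast
    then have "act (d \<otimes> inv (lp u)) (\<alpha> s) r \<le> 0" for r using dc s by (simp add: act_mult)
    then have "act (d \<otimes> inv (lp u)) (\<alpha> s) \<in> Neg"
      unfolding Neg_iff pos_roots_def using dc s by (auto simp: neg_root) (auto simp: neg_def)
    then have "len (d \<otimes> inv (lp u) \<otimes> s) < len (d \<otimes> inv (lp u))" using act_simple_Neg_iff dc s by simp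
    then have "len (d \<otimes> inv (lp u) \<otimes> s) + 1 = len (d \<otimes> inv (lp u))"
      using len_mult_S[of "d \<otimes> inv (lp u)" s] dc s by auto
    then show ?case using IH s dc by (simp add: inv_mult_group m_assoc)
  qed
  note split = this
  have "len (d \<otimes> x) + len x = len d" if x: "x \<in> ?P" for x
  proof -
    have "inv x \<in> ?P" using x sub by (simp add: subgroup.m_inv_closed)
    then obtain u where u: "reduced u" "set u \<subseteq> J" "lp u = inv x" using parabolic_reduced[OF J] by metis
    have "x \<in> carrier G" using x sub by auto
    then show ?thesis using split[OF u(2,1)] u len_inv[of x] by simp
  qed
  then show thesis using that d by blast
qed

section \<open>Diagram automorphisms\<close>

definition diag :: "('a \<Rightarrow> 'a) \<Rightarrow> bool" where
  "diag f \<longleftrightarrow> f \<in> hom G G \<and> inj_on f (carrier G) \<and> f ` S = S"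

lemma diag_closed: "diag f \<Longrightarrow> x \<in> carrier G \<Longrightarrow> f x \<in> carrier G"
  and diag_mult: "diag f \<Longrightarrow> x \<in> carrier G \<Longrightarrow> y \<in> carrier G \<Longrightarrow> f (x \<otimes> y) = f x \<otimes> f y"
  and diag_inj: "diag f \<Longrightarrow> x \<in> carrier G \<Longrightarrow> y \<in> carrier G \<Longrightarrow> f x = f y \<longleftrightarrow> x = y"
  and diag_image: "diag f \<Longrightarrow> f ` S = S"
  by (auto simp: diag_def hom_def inj_on_def)

lemma diag_S: "diag f \<Longrightarrow> s \<in> S \<Longrightarrow> f s \<in> S"
  using diag_image by blast

lemma diag_one: "diag f \<Longrightarrow> f \<one> = \<one>"
  using hom_one[of f G G] is_group by (simp add: diag_def)

lemma diag_inv: assumes "diag f" "x \<in> carrier G" shows "f (inv x) = inv (f x)"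
  using diag_mult[OF assms(1), of "inv x" x] assms diag_one[OF assms(1)] diag_closed[OF assms(1)]
  by (simp add: inv_equality)

lemma diag_set: assumes "diag f" "set u \<subseteq> S" shows "f ` set u \<subseteq> S"
  using assms diag_S[OF assms(1)] by blast

lemma diag_lp: assumes f: "diag f" and u: "set u \<subseteq> S" shows "lp (map f u) = f (lp u)"
  using u by (induct u) (simp_all add: diag_one[OF f] diag_mult[OF f])

lemma diag_word: assumes "diag f" "set v \<subseteq> S" obtains u where "set u \<subseteq> S" "v = map f u"
proof -
  have "set v \<subseteq> f ` S" using assms diag_image[of f] by simp
  then have "\<exists>u. set u \<subseteq> S \<and> v = map f u"
  proof (induct v)
    case Nil then show ?case by simp
  next
    case (Cons t v)
    then obtain s u where "s \<in> S" "t = f s" "set u \<subseteq> S" "v = map f u" by auto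
    then show ?case by (intro exI[of _ "s # u"]) simp
  qed
  then show thesis using that by blast
qed

lemma diag_len: assumes f: "diag f" and x: "x \<in> carrier G" shows "len (f x) = len x"
proof (rule antisym)
  obtain u where "set u \<subseteq> S" "lp u = x" "length u = len x" using len_ex[OF x] by blast
  then show "len (f x) \<le> len x" using diag_lp[OF f] diag_set[OF f] len_le[of "map f u"] by simp
next
  obtain v where v: "set v \<subseteq> S" "lp v = f x" "length v = len (f x)"
    using len_ex[OF diag_closed[OF f x]] by blast
  then obtain u where u: "set u \<subseteq> S" "v = map f u" using diag_word[OF f] by metis
  then have "lp u = x" using v diag_lp[OF f u(1)] diag_inj[OF f _ x, of "lp u"] by simp
  then show "len x \<le> len (f x)" using u v len_le[of u] by simp
qed

lemmas diag_rules = diag_closed diag_mult diag_S diag_one diag_inv diag_set diag_lp diag_len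

lemma diag_reduced: assumes "diag f" "set u \<subseteq> S" shows "reduced (map f u) \<longleftrightarrow> reduced u"
  using assms(2) by (simp add: diag_rules[OF assms(1)])

lemma diag_m: assumes f: "diag f" and st: "s \<in> S" "t \<in> S" shows "m (f s) (f t) = m s t"
proof -
  note [simp] = diag_rules[OF f]
  have x: "s \<otimes> t \<in> carrier G" using st by simp
  have "f (s \<otimes> t) [^] n = f ((s \<otimes> t) [^] n)" for n :: nat
    by (induct n) (use st in simp_all)
  then have "f (s \<otimes> t) [^] n = \<one> \<longleftrightarrow> (s \<otimes> t) [^] n = \<one>" for n :: nat
    using diag_inj[OF f, of "(s \<otimes> t) [^] n" \<one>] x by (simp only: diag_one[OF f] one_closed nat_pow_closed)
  then have "ord (f (s \<otimes> t)) = ord (s \<otimes> t)"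
    using ord_unique[OF diag_closed[OF f x]] pow_eq_id[OF x] by metis
  then show ?thesis using st by simp
qed

lemma diag_id: "diag (\<lambda>x. x)" by (simp add: diag_def hom_def)

lemma diag_comp: "diag f \<Longrightarrow> diag g \<Longrightarrow> diag (\<lambda>x. f (g x))"
proof -
  assume fg: "diag f" "diag g"
  have "(\<lambda>x. f (g x)) ` S = f ` g ` S" by (simp add: image_image)
  then have "(\<lambda>x. f (g x)) ` S = S" using fg by (simp add: diag_image)
  moreover have "inj_on (\<lambda>x. f (g x)) (carrier G)" by (rule inj_onI) (use fg in \<open>metis diag_closed diag_inj\<close>)
  moreover have "(\<lambda>x. f (g x)) \<in> hom G G" using fg
    by (auto simp: hom_def diag_closed[OF fg(1)] diag_closed[OF fg(2)] diag_mult[OF fg(1)] diag_mult[OF fg(2)])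
  ultimately show ?thesis by (simp add: diag_def)
qed

lemma len_1: assumes "x \<in> carrier G" "len x = 1" shows "x \<in> S"
proof -
  obtain u where "set u \<subseteq> S" "lp u = x" "length u = 1" using len_ex[OF assms(1)] assms(2) by metis
  then show ?thesis by (cases u) auto
qed

end

section \<open>Semidirect products\<close>

lemma semidirect_simps:
  "carrier (semidirect K \<phi> N) = carrier K \<times> carrier N"
  "(k, x) \<otimes>\<^bsub>semidirect K \<phi> N\<^esub> (l, y) = (k \<otimes>\<^bsub>K\<^esub> l, \<phi> (inv\<^bsub>K\<^esub> l) x \<otimes>\<^bsub>N\<^esub> y)"
  "\<one>\<^bsub>semidirect K \<phi> N\<^esub> = (\<one>\<^bsub>K\<^esub>, \<one>\<^bsub>N\<^esub>)"
  by (simp_all add: semidirect_def)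

lemma semidirect_monoid:
  assumes K: "group K" and N: "monoid N"
    and cl: "\<And>k x. k \<in> carrier K \<Longrightarrow> x \<in> carrier N \<Longrightarrow> \<phi> k x \<in> carrier N"
    and hom: "\<And>k x y. k \<in> carrier K \<Longrightarrow> x \<in> carrier N \<Longrightarrow> y \<in> carrier N \<Longrightarrow>
        \<phi> k (x \<otimes>\<^bsub>N\<^esub> y) = \<phi> k x \<otimes>\<^bsub>N\<^esub> \<phi> k y"
    and unit: "\<And>k. k \<in> carrier K \<Longrightarrow> \<phi> k \<one>\<^bsub>N\<^esub> = \<one>\<^bsub>N\<^esub>"
    and act: "\<And>k l x. k \<in> carrier K \<Longrightarrow> l \<in> carrier K \<Longrightarrow> x \<in> carrier N \<Longrightarrow>
        \<phi> (k \<otimes>\<^bsub>K\<^esub> l) x = \<phi> k (\<phi> l x)"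
    and one: "\<And>x. x \<in> carrier N \<Longrightarrow> \<phi> \<one>\<^bsub>K\<^esub> x = x"
  shows "monoid (semidirect K \<phi> N)"
proof -
  interpret K: group K by fact
  interpret N: monoid N by fact
  show ?thesis
    by (rule monoidI)
      (auto simp: semidirect_simps K.m_assoc N.m_assoc cl hom unit act one K.inv_mult_group)
qed

lemma semidirect_group:
  assumes K: "group K" and N: "group N"
    and cl: "\<And>k x. k \<in> carrier K \<Longrightarrow> x \<in> carrier N \<Longrightarrow> \<phi> k x \<in> carrier N"
    and hom: "\<And>k x y. k \<in> carrier K \<Longrightarrow> x \<in> carrier N \<Longrightarrow> y \<in> carrier N \<Longrightarrow>
        \<phi> k (x \<otimes>\<^bsub>N\<^esub> y) = \<phi> k x \<otimes>\<^bsub>N\<^esub> \<phi> k y"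
    and act: "\<And>k l x. k \<in> carrier K \<Longrightarrow> l \<in> carrier K \<Longrightarrow> x \<in> carrier N \<Longrightarrow>
        \<phi> (k \<otimes>\<^bsub>K\<^esub> l) x = \<phi> k (\<phi> l x)"
    and one: "\<And>x. x \<in> carrier N \<Longrightarrow> \<phi> \<one>\<^bsub>K\<^esub> x = x"
  shows "group (semidirect K \<phi> N)"
    and "\<And>k x. k \<in> carrier K \<Longrightarrow> x \<in> carrier N \<Longrightarrow>
      inv\<^bsub>semidirect K \<phi> N\<^esub> (k, x) = (inv\<^bsub>K\<^esub> k, \<phi> k (inv\<^bsub>N\<^esub> x))"
proof -
  interpret K: group K by fact
  interpret N: group N by fact
  have unit: "\<phi> k \<one>\<^bsub>N\<^esub> = \<one>\<^bsub>N\<^esub>" if "k \<in> carrier K" for k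
  proof -
    have "\<phi> k \<one>\<^bsub>N\<^esub> \<otimes>\<^bsub>N\<^esub> \<phi> k \<one>\<^bsub>N\<^esub> = \<phi> k \<one>\<^bsub>N\<^esub>" using hom[of k "\<one>\<^bsub>N\<^esub>" "\<one>\<^bsub>N\<^esub>"] that by simp
    then show ?thesis using that cl by simp
  qed
  have M: "monoid (semidirect K \<phi> N)"
    using semidirect_monoid[OF K N.is_monoid cl hom unit act one] by simp
  interpret M: monoid "semidirect K \<phi> N" by fact
  have left: "(inv\<^bsub>K\<^esub> k, \<phi> k (inv\<^bsub>N\<^esub> x)) \<otimes>\<^bsub>semidirect K \<phi> N\<^esub> (k, x) = \<one>\<^bsub>semidirect K \<phi> N\<^esub>"
    if "k \<in> carrier K" "x \<in> carrier N" for k x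
    using that by (simp add: semidirect_simps act[symmetric] one)
  show G: "group (semidirect K \<phi> N)"
  proof (rule groupI)
    fix g assume "g \<in> carrier (semidirect K \<phi> N)"
    then obtain k x where "g = (k, x)" "k \<in> carrier K" "x \<in> carrier N" by (auto simp: semidirect_simps)
    then show "\<exists>h\<in>carrier (semidirect K \<phi> N). h \<otimes>\<^bsub>semidirect K \<phi> N\<^esub> g = \<one>\<^bsub>semidirect K \<phi> N\<^esub>"
      using left cl by (intro bexI[of _ "(inv\<^bsub>K\<^esub> k, \<phi> k (inv\<^bsub>N\<^esub> x))"]) (auto simp: semidirect_simps)
  qed (auto simp: M.m_assoc)
  show "inv\<^bsub>semidirect K \<phi> N\<^esub> (k, x) = (inv\<^bsub>K\<^esub> k, \<phi> k (inv\<^bsub>N\<^esub> x))"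
    if "k \<in> carrier K" "x \<in> carrier N" for k x
    using group.inv_equality[OF G left[OF that]] that cl by (simp add: semidirect_simps)
qed

section \<open>Twists\<close>

locale twisted = coxeter +
  fixes \<Omega> :: "('a \<Rightarrow> 'a) set"
  assumes twisted: "twisted_coxeter G S \<Omega>"
begin

abbreviation K :: "('a \<Rightarrow> 'a) monoid" where "K \<equiv> twist_group G \<Omega>"

lemma Omega_sub: "subgroup \<Omega> (AutoGroup G)"
  and Omega_S: "\<delta> \<in> \<Omega> \<Longrightarrow> \<delta> ` S = S"
  using twisted by (auto simp: twisted_coxeter_def)

lemma Omega_auto: "\<delta> \<in> \<Omega> \<Longrightarrow> \<delta> \<in> auto G"
  using subgroup.subset[OF Omega_sub] by (auto simp: AutoGroup_def)

sublocale K: group K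
  unfolding twist_group_def using subgroup.subgroup_is_group[OF Omega_sub AutoGroup] by simp

lemma K_carrier [simp]: "carrier K = \<Omega>" by (simp add: twist_group_def)

lemma K_one: "\<one>\<^bsub>K\<^esub> = \<one>\<^bsub>AutoGroup G\<^esub>" by (simp add: twist_group_def)

lemma K_one_in [simp]: "\<one>\<^bsub>K\<^esub> \<in> \<Omega>" using K.one_closed by simp

lemma K_one_apply [simp]: "x \<in> carrier G \<Longrightarrow> \<one>\<^bsub>K\<^esub> x = x"
  by (simp add: twist_group_def AutoGroup_def BijGroup_def)

lemma K_mult_apply [simp]: "\<delta> \<in> \<Omega> \<Longrightarrow> \<epsilon> \<in> \<Omega> \<Longrightarrow> x \<in> carrier G \<Longrightarrow> (\<delta> \<otimes>\<^bsub>K\<^esub> \<epsilon>) x = \<delta> (\<epsilon> x)"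
  using Omega_auto by (simp add: twist_group_def AutoGroup_def BijGroup_def auto_def compose_eq)

lemma Omega_diag: "\<delta> \<in> \<Omega> \<Longrightarrow> diag \<delta>"
  using Omega_auto[of \<delta>] Omega_S[of \<delta>] by (simp add: diag_def auto_def Bij_def bij_betw_def)

lemmas Omega_mult [simp] = diag_mult[OF Omega_diag]
  and Omega_closed [simp] = diag_closed[OF Omega_diag]
  and Omega_one [simp] = diag_one[OF Omega_diag]
  and Omega_inv [simp] = diag_inv[OF Omega_diag]
  and Omega_S_closed [simp] = diag_S[OF Omega_diag]
  and Omega_set [simp] = diag_set[OF Omega_diag]
  and Omega_lp [simp] = diag_lp[OF Omega_diag]
  and Omega_len [simp] = diag_len[OF Omega_diag]
  and Omega_inj = diag_inj[OF Omega_diag]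

lemma K_inv_in [simp]: "\<delta> \<in> \<Omega> \<Longrightarrow> inv\<^bsub>K\<^esub> \<delta> \<in> \<Omega>" using K.inv_closed by simp

lemma K_inv_apply [simp]:
  assumes "\<delta> \<in> \<Omega>" "x \<in> carrier G"
  shows "(inv\<^bsub>K\<^esub> \<delta>) (\<delta> x) = x" "\<delta> ((inv\<^bsub>K\<^esub> \<delta>) x) = x"
  using assms K_mult_apply[of "inv\<^bsub>K\<^esub> \<delta>" \<delta> x] K_mult_apply[of \<delta> "inv\<^bsub>K\<^esub> \<delta>" x]
    K.l_inv[of \<delta>] K.r_inv[of \<delta>] by simp_all

lemma cf_twist: "\<delta> \<in> \<Omega> \<Longrightarrow> s \<in> S \<Longrightarrow> t \<in> S \<Longrightarrow> cf (\<delta> s) (\<delta> t) = cf s t"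
  by (simp add: cf_def diag_m[OF Omega_diag])

abbreviation tv :: "('a \<Rightarrow> 'a) \<Rightarrow> ('a \<Rightarrow> real) \<Rightarrow> ('a \<Rightarrow> real)" where "tv \<equiv> twist_act S"

lemma tv_apply: assumes "\<delta> \<in> \<Omega>" "s \<in> S" shows "tv \<delta> v (\<delta> s) = v s"
proof -
  have "tv \<delta> v (\<delta> s) = (\<Sum>r\<in>S. if r = s then v r else 0)"
    unfolding twist_act_def simple_root_def
    by (rule sum.cong[OF HOL.refl]) (use assms Omega_inj[OF assms(1), of s] in auto)
  then show ?thesis using assms S_finite by simp
qed

lemma tv_outside: assumes "\<delta> \<in> \<Omega>" "t \<notin> S" shows "tv \<delta> v t = 0"
  unfolding twist_act_def simple_root_def by (rule sum.neutral) (use assms in auto)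

lemma twist_coords:
  assumes "\<delta> \<in> \<Omega>" "\<And>s. s \<in> S \<Longrightarrow> f (\<delta> s) = g (\<delta> s)" "\<And>r. r \<notin> S \<Longrightarrow> f r = g r"
  shows "f = g"
proof
  fix r show "f r = g r"
  proof (cases "r \<in> S")
    case True
    then have "r \<in> \<delta> ` S" using Omega_S[OF assms(1)] by simp
    then obtain s where "s \<in> S" "r = \<delta> s" by blast
    then show ?thesis using assms by simp
  qed (use assms in simp)
qed

lemma tv_lin: assumes "\<delta> \<in> \<Omega>"
  shows "tv \<delta> (\<lambda>t. a * v t + b * w t) = (\<lambda>t. a * tv \<delta> v t + b * tv \<delta> w t)"
  by (rule twist_coords[OF assms]) (simp_all add: tv_apply tv_outside assms)

lemma tv_simple [simp]: "\<delta> \<in> \<Omega> \<Longrightarrow> s \<in> S \<Longrightarrow> tv \<delta> (\<alpha> s) = \<alpha> (\<delta> s)"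
  by (rule twist_coords) (auto simp: tv_apply tv_outside simple_root_def Omega_inj)

lemma tv_mult: "\<delta> \<in> \<Omega> \<Longrightarrow> \<epsilon> \<in> \<Omega> \<Longrightarrow> tv (\<delta> \<otimes>\<^bsub>K\<^esub> \<epsilon>) v = tv \<delta> (tv \<epsilon> v)"
proof (rule twist_coords[of "\<delta> \<otimes>\<^bsub>K\<^esub> \<epsilon>"])
  assume d: "\<delta> \<in> \<Omega>" "\<epsilon> \<in> \<Omega>"
  then show m: "\<delta> \<otimes>\<^bsub>K\<^esub> \<epsilon> \<in> \<Omega>" using K.m_closed by simp
  fix s assume s: "s \<in> S"
  have "tv (\<delta> \<otimes>\<^bsub>K\<^esub> \<epsilon>) v ((\<delta> \<otimes>\<^bsub>K\<^esub> \<epsilon>) s) = v s" using m s by (rule tv_apply)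
  also have "v s = tv \<delta> (tv \<epsilon> v) (\<delta> (\<epsilon> s))" using d s by (simp add: tv_apply)
  finally show "tv (\<delta> \<otimes>\<^bsub>K\<^esub> \<epsilon>) v ((\<delta> \<otimes>\<^bsub>K\<^esub> \<epsilon>) s) = tv \<delta> (tv \<epsilon> v) ((\<delta> \<otimes>\<^bsub>K\<^esub> \<epsilon>) s)"
    using d s by simp
next
  fix r assume "\<delta> \<in> \<Omega>" "\<epsilon> \<in> \<Omega>" "r \<notin> S"
  then show "tv (\<delta> \<otimes>\<^bsub>K\<^esub> \<epsilon>) v r = tv \<delta> (tv \<epsilon> v) r"
    using K.m_closed[of \<delta> \<epsilon>] by (simp add: tv_outside)
qed

lemma tv_one: "(\<And>r. r \<notin> S \<Longrightarrow> v r = 0) \<Longrightarrow> tv \<one>\<^bsub>K\<^esub> v = v"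
  using tv_apply[of "\<one>\<^bsub>K\<^esub>" _ v] by (intro twist_coords[of "\<one>\<^bsub>K\<^esub>"]) (auto simp: tv_outside)

lemma tv_\<sigma>: assumes "\<delta> \<in> \<Omega>" "s \<in> S" shows "tv \<delta> (\<sigma> s v) = \<sigma> (\<delta> s) (tv \<delta> v)"
proof -
  have "bij_betw \<delta> S S" using Omega_S[OF assms(1)] Omega_inj[OF assms(1)]
    by (auto simp: bij_betw_def inj_on_def)
  then have "(\<Sum>t\<in>S. tv \<delta> v t * cf (\<delta> s) t) = (\<Sum>t\<in>S. tv \<delta> v (\<delta> t) * cf (\<delta> s) (\<delta> t))"
    by (rule sum.reindex_bij_betw[symmetric])
  then have "B (\<alpha> (\<delta> s)) (tv \<delta> v) = B (\<alpha> s) v"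
    using assms by (simp add: B_simple tv_apply cf_twist)
  then show ?thesis unfolding \<sigma>_def tv_lin[OF assms(1)] using assms by simp
qed

lemma tv_act: assumes d: "\<delta> \<in> \<Omega>" and x: "x \<in> carrier G" shows "tv \<delta> (act x v) = act (\<delta> x) (tv \<delta> v)"
proof -
  obtain u where u: "set u \<subseteq> S" "lp u = x" using word_ex[OF x] by blast
  have "tv \<delta> (foldr \<sigma> u v) = foldr \<sigma> (map \<delta> u) (tv \<delta> v)" using u(1)
    by (induct u) (auto simp: tv_\<sigma> d)
  then show ?thesis using act_lp[of u] act_lp[of "map \<delta> u"] u d by auto
qed

lemma tv_root [simp]: "\<delta> \<in> \<Omega> \<Longrightarrow> \<beta> \<in> Phi \<Longrightarrow> tv \<delta> \<beta> \<in> Phi"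
proof -
  assume d: "\<delta> \<in> \<Omega>" and "\<beta> \<in> Phi"
  then obtain x s where "x \<in> carrier G" "s \<in> S" "\<beta> = act x (\<alpha> s)" by (auto simp: roots_def)
  then show ?thesis using d by (simp add: tv_act)
qed

lemma tv_Pos [simp]: "\<delta> \<in> \<Omega> \<Longrightarrow> \<beta> \<in> Pos \<Longrightarrow> tv \<delta> \<beta> \<in> Pos"
proof -
  assume d: "\<delta> \<in> \<Omega>" and b: "\<beta> \<in> Pos"
  have "0 \<le> tv \<delta> \<beta> r" if "r \<in> S" for r
  proof -
    have "r \<in> \<delta> ` S" using that Omega_S[OF d] by simp
    then obtain s where "s \<in> S" "r = \<delta> s" by blast
    then show ?thesis using b d by (simp add: tv_apply pos_roots_def)
  qed
  then show ?thesis using d Pos_root[OF b] by (simp add: pos_roots_def)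
qed

lemma tv_neg: "\<delta> \<in> \<Omega> \<Longrightarrow> tv \<delta> (neg v) = neg (tv \<delta> v)"
  using tv_lin[of \<delta> "-1" v 0 v] by (simp add: neg_def)

lemma tv_Neg: "\<delta> \<in> \<Omega> \<Longrightarrow> \<beta> \<in> Neg \<Longrightarrow> tv \<delta> \<beta> \<in> Neg"
  using tv_Pos[of \<delta> "neg \<beta>"] by (simp add: Neg_iff tv_neg)

section \<open>The twisted Coxeter group acting on the roots\<close>

abbreviation W :: "(('a \<Rightarrow> 'a) \<times> 'a) monoid" where "W \<equiv> tw_group G \<Omega>"
abbreviation A :: "('a \<Rightarrow> 'a) \<times> 'a \<Rightarrow> ('a \<Rightarrow> real) \<Rightarrow> ('a \<Rightarrow> real)" where "A \<equiv> tw_act G S"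
abbreviation tlen :: "('a \<Rightarrow> 'a) \<times> 'a \<Rightarrow> nat" where "tlen \<equiv> tw_length G S"

sublocale W: group W
  unfolding tw_group_def by (rule semidirect_group) (auto simp: K.group_axioms group_axioms)

lemma W_carrier: "carrier W = \<Omega> \<times> carrier G"
  by (simp add: tw_group_def semidirect_simps)

lemma W_mult: "(\<delta>, x) \<otimes>\<^bsub>W\<^esub> (\<epsilon>, y) = (\<delta> \<otimes>\<^bsub>K\<^esub> \<epsilon>, (inv\<^bsub>K\<^esub> \<epsilon>) x \<otimes> y)"
  by (simp add: tw_group_def semidirect_simps)

lemma W_one: "\<one>\<^bsub>W\<^esub> = (\<one>\<^bsub>K\<^esub>, \<one>)" by (simp add: tw_group_def semidirect_simps)

lemma W_inv: "\<delta> \<in> \<Omega> \<Longrightarrow> x \<in> carrier G \<Longrightarrow> inv\<^bsub>W\<^esub> (\<delta>, x) = (inv\<^bsub>K\<^esub> \<delta>, \<delta> (inv x))"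
  unfolding tw_group_def by (rule semidirect_group) (auto simp: K.group_axioms group_axioms)

lemma W_cancel [simp]:
  assumes "t \<in> carrier W" "x \<in> carrier W"
  shows "inv\<^bsub>W\<^esub> t \<otimes>\<^bsub>W\<^esub> (t \<otimes>\<^bsub>W\<^esub> x) = x" "t \<otimes>\<^bsub>W\<^esub> (inv\<^bsub>W\<^esub> t \<otimes>\<^bsub>W\<^esub> x) = x"
  using assms by (simp_all add: W.m_assoc[symmetric])

lemma A_mult:
  assumes "v \<in> carrier W" "w \<in> carrier W" shows "A (v \<otimes>\<^bsub>W\<^esub> w) \<beta> = A v (A w \<beta>)"
proof -
  obtain \<delta> x \<epsilon> y where [simp]: "v = (\<delta>, x)" "w = (\<epsilon>, y)" "\<delta> \<in> \<Omega>" "\<epsilon> \<in> \<Omega>" "x \<in> carrier G" "y \<in> carrier G"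
    using assms by (auto simp: W_carrier)
  show ?thesis by (simp add: W_mult tw_act_def tv_mult act_mult tv_act)
qed

lemma A_one: "\<beta> \<in> Phi \<Longrightarrow> A \<one>\<^bsub>W\<^esub> \<beta> = \<beta>"
  by (simp add: W_one tw_act_def tv_one root_support)

lemma A_root [simp]: "w \<in> carrier W \<Longrightarrow> \<beta> \<in> Phi \<Longrightarrow> A w \<beta> \<in> Phi"
  by (auto simp: W_carrier tw_act_def)

lemma A_inv [simp]: "w \<in> carrier W \<Longrightarrow> \<beta> \<in> Phi \<Longrightarrow> A (inv\<^bsub>W\<^esub> w) (A w \<beta>) = \<beta>"
  "w \<in> carrier W \<Longrightarrow> \<beta> \<in> Phi \<Longrightarrow> A w (A (inv\<^bsub>W\<^esub> w) \<beta>) = \<beta>"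
  by (simp_all add: A_mult[symmetric] A_one)

lemma A_inj: "w \<in> carrier W \<Longrightarrow> inj_on (A w) Phi"
  by (rule inj_on_inverseI[of _ "A (inv\<^bsub>W\<^esub> w)"]) simp

lemma A_neg: "w \<in> carrier W \<Longrightarrow> A w (neg v) = neg (A w v)"
  by (auto simp: W_carrier tw_act_def act_neg' tv_neg)

lemma inversions_Inv: assumes "\<delta> \<in> \<Omega>" "x \<in> carrier G" shows "inversions G S (\<delta>, x) = Inv x"
proof -
  have "tv \<delta> (act x \<beta>) \<in> Neg \<longleftrightarrow> act x \<beta> \<in> Neg" if "\<beta> \<in> Pos" for \<beta>
    using tv_Neg[OF assms(1)] tv_Pos[OF assms(1)] not_Pos_Neg Pos_or_Neg act_root[OF assms(2) Pos_root[OF that]]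
    by blast
  then show ?thesis by (auto simp: inversions_def Inv_def tw_act_def)
qed

lemma tl_len: "\<delta> \<in> \<Omega> \<Longrightarrow> x \<in> carrier G \<Longrightarrow> tlen (\<delta>, x) = len x"
  by (simp add: tw_length_def inversions_Inv card_Inv)

lemma tl_inv: "w \<in> carrier W \<Longrightarrow> tlen (inv\<^bsub>W\<^esub> w) = tlen w"
proof -
  assume "w \<in> carrier W"
  then obtain \<delta> x where "w = (\<delta>, x)" "\<delta> \<in> \<Omega>" "x \<in> carrier G" by (auto simp: W_carrier)
  then show ?thesis using W_inv[of \<delta> x] by (simp add: tl_len del: Omega_inv)
qed

lemma finite_inversions: "w \<in> carrier W \<Longrightarrow> finite (inversions G S w)"
  by (auto simp: W_carrier inversions_Inv card_Inv)

lemma inversions_iff: "\<beta> \<in> inversions G S w \<longleftrightarrow> \<beta> \<in> Pos \<and> A w \<beta> \<in> Neg"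
  by (simp add: inversions_def)

text \<open>Passing from \<open>w\<close> to \<open>v w\<close> replaces some inversions of \<open>w\<close> by new ones, and both kinds are
  counted by the inversions of \<open>v\<close>, according to the sign of their preimages.\<close>

lemma tl_mult:
  assumes v: "v \<in> carrier W" and w: "w \<in> carrier W"
  defines "X \<equiv> {\<gamma> \<in> inversions G S v. A (inv\<^bsub>W\<^esub> w) \<gamma> \<in> Pos}"
    and "Y \<equiv> {\<gamma> \<in> inversions G S v. A (inv\<^bsub>W\<^esub> w) \<gamma> \<in> Neg}"
  shows "tlen (v \<otimes>\<^bsub>W\<^esub> w) + card Y = tlen w + card X" "card X + card Y = tlen v" "finite X" "finite Y"
proof -
  let ?i = "A (inv\<^bsub>W\<^esub> w)" and ?I = "inversions G S"
  have ic: "inv\<^bsub>W\<^esub> w \<in> carrier W" using w by simp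
  have inP: "\<gamma> \<in> Phi" if "\<gamma> \<in> ?I u" for \<gamma> u using that by (simp add: inversions_iff Pos_root)
  show fin: "finite X" "finite Y" using finite_inversions[OF v] by (auto simp: X_def Y_def)
  have "?I v = X \<union> Y" "X \<inter> Y = {}"
    unfolding X_def Y_def using Pos_or_Neg[OF A_root[OF ic inP]] not_Pos_Neg by blast+
  then show "card X + card Y = tlen v" using fin by (simp add: tw_length_def card_Un_disjoint)
  let ?Y = "(\<lambda>\<gamma>. neg (?i \<gamma>)) ` Y"
  have XY: "X \<subseteq> Phi" "Y \<subseteq> Phi" unfolding X_def Y_def using inP by blast+
  have "inj_on ?i Phi" using A_inj ic by blast
  then have inj: "inj_on ?i X" "inj_on (\<lambda>\<gamma>. neg (?i \<gamma>)) Y"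
    using XY by (auto simp: inj_on_def) (metis neg_neg subsetD)
  have sub: "?Y \<subseteq> ?I w"
  proof
    fix \<beta> assume "\<beta> \<in> ?Y"
    then obtain \<gamma> where g: "\<gamma> \<in> Y" "\<beta> = neg (?i \<gamma>)" by blast
    then show "\<beta> \<in> ?I w"
      using XY w by (auto simp: Y_def inversions_iff A_neg Neg_neg) (metis Neg_iff)
  qed
  have eq: "?I (v \<otimes>\<^bsub>W\<^esub> w) = (?I w - ?Y) \<union> ?i ` X"
  proof (intro equalityI subsetI)
    fix \<beta> assume b: "\<beta> \<in> ?I (v \<otimes>\<^bsub>W\<^esub> w)"
    then have b': "\<beta> \<in> Pos" "\<beta> \<in> Phi" "A v (A w \<beta>) \<in> Neg"
      using v w by (auto simp: inversions_iff A_mult Pos_root)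
    show "\<beta> \<in> (?I w - ?Y) \<union> ?i ` X"
    proof (cases "A w \<beta> \<in> Pos")
      case True
      then have "A w \<beta> \<in> X" using b' w by (simp add: X_def inversions_iff)
      then have "?i (A w \<beta>) \<in> ?i ` X" by (rule imageI)
      then show ?thesis using b' w by simp
    next
      case False
      then have N: "A w \<beta> \<in> Neg" using Pos_or_Neg b' w A_root by blast
      have "\<beta> \<notin> ?Y"
      proof
        assume "\<beta> \<in> ?Y"
        then obtain \<gamma> where g: "\<gamma> \<in> Y" "\<beta> = neg (?i \<gamma>)" by blast
        then have "A w \<beta> = neg \<gamma>" using XY w by (auto simp: A_neg)
        then have "A v (neg \<gamma>) \<in> Neg" using b' by simp
        then have "A v \<gamma> \<in> Pos" using v by (simp add: A_neg Neg_neg)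
        then show False using g not_Pos_Neg by (auto simp: Y_def inversions_iff)
      qed
      then show ?thesis using b' N by (simp add: inversions_iff)
    qed
  next
    fix \<beta> assume "\<beta> \<in> (?I w - ?Y) \<union> ?i ` X"
    then consider "\<beta> \<in> ?I w" "\<beta> \<notin> ?Y" | \<gamma> where "\<gamma> \<in> X" "\<beta> = ?i \<gamma>" by blast
    then show "\<beta> \<in> ?I (v \<otimes>\<^bsub>W\<^esub> w)"
    proof cases
      case 1
      then have b: "\<beta> \<in> Pos" "A w \<beta> \<in> Neg" "\<beta> \<in> Phi" by (auto simp: inversions_iff Pos_root)
      have "A v (A w \<beta>) \<in> Neg"
      proof (rule ccontr)
        assume "A v (A w \<beta>) \<notin> Neg"
        then have "A v (A w \<beta>) \<in> Pos" using Pos_or_Neg b v w by (meson A_root)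
        then have "neg (A w \<beta>) \<in> Y" using b v w
          by (simp add: Y_def inversions_iff A_neg Neg_iff)
        then have "neg (?i (neg (A w \<beta>))) \<in> ?Y" by (rule imageI)
        then have "\<beta> \<in> ?Y" using b w ic by (simp add: A_neg)
        then show False using 1 by simp
      qed
      then show ?thesis using b v w by (simp add: inversions_iff A_mult)
    next
      case 2
      then show ?thesis using XY v w by (auto simp: X_def inversions_iff A_mult)
    qed
  qed
  have disj: "(?I w - ?Y) \<inter> ?i ` X = {}"
  proof -
    have "?i \<gamma> \<notin> ?I w" if "\<gamma> \<in> X" for \<gamma>
      using that XY w not_Pos_Neg by (auto simp: X_def inversions_iff)
    then show ?thesis by blast
  qed
  have "card (?I (v \<otimes>\<^bsub>W\<^esub> w)) = card (?I w - ?Y) + card (?i ` X)"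
    unfolding eq by (rule card_Un_disjoint) (use finite_inversions[OF w] fin disj in auto)
  also have "\<dots> = (card (?I w) - card Y) + card X"
    using card_Diff_subset[of ?Y "?I w"] sub fin card_image[OF inj(1)] card_image[OF inj(2)] by simp
  finally show "tlen (v \<otimes>\<^bsub>W\<^esub> w) + card Y = tlen w + card X"
    using card_mono[OF finite_inversions[OF w] sub] card_image[OF inj(2)] by (simp add: tw_length_def)
qed

lemma tl_add:
  assumes "v \<in> carrier W" "w \<in> carrier W" "tlen (v \<otimes>\<^bsub>W\<^esub> w) = tlen w + tlen v" "\<gamma> \<in> inversions G S v"
  shows "A (inv\<^bsub>W\<^esub> w) \<gamma> \<in> Pos"
proof -
  note * = tl_mult[OF assms(1,2)]
  have "card {\<gamma> \<in> inversions G S v. A (inv\<^bsub>W\<^esub> w) \<gamma> \<in> Neg} = 0"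
    using *(1,2) assms(3) by linarith
  then have "{\<gamma> \<in> inversions G S v. A (inv\<^bsub>W\<^esub> w) \<gamma> \<in> Neg} = {}" using card_0_eq[OF *(4)] by simp
  moreover have "A (inv\<^bsub>W\<^esub> w) \<gamma> \<in> Pos \<or> A (inv\<^bsub>W\<^esub> w) \<gamma> \<in> Neg"
    using assms(2,4) by (intro Pos_or_Neg) (simp add: inversions_iff Pos_root)
  ultimately show ?thesis using assms(4) by blast
qed

lemma tl_sub:
  assumes "v \<in> carrier W" "w \<in> carrier W" "tlen (v \<otimes>\<^bsub>W\<^esub> w) + tlen v = tlen w" "\<gamma> \<in> inversions G S v"
  shows "A (inv\<^bsub>W\<^esub> w) \<gamma> \<in> Neg"
proof -
  note * = tl_mult[OF assms(1,2)]
  have "card {\<gamma> \<in> inversions G S v. A (inv\<^bsub>W\<^esub> w) \<gamma> \<in> Pos} = 0"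
    using *(1,2) assms(3) by linarith
  then have "{\<gamma> \<in> inversions G S v. A (inv\<^bsub>W\<^esub> w) \<gamma> \<in> Pos} = {}" using card_0_eq[OF *(3)] by simp
  moreover have "A (inv\<^bsub>W\<^esub> w) \<gamma> \<in> Pos \<or> A (inv\<^bsub>W\<^esub> w) \<gamma> \<in> Neg"
    using assms(2,4) by (intro Pos_or_Neg) (simp add: inversions_iff Pos_root)
  ultimately show ?thesis using assms(4) by blast
qed

section \<open>Stable roots\<close>

abbreviation orb :: "('a \<Rightarrow> 'a) \<times> 'a \<Rightarrow> ('a \<Rightarrow> real) \<Rightarrow> ('a \<Rightarrow> real) set" where "orb \<equiv> root_orbit G S \<Omega>"
abbreviation stable :: "('a \<Rightarrow> 'a) \<times> 'a \<Rightarrow> ('a \<Rightarrow> real) set" where "stable \<equiv> stable_roots G S \<Omega>"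

lemma gen_carrier: "w \<in> carrier W \<Longrightarrow> g \<in> generate W {w} \<Longrightarrow> g \<in> carrier W"
  using W.generate_in_carrier[of "{w}"] by simp

lemma orb_neg: assumes "w \<in> carrier W" shows "orb w (neg \<beta>) = neg ` orb w \<beta>"
  using gen_carrier[OF assms] by (force simp: root_orbit_def image_image A_neg)

lemma neg_image: "neg ` X \<subseteq> Pos \<longleftrightarrow> X \<subseteq> Neg" "neg ` X \<subseteq> Neg \<longleftrightarrow> X \<subseteq> Pos"
  by (auto simp: Neg_iff)

lemma stable_neg: "w \<in> carrier W \<Longrightarrow> \<beta> \<in> stable w \<Longrightarrow> neg \<beta> \<in> stable w"
  by (auto simp: stable_roots_def orb_neg neg_image neg_root)

lemma stable_inv: assumes "w \<in> carrier W" shows "stable (inv\<^bsub>W\<^esub> w) = stable w"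
proof -
  have le: "generate W {inv\<^bsub>W\<^esub> v} \<subseteq> generate W {v}" if v: "v \<in> carrier W" for v
  proof (rule W.generate_subgroup_incl)
    show "{inv\<^bsub>W\<^esub> v} \<subseteq> generate W {v}" by (simp add: generate.inv)
    show "subgroup (generate W {v}) W" using v by (intro W.generate_is_subgroup) simp
  qed
  have "generate W {inv\<^bsub>W\<^esub> w} = generate W {w}"
    using le[OF assms] le[of "inv\<^bsub>W\<^esub> w"] assms by auto
  then show ?thesis by (simp add: stable_roots_def root_orbit_def)
qed

lemma generate_conj:
  assumes w: "w \<in> carrier W" and t: "t \<in> carrier W"
    and h: "h \<in> generate W {t \<otimes>\<^bsub>W\<^esub> w \<otimes>\<^bsub>W\<^esub> inv\<^bsub>W\<^esub> t}"
  shows "inv\<^bsub>W\<^esub> t \<otimes>\<^bsub>W\<^esub> h \<otimes>\<^bsub>W\<^esub> t \<in> generate W {w}"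
  using h
proof induct
  case one then show ?case using t by (simp add: generate.one)
next
  case (incl h)
  then have "inv\<^bsub>W\<^esub> t \<otimes>\<^bsub>W\<^esub> h \<otimes>\<^bsub>W\<^esub> t = w"
    using w t by (simp add: W.m_assoc)
  then show ?case by (simp add: generate.incl)
next
  case (inv h)
  then have "inv\<^bsub>W\<^esub> t \<otimes>\<^bsub>W\<^esub> inv\<^bsub>W\<^esub> h \<otimes>\<^bsub>W\<^esub> t = inv\<^bsub>W\<^esub> w"
    using w t by (simp add: W.m_assoc W.inv_mult_group)
  then show ?case by (simp add: generate.inv)
next
  case (eng h1 h2)
  have "t \<otimes>\<^bsub>W\<^esub> w \<otimes>\<^bsub>W\<^esub> inv\<^bsub>W\<^esub> t \<in> carrier W" using w t by simp
  then have c: "h1 \<in> carrier W" "h2 \<in> carrier W" using gen_carrier eng by blast+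
  have "(inv\<^bsub>W\<^esub> t \<otimes>\<^bsub>W\<^esub> h1 \<otimes>\<^bsub>W\<^esub> t) \<otimes>\<^bsub>W\<^esub> (inv\<^bsub>W\<^esub> t \<otimes>\<^bsub>W\<^esub> h2 \<otimes>\<^bsub>W\<^esub> t)
      = inv\<^bsub>W\<^esub> t \<otimes>\<^bsub>W\<^esub> h1 \<otimes>\<^bsub>W\<^esub> (t \<otimes>\<^bsub>W\<^esub> inv\<^bsub>W\<^esub> t) \<otimes>\<^bsub>W\<^esub> h2 \<otimes>\<^bsub>W\<^esub> t"
    using c t by (simp only: W.m_assoc W.m_closed W.inv_closed)
  also have "\<dots> = inv\<^bsub>W\<^esub> t \<otimes>\<^bsub>W\<^esub> (h1 \<otimes>\<^bsub>W\<^esub> h2) \<otimes>\<^bsub>W\<^esub> t" using c t by (simp add: W.m_assoc)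
  finally show ?case using eng generate.eng by metis
qed

lemma orb_conj:
  assumes w: "w \<in> carrier W" and t: "t \<in> carrier W" and b: "\<beta> \<in> Phi"
  shows "orb (t \<otimes>\<^bsub>W\<^esub> w \<otimes>\<^bsub>W\<^esub> inv\<^bsub>W\<^esub> t) (A t \<beta>) \<subseteq> A t ` orb w \<beta>"
proof
  fix \<gamma> assume "\<gamma> \<in> orb (t \<otimes>\<^bsub>W\<^esub> w \<otimes>\<^bsub>W\<^esub> inv\<^bsub>W\<^esub> t) (A t \<beta>)"
  then obtain h where h: "h \<in> generate W {t \<otimes>\<^bsub>W\<^esub> w \<otimes>\<^bsub>W\<^esub> inv\<^bsub>W\<^esub> t}" "\<gamma> = A h (A t \<beta>)"
    by (auto simp: root_orbit_def)
  have hc: "h \<in> carrier W" using gen_carrier[OF _ h(1)] w t by simp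
  let ?g = "inv\<^bsub>W\<^esub> t \<otimes>\<^bsub>W\<^esub> h \<otimes>\<^bsub>W\<^esub> t"
  have "A t (A ?g \<beta>) = \<gamma>" using hc t b h(2) by (simp add: A_mult)
  moreover have "A ?g \<beta> \<in> orb w \<beta>" using generate_conj[OF w t h(1)] by (simp add: root_orbit_def)
  ultimately show "\<gamma> \<in> A t ` orb w \<beta>" by blast
qed

text \<open>If lengths drop, a root inverted by \<open>t\<close> has a negative preimage under \<open>w\<close> and so cannot lie in
  a positive orbit. If lengths add up, the roots of a positive orbit inverted by \<open>t\<close> are mapped to
  each other by \<open>w\<close>; being finitely many they form the whole orbit unless there are none.\<close>

lemma positive_orbit:
  assumes w: "w \<in> carrier W" and t: "t \<in> carrier W" and b: "\<beta> \<in> Phi" and P: "orb w \<beta> \<subseteq> Pos"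
    and len: "tlen (t \<otimes>\<^bsub>W\<^esub> w \<otimes>\<^bsub>W\<^esub> inv\<^bsub>W\<^esub> t) = tlen w"
    and shift: "tlen (t \<otimes>\<^bsub>W\<^esub> w) = tlen w + tlen t \<or> tlen (t \<otimes>\<^bsub>W\<^esub> w) + tlen t = tlen w"
  shows "A t ` orb w \<beta> \<subseteq> Pos \<or> A t ` orb w \<beta> \<subseteq> Neg"
proof -
  let ?w = "t \<otimes>\<^bsub>W\<^esub> w \<otimes>\<^bsub>W\<^esub> inv\<^bsub>W\<^esub> t" and ?O = "orb w \<beta>" and ?I = "inversions G S"
  define Q where "Q = ?O \<inter> ?I t"
  have O: "?O \<subseteq> Phi" using P Pos_root by blast
  have wt: "?w \<otimes>\<^bsub>W\<^esub> t = t \<otimes>\<^bsub>W\<^esub> w" using w t by (simp add: W.m_assoc)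
  have moves: "A g \<gamma> \<in> ?O" if g: "g \<in> generate W {w}" and "\<gamma> \<in> ?O" for g \<gamma>
  proof -
    obtain h where h: "h \<in> generate W {w}" "\<gamma> = A h \<beta>" using \<open>\<gamma> \<in> ?O\<close> by (auto simp: root_orbit_def)
    then have "A g \<gamma> = A (g \<otimes>\<^bsub>W\<^esub> h) \<beta>" using gen_carrier[OF w] g by (simp add: A_mult)
    then show ?thesis using generate.eng[OF g h(1)] by (simp add: root_orbit_def)
  qed
  have wO: "A w \<gamma> \<in> ?O" "A (inv\<^bsub>W\<^esub> w) \<gamma> \<in> ?O" if "\<gamma> \<in> ?O" for \<gamma>
    using moves[OF generate.incl[OF singletonI] that] moves[OF generate.inv[OF singletonI] that] .
  consider "Q = {}" | "Q = ?O"
  proof (cases "tlen (t \<otimes>\<^bsub>W\<^esub> w) = tlen w + tlen t")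
    case False
    then have sub: "tlen (t \<otimes>\<^bsub>W\<^esub> w) + tlen t = tlen w" using shift by simp
    have "Q = {}"
    proof (rule ccontr)
      assume "Q \<noteq> {}"
      then obtain \<gamma> where "\<gamma> \<in> ?O" "\<gamma> \<in> ?I t" by (auto simp: Q_def)
      then have "A (inv\<^bsub>W\<^esub> w) \<gamma> \<in> Neg" "A (inv\<^bsub>W\<^esub> w) \<gamma> \<in> Pos" using tl_sub[OF t w sub] wO P by blast+
      then show False using not_Pos_Neg by blast
    qed
    then show thesis using that by blast
  next
    case True
    then have add: "tlen (?w \<otimes>\<^bsub>W\<^esub> t) = tlen t + tlen ?w" using wt len by simp
    have step: "A w \<gamma> \<in> Q" if "\<gamma> \<in> Q" for \<gamma>
    proof -
      have g: "\<gamma> \<in> ?O" "A t \<gamma> \<in> Neg" "\<gamma> \<in> Pos" "\<gamma> \<in> Phi" using that O by (auto simp: Q_def inversions_iff)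
      have wc: "?w \<in> carrier W" using w t by simp
      have "A ?w (A t \<gamma>) \<in> Neg"
      proof (rule ccontr)
        assume "A ?w (A t \<gamma>) \<notin> Neg"
        then have "A ?w (A t \<gamma>) \<in> Pos" using Pos_or_Neg[of "A ?w (A t \<gamma>)"] g wc t by simp
        then have "neg (A t \<gamma>) \<in> ?I ?w" using g wc by (simp add: inversions_iff A_neg Neg_neg Neg_iff[symmetric])
        then have "A (inv\<^bsub>W\<^esub> t) (neg (A t \<gamma>)) \<in> Pos" using tl_add[OF wc t add] by simp
        then have "\<gamma> \<in> Neg" using g t by (simp add: A_neg Neg_iff)
        then show False using g not_Pos_Neg by blast
      qed
      then have "A t (A w \<gamma>) \<in> Neg" using g w t wc by (metis A_mult wt)
      then show ?thesis using wO[OF g(1)] P by (auto simp: Q_def inversions_iff)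
    qed
    have fin: "finite Q" using finite_inversions[OF t] by (simp add: Q_def)
    have QP: "Q \<subseteq> Phi" using O by (auto simp: Q_def)
    have "inj_on (A w) Q" using A_inj[OF w] QP inj_on_subset by blast
    then have img: "A w ` Q = Q" using endo_inj_surj[OF fin] step by blast
    have preimage: "A (inv\<^bsub>W\<^esub> w) \<gamma> \<in> Q" if g: "\<gamma> \<in> Q" for \<gamma>
    proof -
      obtain \<gamma>' where "\<gamma>' \<in> Q" "\<gamma> = A w \<gamma>'" using img g by blast
      then show ?thesis using w QP by auto
    qed
    have all: "A g \<gamma> \<in> Q" if "g \<in> generate W {w}" "\<gamma> \<in> Q" for g \<gamma>
      using that
    proof (induct arbitrary: \<gamma>)
      case one then show ?case using QP A_one by auto
    next
      case (eng h1 h2)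
      then show ?case using gen_carrier[OF w] by (simp add: A_mult)
    qed (use step preimage in auto)
    show thesis
    proof (cases "Q = {}")
      case False
      then obtain \<gamma> where g: "\<gamma> \<in> Q" by blast
      then obtain h where h: "h \<in> generate W {w}" "\<gamma> = A h \<beta>" by (auto simp: Q_def root_orbit_def)
      have hi: "inv\<^bsub>W\<^esub> h \<in> generate W {w}"
        using W.generate_m_inv_closed[of "{w}" h] h w by simp
      have "A (inv\<^bsub>W\<^esub> h) \<gamma> = \<beta>" using h gen_carrier[OF w] b by simp
      then have "\<beta> \<in> Q" using all[OF hi g] by simp
      then have "?O \<subseteq> Q" using all by (auto simp: root_orbit_def)
      then show thesis using that by (auto simp: Q_def)
    qed (use that in blast)
  qed
  then show ?thesis
  proof cases
    case 1
    have "A t \<gamma> \<in> Pos" if g: "\<gamma> \<in> ?O" for \<gamma>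
      using 1 g P O Pos_or_Neg[of "A t \<gamma>"] t by (fastforce simp: Q_def inversions_iff)
    then show ?thesis by blast
  next
    case 2
    then show ?thesis by (auto simp: Q_def inversions_iff)
  qed
qed

lemma stable_step_left:
  assumes w: "w \<in> carrier W" and t: "t \<in> carrier W"
    and len: "tlen (t \<otimes>\<^bsub>W\<^esub> w \<otimes>\<^bsub>W\<^esub> inv\<^bsub>W\<^esub> t) = tlen w"
    and shift: "tlen (t \<otimes>\<^bsub>W\<^esub> w) = tlen w + tlen t \<or> tlen (t \<otimes>\<^bsub>W\<^esub> w) + tlen t = tlen w"
  shows "A t ` stable w \<subseteq> stable (t \<otimes>\<^bsub>W\<^esub> w \<otimes>\<^bsub>W\<^esub> inv\<^bsub>W\<^esub> t)"
proof -
  let ?w = "t \<otimes>\<^bsub>W\<^esub> w \<otimes>\<^bsub>W\<^esub> inv\<^bsub>W\<^esub> t"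
  have wc: "?w \<in> carrier W" using w t by simp
  have pos: "A t \<beta> \<in> stable ?w" if "\<beta> \<in> Phi" "orb w \<beta> \<subseteq> Pos" for \<beta>
  proof -
    have "orb ?w (A t \<beta>) \<subseteq> Pos \<or> orb ?w (A t \<beta>) \<subseteq> Neg"
      using positive_orbit[OF w t that len shift] orb_conj[OF w t that(1)] by (meson subset_trans)
    then show ?thesis using that t by (simp add: stable_roots_def)
  qed
  show ?thesis
  proof clarify
    fix \<beta> assume b: "\<beta> \<in> stable w"
    show "A t \<beta> \<in> stable ?w"
    proof (cases "orb w \<beta> \<subseteq> Pos")
      case True then show ?thesis using pos b by (simp add: stable_roots_def)
    next
      case False
      then have "neg \<beta> \<in> Phi" "orb w (neg \<beta>) \<subseteq> Pos"
        using b w by (auto simp: stable_roots_def orb_neg neg_image neg_root)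
      then have "neg (A t \<beta>) \<in> stable ?w" using pos t by (metis A_neg)
      then show ?thesis using stable_neg[OF wc, of "neg (A t \<beta>)"] by simp
    qed
  qed
qed

text \<open>Multiplication on the right is reduced to multiplication on the left by inverting \<open>w\<close>, which has the same
  length and the same stable roots.\<close>

lemma stable_step_sub:
  assumes w: "w \<in> carrier W" and \<tau>: "\<tau> \<in> carrier G" and st: "mixed_step G S \<Omega> \<tau> w w'"
  shows "A (untwisted G \<tau>) ` stable w \<subseteq> stable w'"
proof -
  let ?t = "untwisted G \<tau>"
  have t: "?t \<in> carrier W" using \<tau> by (simp add: untwisted_def W_carrier K_one[symmetric])
  have w': "w' = ?t \<otimes>\<^bsub>W\<^esub> w \<otimes>\<^bsub>W\<^esub> inv\<^bsub>W\<^esub> ?t" and l: "tlen w' = tlen w"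
    and sh: "strong_conj_step G S \<Omega> \<tau> w \<or> cyclic_shift_step G S \<Omega> \<tau> w"
    using st by (auto simp: mixed_step_def)
  have iw: "inv\<^bsub>W\<^esub> w \<in> carrier W" using w by simp
  have w'i: "?t \<otimes>\<^bsub>W\<^esub> inv\<^bsub>W\<^esub> w \<otimes>\<^bsub>W\<^esub> inv\<^bsub>W\<^esub> ?t = inv\<^bsub>W\<^esub> w'"
    unfolding w' using w t by (simp add: W.inv_mult_group W.m_assoc)
  have "tlen (?t \<otimes>\<^bsub>W\<^esub> inv\<^bsub>W\<^esub> w) = tlen (w \<otimes>\<^bsub>W\<^esub> inv\<^bsub>W\<^esub> ?t)"
    using tl_inv[of "w \<otimes>\<^bsub>W\<^esub> inv\<^bsub>W\<^esub> ?t"] w t by (simp add: W.inv_mult_group)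
  then consider "tlen (?t \<otimes>\<^bsub>W\<^esub> w) = tlen w + tlen ?t \<or> tlen (?t \<otimes>\<^bsub>W\<^esub> w) + tlen ?t = tlen w"
    | "tlen (?t \<otimes>\<^bsub>W\<^esub> inv\<^bsub>W\<^esub> w) = tlen (inv\<^bsub>W\<^esub> w) + tlen ?t \<or> tlen (?t \<otimes>\<^bsub>W\<^esub> inv\<^bsub>W\<^esub> w) + tlen ?t = tlen (inv\<^bsub>W\<^esub> w)"
    using sh w by (auto simp: strong_conj_step_def cyclic_shift_step_def Let_def tl_inv)
  then show ?thesis
  proof cases
    case 1
    then show ?thesis using stable_step_left[OF w t _ 1] l unfolding w' by simp
  next
    case 2
    have "tlen (?t \<otimes>\<^bsub>W\<^esub> inv\<^bsub>W\<^esub> w \<otimes>\<^bsub>W\<^esub> inv\<^bsub>W\<^esub> ?t) = tlen (inv\<^bsub>W\<^esub> w)"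
      unfolding w'i using l w w' t by (simp add: tl_inv)
    from stable_step_left[OF iw t this 2] show ?thesis
      unfolding w'i using w w' t by (simp add: stable_inv)
  qed
qed

lemma untwisted_closed [simp]: "\<tau> \<in> carrier G \<Longrightarrow> untwisted G \<tau> \<in> carrier W"
  by (simp add: untwisted_def W_carrier K_one[symmetric])

lemma untwisted_inv: "\<tau> \<in> carrier G \<Longrightarrow> untwisted G (inv \<tau>) = inv\<^bsub>W\<^esub> (untwisted G \<tau>)"
  by (simp add: untwisted_def W_inv K_one[symmetric] del: Omega_inv)

lemma mixed_step_closed: "w \<in> carrier W \<Longrightarrow> \<tau> \<in> carrier G \<Longrightarrow> mixed_step G S \<Omega> \<tau> w w' \<Longrightarrow> w' \<in> carrier W"
  by (simp add: mixed_step_def)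

text \<open>Since \<open>w' \<tau> = \<tau> w\<close>, the products measured for the inverse step are the same as for the step itself, with
  the two sides exchanged.\<close>

lemma mixed_step_sym:
  assumes w: "w \<in> carrier W" and \<tau>: "\<tau> \<in> carrier G" and st: "mixed_step G S \<Omega> \<tau> w w'"
  shows "mixed_step G S \<Omega> (inv \<tau>) w' w"
proof -
  let ?t = "untwisted G \<tau>"
  have t: "?t \<in> carrier W" using \<tau> by simp
  have w': "w' = ?t \<otimes>\<^bsub>W\<^esub> w \<otimes>\<^bsub>W\<^esub> inv\<^bsub>W\<^esub> ?t" and l: "tlen w' = tlen w"
    and sh: "strong_conj_step G S \<Omega> \<tau> w \<or> cyclic_shift_step G S \<Omega> \<tau> w"
    using st by (auto simp: mixed_step_def)
  have a: "w' \<otimes>\<^bsub>W\<^esub> ?t = ?t \<otimes>\<^bsub>W\<^esub> w" "inv\<^bsub>W\<^esub> ?t \<otimes>\<^bsub>W\<^esub> w' = w \<otimes>\<^bsub>W\<^esub> inv\<^bsub>W\<^esub> ?t"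
    "w = inv\<^bsub>W\<^esub> ?t \<otimes>\<^bsub>W\<^esub> w' \<otimes>\<^bsub>W\<^esub> ?t"
    unfolding w' using w t by (simp_all add: W.m_assoc)
  have u: "untwisted G (inv \<tau>) = inv\<^bsub>W\<^esub> ?t" "inv\<^bsub>W\<^esub> (inv\<^bsub>W\<^esub> ?t) = ?t" "tlen (inv\<^bsub>W\<^esub> ?t) = tlen ?t"
    using \<tau> t by (simp_all add: untwisted_inv tl_inv)
  have "strong_conj_step G S \<Omega> (inv \<tau>) w' \<or> cyclic_shift_step G S \<Omega> (inv \<tau>) w'"
    using sh unfolding strong_conj_step_def cyclic_shift_step_def Let_def u a(1,2) l by blast
  then show ?thesis unfolding mixed_step_def u using a(3) l by simp
qed

lemma stable_step:
  assumes w: "w \<in> carrier W" and \<tau>: "\<tau> \<in> carrier G" and st: "mixed_step G S \<Omega> \<tau> w w'"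
  shows "A (untwisted G \<tau>) ` stable w = stable w'"
proof
  show "A (untwisted G \<tau>) ` stable w \<subseteq> stable w'" using assms by (rule stable_step_sub)
  have w': "w' \<in> carrier W" using mixed_step_closed assms by blast
  have "A (inv\<^bsub>W\<^esub> (untwisted G \<tau>)) ` stable w' \<subseteq> stable w"
    using stable_step_sub[OF w' _ mixed_step_sym[OF assms]] \<tau> by (simp add: untwisted_inv)
  then have "A (untwisted G \<tau>) ` A (inv\<^bsub>W\<^esub> (untwisted G \<tau>)) ` stable w' \<subseteq> A (untwisted G \<tau>) ` stable w"
    by (rule image_mono)
  moreover have "A (untwisted G \<tau>) ` A (inv\<^bsub>W\<^esub> (untwisted G \<tau>)) ` stable w' = stable w'"
    using \<tau> by (auto simp: image_image stable_roots_def)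
  ultimately show "stable w' \<subseteq> A (untwisted G \<tau>) ` stable w" by simp
qed

lemma tran_mixed_stable:
  assumes "(\<tau>s, v) \<in> tran_mixed G S \<Omega> P w" "P \<subseteq> carrier G" "w \<in> carrier W"
  defines "t \<equiv> lprod W (map (untwisted G) \<tau>s)"
  shows "t \<in> carrier W \<and> v \<in> carrier W \<and> v = t \<otimes>\<^bsub>W\<^esub> w \<otimes>\<^bsub>W\<^esub> inv\<^bsub>W\<^esub> t \<and> A t ` stable w = stable v"
  using assms(1) unfolding t_def
proof induct
  case Nil
  have "A \<one>\<^bsub>W\<^esub> ` stable w = stable w" using A_one by (force simp: stable_roots_def)
  then show ?case using assms(3) by (simp add: lprod_def)
next
  case (Cons \<tau>s v \<tau> v')
  let ?t = "untwisted G \<tau>" and ?T = "lprod W (map (untwisted G) \<tau>s)"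
  have \<tau>: "\<tau> \<in> carrier G" using Cons assms(2) by auto
  then have t: "?t \<in> carrier W" by simp
  have T: "?T \<in> carrier W" "v \<in> carrier W" "v = ?T \<otimes>\<^bsub>W\<^esub> w \<otimes>\<^bsub>W\<^esub> inv\<^bsub>W\<^esub> ?T" "A ?T ` stable w = stable v"
    using Cons by auto
  have L: "lprod W (map (untwisted G) (\<tau> # \<tau>s)) = ?t \<otimes>\<^bsub>W\<^esub> ?T" by (simp add: lprod_def)
  have "A (?t \<otimes>\<^bsub>W\<^esub> ?T) ` stable w = A ?t ` A ?T ` stable w"
    using t T(1) by (simp add: image_image A_mult)
  then have "A (?t \<otimes>\<^bsub>W\<^esub> ?T) ` stable w = stable v'"
    unfolding T(4) using stable_step[OF T(2) \<tau> Cons(4)] by simp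
  moreover have "v' = ?t \<otimes>\<^bsub>W\<^esub> ?T \<otimes>\<^bsub>W\<^esub> w \<otimes>\<^bsub>W\<^esub> inv\<^bsub>W\<^esub> (?t \<otimes>\<^bsub>W\<^esub> ?T)"
    using Cons(4) t T(1,3) assms(3) by (simp add: mixed_step_def W.inv_mult_group W.m_assoc)
  ultimately show ?case unfolding L using t T mixed_step_closed[OF T(2) \<tau> Cons(4)] by simp
qed

lemma fixed_roots_conj:
  assumes w: "w \<in> carrier W" and t: "t \<in> carrier W"
  shows "A t ` fixed_roots G S w = fixed_roots G S (t \<otimes>\<^bsub>W\<^esub> w \<otimes>\<^bsub>W\<^esub> inv\<^bsub>W\<^esub> t)"
proof (intro equalityI subsetI)
  fix \<beta> assume "\<beta> \<in> A t ` fixed_roots G S w"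
  then show "\<beta> \<in> fixed_roots G S (t \<otimes>\<^bsub>W\<^esub> w \<otimes>\<^bsub>W\<^esub> inv\<^bsub>W\<^esub> t)"
    using w t by (auto simp: fixed_roots_def A_mult)
next
  fix \<beta> assume "\<beta> \<in> fixed_roots G S (t \<otimes>\<^bsub>W\<^esub> w \<otimes>\<^bsub>W\<^esub> inv\<^bsub>W\<^esub> t)"
  then have b: "\<beta> \<in> Phi" "A t (A w (A (inv\<^bsub>W\<^esub> t) \<beta>)) = \<beta>" using w t by (auto simp: fixed_roots_def A_mult)
  have "A (inv\<^bsub>W\<^esub> t) \<beta> \<in> fixed_roots G S w"
    using arg_cong[OF b(2), of "A (inv\<^bsub>W\<^esub> t)"] b(1) w t by (simp add: fixed_roots_def)
  moreover have "A t (A (inv\<^bsub>W\<^esub> t) \<beta>) = \<beta>" using b t by simp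
  ultimately show "\<beta> \<in> A t ` fixed_roots G S w" by (metis image_eqI)
qed

lemma firm_transfer:
  assumes "(\<tau>s, w') \<in> tran_mixed G S \<Omega> P w" "P \<subseteq> carrier G" "w \<in> carrier W"
  shows "fixed_roots G S w = stable w \<longleftrightarrow> fixed_roots G S w' = stable w'"
proof -
  let ?t = "lprod W (map (untwisted G) \<tau>s)"
  have *: "?t \<in> carrier W" "w' = ?t \<otimes>\<^bsub>W\<^esub> w \<otimes>\<^bsub>W\<^esub> inv\<^bsub>W\<^esub> ?t" "A ?t ` stable w = stable w'"
    using tran_mixed_stable[OF assms] by auto
  have F: "A ?t ` fixed_roots G S w = fixed_roots G S w'"
    using fixed_roots_conj[OF assms(3) *(1)] *(2) by simp
  have sub: "fixed_roots G S w \<subseteq> Phi" "stable w \<subseteq> Phi" by (auto simp: fixed_roots_def stable_roots_def)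
  show ?thesis using inj_on_image_eq_iff[OF A_inj[OF *(1)] sub] unfolding F *(3) by simp
qed

end

section \<open>Braid words\<close>

context coxeter
begin

abbreviation braid_eq :: "'a list \<Rightarrow> 'a list \<Rightarrow> bool" (infix "\<sim>" 50) where
  "u \<sim> v \<equiv> word_cong (braid_relations G S) u v"

lemmas be_refl [simp, intro] = word_cong.refl[of "braid_relations G S"]
lemmas be_sym = word_cong.sym[of "braid_relations G S"]
lemmas be_trans [trans] = word_cong.trans[of "braid_relations G S"]
lemmas be_append = word_cong.append[of "braid_relations G S"]

lemma be_left: "u \<sim> v \<Longrightarrow> w @ u \<sim> w @ v" by (simp add: be_append)
lemma be_right: "u \<sim> v \<Longrightarrow> u @ w \<sim> v @ w" by (simp add: be_append)
lemma be_Cons: "u \<sim> v \<Longrightarrow> s # u \<sim> s # v" using be_left[of u v "[s]"] by simp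

lemma braid_relE:
  assumes "(u, v) \<in> braid_relations G S"
  obtains s t where "u = alternating (m s t) s t" "v = alternating (m s t) t s"
    "s \<in> S" "t \<in> S" "s \<noteq> t" "m s t \<noteq> 0"
  using assms unfolding braid_relations_def by blast

lemma be_braid: "s \<in> S \<Longrightarrow> t \<in> S \<Longrightarrow> s \<noteq> t \<Longrightarrow> m s t \<noteq> 0 \<Longrightarrow> alternating (m s t) s t \<sim> alternating (m s t) t s"
  by (rule word_cong.rel) (auto simp: braid_relations_def)

lemma be_length: "u \<sim> v \<Longrightarrow> length u = length v"
  by (induct rule: word_cong.induct) (auto elim: braid_relE)

lemma be_set: "u \<sim> v \<Longrightarrow> set u = set v"
proof (induct rule: word_cong.induct)
  case (rel u v)
  then show ?case by (rule braid_relE) (use m_ge_2 in \<open>auto simp: set_alternating\<close>)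
qed auto

lemma be_lp: "u \<sim> v \<Longrightarrow> set u \<subseteq> S \<Longrightarrow> lp u = lp v"
proof (induct rule: word_cong.induct)
  case (rel u v)
  then show ?case by (metis braid_relE lp_alternating_eq)
next
  case (sym u v) then show ?case using be_set by metis
next
  case (trans u v w) then show ?case using be_set by metis
next
  case (append u u' v v')
  moreover have "set u' \<subseteq> S" "set v' \<subseteq> S" using append be_set[of u u'] be_set[of v v'] by auto
  ultimately show ?case by simp
qed simp

lemma be_rev: "u \<sim> v \<Longrightarrow> rev u \<sim> rev v"
proof (induct rule: word_cong.induct)
  case (rel u v)
  then obtain s t where st: "u = alternating (m s t) s t" "v = alternating (m s t) t s"
    "s \<in> S" "t \<in> S" "s \<noteq> t" "m s t \<noteq> 0" by (rule braid_relE)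
  then show ?case using be_braid[OF st(3-6)] be_sym by (simp add: rev_alternating)
qed (auto intro: be_sym be_trans be_append)

lemma be_reduced: "u \<sim> v \<Longrightarrow> reduced u \<Longrightarrow> reduced v"
  using be_length be_set be_lp by metis

text \<open>Matsumoto's theorem. Reduced words starting with different letters \<open>s, t\<close> both pass, by
  induction, to words starting with the two sides of the braid relation for \<open>s, t\<close>.\<close>

theorem matsumoto: "reduced u \<Longrightarrow> reduced v \<Longrightarrow> lp u = lp v \<Longrightarrow> u \<sim> v"
proof (induct "length u" arbitrary: u v)
  case 0
  then have "u = []" "v = []" by auto
  then show ?case by simp
next
  case (Suc n)
  have "length v = Suc n" using Suc(2-5) by simp
  then obtain s u' t v' where uv: "u = s # u'" "v = t # v'" using Suc(2) by (metis length_Suc_conv)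
  have st: "s \<in> S" "t \<in> S" "set u' \<subseteq> S" "set v' \<subseteq> S" using Suc(2-5) uv by auto
  have red: "reduced u'" "reduced v'"
    using reduced_ConsD[OF Suc(3)[unfolded uv(1)]] reduced_ConsD[OF Suc(4)[unfolded uv(2)]] .
  have cancel: "a \<sim> b" if "reduced (r # a)" "reduced (r # b)" "lp (r # a) = lp (r # b)" "length a = n" for r a b
  proof -
    have "r \<in> S" "set a \<subseteq> S" "set b \<subseteq> S" using that by auto
    then have "lp a = lp b" using that(3) by simp
    moreover have "reduced a" "reduced b" using reduced_ConsD[OF that(1)] reduced_ConsD[OF that(2)] .
    ultimately show ?thesis using Suc(1)[of a b] that(4) by blast
  qed
  have R: "reduced (s # u')" "reduced (t # v')" "lp (s # u') = lp (t # v')"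
    using Suc(3-5) unfolding uv by blast+
  have n: "length u' = n" "length v' = n" using Suc(2) \<open>length v = Suc n\<close> unfolding uv by simp_all
  show ?case
  proof (cases "s = t")
    case True
    then have "u' \<sim> v'" using cancel[of s u' v'] R n by blast
    then show ?thesis using True uv be_Cons by simp
  next
    case False
    let ?x = "lp u" and ?n = "m s t"
    have x: "?x \<in> carrier G" using Suc(3) by blast
    have xu: "?x = s \<otimes> lp u'" by (simp add: uv)
    have xv: "?x = t \<otimes> lp v'" using R(3) xu by simp
    have "s \<otimes> ?x = lp u'" unfolding xu using st by simp
    moreover have "t \<otimes> ?x = lp v'" unfolding xv using st by simp
    moreover have L: "len ?x = Suc n" using Suc(2,3) by simp
    moreover have "len (lp u') = n" "len (lp v') = n" using red n by simp_all
    ultimately have "len (s \<otimes> ?x) < len ?x" "len (t \<otimes> ?x) < len ?x" by simp_all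
    then obtain v0 where v0: "?n \<noteq> 0" "v0 \<in> carrier G" "?x = lp (alternating ?n s t) \<otimes> v0" "len ?x = ?n + len v0"
      using two_descents[OF x st(1,2) False] by metis
    obtain r where r: "set r \<subseteq> S" "lp r = v0" "length r = len v0" using len_ex[OF v0(2)] by blast
    obtain i where i: "?n = Suc i" using v0 by (cases ?n) auto
    have al: "set (alternating j a b) \<subseteq> S" if "a \<in> S" "b \<in> S" for j a b
      using set_alternating_subset[OF that] .
    have X1: "lp (alternating ?n s t @ r) = ?x" using v0 r al st by simp
    moreover have X2: "lp (alternating ?n t s @ r) = ?x"
      using v0 r al st lp_alternating_eq[OF st(1,2) v0(1)] by simp
    moreover have "set (alternating ?n s t @ r) \<subseteq> S" "set (alternating ?n t s @ r) \<subseteq> S"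
      using al[of s t] al[of t s] st r by simp_all
    moreover have "length (alternating ?n a b @ r) = len ?x" for a b using r(3) v0(4) by simp
    ultimately have R': "reduced (alternating ?n s t @ r)" "reduced (alternating ?n t s @ r)" by metis+
    have "lp (s # u') = lp (s # alternating i t s @ r)" using X1 xu unfolding i by simp
    then have "u' \<sim> alternating i t s @ r"
      using cancel[OF R(1) _ _ n(1)] R'(1) unfolding i alternating.simps append_Cons by blast
    moreover have "lp (t # v') = lp (t # alternating i s t @ r)" using X2 xv unfolding i by simp
    then have "v' \<sim> alternating i s t @ r"
      using cancel[OF R(2) _ _ n(2)] R'(2) unfolding i alternating.simps append_Cons by blast
    ultimately
    have "u \<sim> alternating ?n s t @ r" "v \<sim> alternating ?n t s @ r"
      unfolding i uv by (simp_all add: be_Cons)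
    moreover have "alternating ?n s t @ r \<sim> alternating ?n t s @ r"
      using be_braid[OF st(1,2) False v0(1)] by (rule be_right)
    ultimately show ?thesis by (meson be_sym be_trans)
  qed
qed

definition rw :: "'a \<Rightarrow> 'a list" where "rw x = (SOME u. reduced_expr G S x u)"

lemma rw: assumes "x \<in> carrier G" shows "reduced (rw x)" "lp (rw x) = x"
proof -
  obtain u where "reduced_expr G S x u" using len_ex[OF assms] by (metis reduced_expr_iff)
  then have "reduced_expr G S x (rw x)" unfolding rw_def by (rule someI)
  then show "reduced (rw x)" "lp (rw x) = x" by (auto simp: reduced_expr_iff)
qed

lemma rw_set [simp]: "x \<in> carrier G \<Longrightarrow> set (rw x) \<subseteq> S" using rw by simp
lemma rw_lp [simp]: "x \<in> carrier G \<Longrightarrow> lp (rw x) = x" using rw by simp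
lemma rw_length [simp]: "x \<in> carrier G \<Longrightarrow> length (rw x) = len x" using rw by metis
lemma rw_one [simp]: "rw \<one> = []" by (metis len_one length_0_conv one_closed rw_length)

lemma rw_eq: "reduced u \<Longrightarrow> rw (lp u) \<sim> u"
  by (rule matsumoto) auto

lemma rw_mult:
  assumes "x \<in> carrier G" "y \<in> carrier G" "len (x \<otimes> y) = len x + len y"
  shows "rw x @ rw y \<sim> rw (x \<otimes> y)"
  by (rule matsumoto) (use assms in auto)

section \<open>The weak order\<close>

definition pre :: "'a \<Rightarrow> 'a \<Rightarrow> bool" where
  "pre x h \<longleftrightarrow> x \<in> carrier G \<and> h \<in> carrier G \<and> len x + len (inv x \<otimes> h) = len h"

lemma pre_closed: "pre x h \<Longrightarrow> x \<in> carrier G" "pre x h \<Longrightarrow> h \<in> carrier G"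
  by (auto simp: pre_def)

lemma cancel_inv [simp]: "x \<in> carrier G \<Longrightarrow> y \<in> carrier G \<Longrightarrow> inv x \<otimes> (x \<otimes> y) = y"
  "x \<in> carrier G \<Longrightarrow> y \<in> carrier G \<Longrightarrow> x \<otimes> (inv x \<otimes> y) = y"
  by (simp_all add: m_assoc[symmetric])

lemma pre_mult: "x \<in> carrier G \<Longrightarrow> y \<in> carrier G \<Longrightarrow> pre x (x \<otimes> y) \<longleftrightarrow> len (x \<otimes> y) = len x + len y"
  by (auto simp: pre_def)

lemma pre_refl [simp]: "x \<in> carrier G \<Longrightarrow> pre x x" by (simp add: pre_def)
lemma pre_one [simp]: "x \<in> carrier G \<Longrightarrow> pre \<one> x" by (simp add: pre_def)

lemma pre_trans: assumes "pre x y" "pre y z" shows "pre x z"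
proof -
  have c: "x \<in> carrier G" "y \<in> carrier G" "z \<in> carrier G" using assms by (auto simp: pre_def)
  have "inv x \<otimes> z = (inv x \<otimes> y) \<otimes> (inv y \<otimes> z)" using c by (simp add: m_assoc)
  then have "len (inv x \<otimes> z) \<le> len (inv x \<otimes> y) + len (inv y \<otimes> z)" using len_mult c by simp
  moreover have "len z \<le> len x + len (inv x \<otimes> z)" using len_mult[of x "inv x \<otimes> z"] c by simp
  ultimately show ?thesis using assms c by (simp add: pre_def)
qed

lemma pre_antisym: assumes "pre x y" "pre y x" shows "x = y"
proof -
  have c: "x \<in> carrier G" "y \<in> carrier G" using assms by (auto simp: pre_def)
  have "len (inv x \<otimes> y) = 0" using assms by (simp add: pre_def)
  then have "inv x \<otimes> y = \<one>" using len_eq_0[of "inv x \<otimes> y"] c by simp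
  then have "x \<otimes> (inv x \<otimes> y) = x" using c by simp
  then show ?thesis using c by simp
qed

lemma pre_S: "s \<in> S \<Longrightarrow> h \<in> carrier G \<Longrightarrow> pre s h \<longleftrightarrow> len (s \<otimes> h) < len h"
  using len_S_mult[of h s] by (auto simp: pre_def)

text \<open>Prefixes of the complement of \<open>x\<close> in \<open>h\<close> are the prefixes of \<open>h\<close> above \<open>x\<close>.\<close>

lemma pre_shift:
  assumes "pre x h" "pre y (inv x \<otimes> h)"
  shows "pre (x \<otimes> y) h" "len (x \<otimes> y) = len x + len y"
proof -
  have c: "x \<in> carrier G" "y \<in> carrier G" "h \<in> carrier G" using assms by (auto simp: pre_def)
  have e: "inv (x \<otimes> y) \<otimes> h = inv y \<otimes> (inv x \<otimes> h)" using c by (simp add: inv_mult_group m_assoc)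
  have "len h \<le> len (x \<otimes> y) + len (inv (x \<otimes> y) \<otimes> h)"
    using len_mult[of "x \<otimes> y" "inv (x \<otimes> y) \<otimes> h"] c by (simp del: inv_mult_group)
  moreover have "len (x \<otimes> y) \<le> len x + len y" using len_mult c by simp
  ultimately show "pre (x \<otimes> y) h" "len (x \<otimes> y) = len x + len y" using assms c e by (auto simp: pre_def)
qed

lemma pre_unshift:
  assumes "x \<in> carrier G" "y \<in> carrier G" "pre (x \<otimes> y) h" "len (x \<otimes> y) = len x + len y"
  shows "pre x h" "pre y (inv x \<otimes> h)"
proof -
  have c: "h \<in> carrier G" using assms by (auto simp: pre_def)
  show x: "pre x h" using pre_trans[of x "x \<otimes> y" h] assms by (simp add: pre_mult)
  have e: "inv (x \<otimes> y) \<otimes> h = inv y \<otimes> (inv x \<otimes> h)" using c assms by (simp add: inv_mult_group m_assoc)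
  show "pre y (inv x \<otimes> h)" using x assms c e by (auto simp: pre_def)
qed

lemma pre_reduced:
  assumes "reduced d" "reduced h" "pre (lp d) (lp h)"
  obtains f where "set f \<subseteq> S" "h \<sim> d @ f"
proof -
  let ?z = "inv (lp d) \<otimes> lp h"
  have c: "?z \<in> carrier G" "set d \<subseteq> S" using assms by auto
  have "reduced (d @ rw ?z)" "lp (d @ rw ?z) = lp h" using assms c by (auto simp: pre_def)
  then have "h \<sim> d @ rw ?z" using matsumoto assms by metis
  then show thesis using that[of "rw ?z"] rw_set[OF c(1)] by blast
qed

end

text \<open>Newman's argument: if any two steps from a common point can be continued to a common bound,
  then everything above a point has a greatest element. Applied to common divisors it produces
  greatest common divisors from least common multiples of pairs of generators.\<close>

lemma newman_greatest:
  fixes le :: "'b \<Rightarrow> 'b \<Rightarrow> bool" and f :: "'b \<Rightarrow> nat"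
  assumes le_refl: "\<And>x. x \<in> C \<Longrightarrow> le x x"
    and le_trans: "\<And>x y z. le x y \<Longrightarrow> le y z \<Longrightarrow> le x z"
    and mono: "\<And>x y. x \<in> C \<Longrightarrow> y \<in> C \<Longrightarrow> le x y \<Longrightarrow> f y \<le> f x"
    and step: "\<And>y y'. R y y' \<Longrightarrow> y \<in> C \<and> y' \<in> C \<and> le y y' \<and> f y' < f y"
    and factor: "\<And>y y'. y \<in> C \<Longrightarrow> y' \<in> C \<Longrightarrow> le y y' \<Longrightarrow> le y' y \<or> (\<exists>y1. R y y1 \<and> le y1 y')"
    and confluent: "\<And>y a b. R y a \<Longrightarrow> R y b \<Longrightarrow> \<exists>c\<in>C. le a c \<and> le b c"
    and y: "y \<in> C"
  shows "\<exists>z\<in>C. le y z \<and> (\<forall>x\<in>C. le y x \<longrightarrow> le x z)"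
  using y
proof (induct "f y" arbitrary: y rule: less_induct)
  case less
  have up: "\<exists>z\<in>C. le a z \<and> (\<forall>x\<in>C. le a x \<longrightarrow> le x z)" if "R y a" for a
    using less(1)[of a] step[OF that] by blast
  show ?case
  proof (cases "\<exists>a. R y a")
    case False
    then have "le x y" if "x \<in> C" "le y x" for x using factor[OF less(2) that] by blast
    then show ?thesis using less(2) le_refl by blast
  next
    case True
    then obtain a where a: "R y a" by blast
    then obtain z where z: "z \<in> C" "le a z" "\<forall>x\<in>C. le a x \<longrightarrow> le x z" using up by blast
    have "le x z" if x: "x \<in> C" "le y x" for x
    proof (cases "le x y")
      case True
      then show ?thesis using step[OF a] z le_trans by blast
    next
      case False
      then obtain b where b: "R y b" "le b x" using factor[OF less(2) x] by blast
      then obtain z' where z': "z' \<in> C" "le b z'" "\<forall>x\<in>C. le b x \<longrightarrow> le x z'" using up by blast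
      obtain c where c: "c \<in> C" "le a c" "le b c" using confluent[OF a b(1)] by blast
      have "f c < f y" using mono[OF _ c(1,2)] step[OF a] by fastforce
      then obtain zc where zc: "zc \<in> C" "le c zc" "\<forall>x\<in>C. le c x \<longrightarrow> le x zc" using less(1)[OF _ c(1)] by blast
      have "le z' zc" using zc z' c by blast
      moreover have "le zc z" using z zc c le_trans by blast
      moreover have "le x z'" using z' b x by blast
      ultimately show ?thesis using le_trans by blast
    qed
    then show ?thesis using z step[OF a] le_trans by blast
  qed
qed

section \<open>Longest elements and meets\<close>

locale finite_coxeter = coxeter +
  assumes fin: "finite (carrier G)"
begin

definition w0 :: 'a where
  "w0 = (SOME d. d \<in> carrier G \<and> (\<forall>x\<in>carrier G. len (d \<otimes> x) + len x = len d))"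

lemma generate_S: "generate G S = carrier G"
  using presentation by (simp add: is_presentation_def)

lemma w0 [simp]: "w0 \<in> carrier G" and w0_right: "x \<in> carrier G \<Longrightarrow> len (w0 \<otimes> x) + len x = len w0"
proof -
  have "\<exists>d. d \<in> carrier G \<and> (\<forall>x\<in>carrier G. len (d \<otimes> x) + len x = len d)"
    by (rule longest_element[OF subset_refl[of S] fin, unfolded generate_S]) blast
  from someI_ex[OF this, folded w0_def]
  show "w0 \<in> carrier G" "x \<in> carrier G \<Longrightarrow> len (w0 \<otimes> x) + len x = len w0" by auto
qed

lemma w0_square [simp]: "w0 \<otimes> w0 = \<one>"
proof -
  have "len (w0 \<otimes> w0) = 0" using w0_right[of w0] by simp
  then show ?thesis using len_eq_0[of "w0 \<otimes> w0"] by simp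
qed

lemma w0_inv [simp]: "inv w0 = w0" by (simp add: inv_equality)

lemma w0_left: assumes "x \<in> carrier G" shows "len (x \<otimes> w0) + len x = len w0"
  using w0_right[of "inv x"] len_inv[of "x \<otimes> w0"] assms by (simp add: inv_mult_group)

text \<open>Multiplying \<open>y\<close> to \<open>x\<close> without cancellation means that \<open>y\<close> is a prefix of the complement of \<open>x\<close> in the longest
  element; this turns the question for the longest such prefix of \<open>h\<close> into one for a meet.\<close>

lemma pre_complement:
  assumes "x \<in> carrier G" "y \<in> carrier G"
  shows "pre y (inv x \<otimes> w0) \<longleftrightarrow> len (x \<otimes> y) = len x + len y"
proof -
  have "inv y \<otimes> (inv x \<otimes> w0) = inv (x \<otimes> y) \<otimes> w0" using assms by (simp add: inv_mult_group m_assoc)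
  moreover have "len (inv (x \<otimes> y) \<otimes> w0) + len (x \<otimes> y) = len w0"
    using w0_left[of "inv (x \<otimes> y)"] len_inv[of "x \<otimes> y"] assms by simp
  moreover have "len (inv x \<otimes> w0) + len x = len w0" using w0_left[of "inv x"] assms by simp
  ultimately show ?thesis using assms by (auto simp: pre_def)
qed

lemma two_prefixes:
  assumes "h \<in> carrier G" "s \<in> S" "t \<in> S" "s \<noteq> t" "pre s h" "pre t h"
  shows "m s t \<noteq> 0" "pre (lp (alternating (m s t) s t)) h" "len (lp (alternating (m s t) s t)) = m s t"
proof -
  have "len (s \<otimes> h) < len h" "len (t \<otimes> h) < len h" using assms pre_S by auto
  then obtain v where v: "m s t \<noteq> 0" "v \<in> carrier G" "h = lp (alternating (m s t) s t) \<otimes> v" "len h = m s t + len v"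
    using two_descents[OF assms(1-4)] by metis
  have al: "set (alternating (m s t) s t) \<subseteq> S" using set_alternating_subset[OF assms(2,3)] .
  have "len h \<le> len (lp (alternating (m s t) s t)) + len v" using len_mult[OF lp_closed[OF al] v(2)] v(3) by simp
  then show l: "len (lp (alternating (m s t) s t)) = m s t" using len_le[OF al] v by simp
  show "m s t \<noteq> 0" by fact
  have "len (lp (alternating (m s t) s t) \<otimes> v) = len (lp (alternating (m s t) s t)) + len v" using v l by simp
  then show "pre (lp (alternating (m s t) s t)) h" unfolding v(3) using pre_mult v al by simp
qed

lemma reduced_alternating:
  assumes "s \<in> S" "t \<in> S" "s \<noteq> t" "m s t \<noteq> 0" shows "reduced (alternating (m s t) s t)"
proof -
  have "pre r w0" if "r \<in> S" for r
    using that w0_left[of r] pre_S[of r w0] by simp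
  then show ?thesis using two_prefixes(3)[of w0 s t] assms set_alternating_subset[OF assms(1,2)] by simp
qed

lemma alternating_prefix:
  assumes "s \<in> S" "t \<in> S" "s \<noteq> t" "m s t \<noteq> 0"
  shows "pre s (lp (alternating (m s t) s t))" "pre t (lp (alternating (m s t) s t))"
proof -
  have *: "pre a (lp (alternating (m a b) a b))" if "a \<in> S" "b \<in> S" "a \<noteq> b" "m a b \<noteq> 0" for a b
  proof -
    obtain i where i: "m a b = Suc i" using \<open>m a b \<noteq> 0\<close> by (cases "m a b") auto
    have r: "reduced (alternating (Suc i) a b)" using reduced_alternating[OF that] unfolding i .
    moreover have "set (alternating i b a) \<subseteq> S" using set_alternating_subset[of b S a] that by simp
    moreover have "len (lp (alternating i b a)) = i"
      using reduced_append(2)[of "[a]" "alternating i b a"] r by simp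
    moreover have "len (a \<otimes> lp (alternating i b a)) = Suc i" using r by simp
    ultimately show ?thesis unfolding i alternating.simps lp_Cons using that
      by (subst pre_mult) auto
  qed
  show "pre s (lp (alternating (m s t) s t))" using * assms .
  have "pre t (lp (alternating (m t s) t s))" using *[of t s] assms ord_swap[of s t] by auto
  then show "pre t (lp (alternating (m s t) s t))"
    using lp_alternating_eq[OF assms(1,2,4)] ord_swap[of s t] assms by simp
qed

text \<open>If \<open>y s\<close> and \<open>y t\<close> are common prefixes, so is \<open>y\<close> times the longest element of the dihedral group of \<open>s, t\<close>, by
  the lemma on two descents. This is the confluence that Newman's argument asks for.\<close>

lemma meet_exists:
  assumes a: "a \<in> carrier G" and b: "b \<in> carrier G"
  obtains z where "pre z a" "pre z b" "\<And>y. pre y a \<Longrightarrow> pre y b \<Longrightarrow> pre y z"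
proof -
  define C where "C = {y. pre y a \<and> pre y b}"
  define R where "R y y' \<longleftrightarrow> y \<in> C \<and> y' \<in> C \<and> (\<exists>s\<in>S. y' = y \<otimes> s \<and> len y' = len y + 1)" for y y'
  have C: "y \<in> carrier G" "len y \<le> len a" if "y \<in> C" for y using that by (auto simp: C_def pre_def)
  have "\<exists>z\<in>C. pre \<one> z \<and> (\<forall>x\<in>C. pre \<one> x \<longrightarrow> pre x z)"
  proof (rule newman_greatest[where f = "\<lambda>y. len a - len y" and R = R])
    show "len a - len y \<le> len a - len x" if "pre x y" for x y using that by (auto simp: pre_def)
    show "y \<in> C \<and> y' \<in> C \<and> pre y y' \<and> len a - len y' < len a - len y" if R: "R y y'" for y y'
    proof -
      obtain s where "s \<in> S" "y' = y \<otimes> s" "len y' = len y + 1" "y \<in> C" "y' \<in> C" using R by (auto simp: R_def)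
      then show ?thesis using C(1)[of y] C(2)[of y'] by (auto simp: pre_mult)
    qed
    show "pre y' y \<or> (\<exists>y1. R y y1 \<and> pre y1 y')" if y: "y \<in> C" "y' \<in> C" "pre y y'" for y y'
    proof (cases "len (inv y \<otimes> y') = 0")
      case True
      have c: "y \<in> carrier G" "y' \<in> carrier G" using y C by auto
      then have "inv y \<otimes> y' = \<one>" using True len_eq_0[of "inv y \<otimes> y'"] by simp
      then have "y \<otimes> (inv y \<otimes> y') = y" using c by simp
      then show ?thesis using c by simp
    next
      case False
      have c: "y \<in> carrier G" "y' \<in> carrier G" using y C by auto
      obtain u where u: "set u \<subseteq> S" "lp u = inv y \<otimes> y'" "length u = len (inv y \<otimes> y')"
        using len_ex[of "inv y \<otimes> y'"] c by auto
      obtain s u' where su: "u = s # u'" using False u by (cases u) auto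
      have s: "s \<in> S" "set u' \<subseteq> S" using u su by auto
      have "reduced u'" using reduced_append(2)[of "[s]" u'] u su by simp
      then have "pre s (inv y \<otimes> y')" using u s su pre_mult[of s "lp u'"] by auto
      then have *: "pre (y \<otimes> s) y'" "len (y \<otimes> s) = len y + 1" using pre_shift[OF y(3)] s by auto
      then have "y \<otimes> s \<in> C" using y pre_trans by (auto simp: C_def)
      then show ?thesis using * y s by (auto simp: R_def)
    qed
    show "\<exists>c\<in>C. pre p c \<and> pre q c" if R: "R y p" "R y q" for y p q
    proof -
      obtain s t where st: "s \<in> S" "p = y \<otimes> s" "len p = len y + 1" "t \<in> S" "q = y \<otimes> t" "len q = len y + 1"
        and y: "y \<in> C" "p \<in> C" "q \<in> C" using R by (auto simp: R_def)
      have yc: "y \<in> carrier G" using C y by auto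
      show ?thesis
      proof (cases "s = t")
        case True then show ?thesis using st y C(1) by (intro bexI[of _ p]) auto
      next
        case False
        let ?D = "lp (alternating (m s t) s t)"
        have D: "?D \<in> carrier G" using set_alternating_subset[OF st(1,4)] by blast
        have below: "pre (y \<otimes> ?D) h \<and> len (y \<otimes> ?D) = len y + len ?D \<and> m s t \<noteq> 0" if h: "h \<in> {a, b}" for h
        proof -
          have ph: "pre y h" "pre p h" "pre q h" using y h by (auto simp: C_def)
          have "pre s (inv y \<otimes> h)" "pre t (inv y \<otimes> h)"
            using pre_unshift(2)[of y s h] pre_unshift(2)[of y t h] ph st yc by simp_all
          from two_prefixes[OF _ st(1,4) False this] have "pre ?D (inv y \<otimes> h)" "m s t \<noteq> 0"
            using yc a b h by auto
          then show ?thesis using pre_shift[OF ph(1), of ?D] by blast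
        qed
        then have DC: "y \<otimes> ?D \<in> C" by (auto simp: C_def)
        have Dl: "len (y \<otimes> ?D) = len y + len ?D" "m s t \<noteq> 0" using below[of a] by auto
        have "pre (y \<otimes> r) (y \<otimes> ?D)" if r: "r \<in> {s, t}" for r
        proof -
          have "pre r ?D" using alternating_prefix[OF st(1,4) False Dl(2)] r by auto
          moreover have "pre y (y \<otimes> ?D)" using Dl yc D by (simp add: pre_mult)
          ultimately show ?thesis using pre_shift(1)[of y "y \<otimes> ?D" r] yc D by simp
        qed
        then show ?thesis using DC st by blast
      qed
    qed
  qed (use pre_trans C a b in \<open>auto simp: C_def\<close>)
  then show thesis using that C by (auto simp: C_def pre_closed)
qed

text \<open>The longest prefix of \<open>h\<close> that can be multiplied to \<open>x\<close> without cancellation.\<close>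

definition fit :: "'a \<Rightarrow> 'a \<Rightarrow> 'a" where
  "fit x h = (SOME z. pre z h \<and> len (x \<otimes> z) = len x + len z \<and>
      (\<forall>y. pre y h \<longrightarrow> len (x \<otimes> y) = len x + len y \<longrightarrow> pre y z))"

lemma fit:
  assumes x: "x \<in> carrier G" and h: "h \<in> carrier G"
  shows "pre (fit x h) h" "len (x \<otimes> fit x h) = len x + len (fit x h)"
    "\<And>y. pre y h \<Longrightarrow> len (x \<otimes> y) = len x + len y \<Longrightarrow> pre y (fit x h)" "fit x h \<in> carrier G"
proof -
  obtain z where z: "pre z h" "pre z (inv x \<otimes> w0)"
      "\<And>y. pre y h \<Longrightarrow> pre y (inv x \<otimes> w0) \<Longrightarrow> pre y z"
    using meet_exists[of h "inv x \<otimes> w0"] x h by auto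
  have "pre z h \<and> len (x \<otimes> z) = len x + len z \<and>
      (\<forall>y. pre y h \<longrightarrow> len (x \<otimes> y) = len x + len y \<longrightarrow> pre y z)"
    using z pre_complement[OF x] pre_closed by blast
  from someI[of "\<lambda>z. pre z h \<and> len (x \<otimes> z) = len x + len z \<and>
      (\<forall>y. pre y h \<longrightarrow> len (x \<otimes> y) = len x + len y \<longrightarrow> pre y z)", OF this, folded fit_def]
  show "pre (fit x h) h" "len (x \<otimes> fit x h) = len x + len (fit x h)"
    "\<And>y. pre y h \<Longrightarrow> len (x \<otimes> y) = len x + len y \<Longrightarrow> pre y (fit x h)" "fit x h \<in> carrier G"
    using pre_closed by auto
qed

lemma fit_one: "h \<in> carrier G \<Longrightarrow> fit \<one> h = h"
  using fit[of \<one> h] by (intro pre_antisym) (auto dest: pre_closed)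

text \<open>What fits to \<open>x y\<close> can be found by fitting first to \<open>y\<close> and then to \<open>x\<close>. This is the reason why pushing
  elements into pairs, as defined below, is an action.\<close>

lemma fit_mult:
  assumes x: "x \<in> carrier G" and y: "y \<in> carrier G" and xy: "len (x \<otimes> y) = len x + len y"
    and h: "h \<in> carrier G"
  shows "fit x (y \<otimes> fit y h) = y \<otimes> fit (x \<otimes> y) h" "pre (fit (x \<otimes> y) h) (fit y h)"
proof -
  define u where "u = fit y h"
  define v where "v = fit x (y \<otimes> u)"
  define u' where "u' = inv y \<otimes> v"
  define q where "q = fit (x \<otimes> y) h"
  have u: "pre u h" "len (y \<otimes> u) = len y + len u" "u \<in> carrier G"
    "\<And>z. pre z h \<Longrightarrow> len (y \<otimes> z) = len y + len z \<Longrightarrow> pre z u"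
    using fit[OF y h] by (auto simp: u_def)
  have v: "pre v (y \<otimes> u)" "len (x \<otimes> v) = len x + len v" "v \<in> carrier G"
    "\<And>z. pre z (y \<otimes> u) \<Longrightarrow> len (x \<otimes> z) = len x + len z \<Longrightarrow> pre z v"
    using fit[of x "y \<otimes> u"] x y u by (auto simp: v_def)
  have q: "pre q h" "len (x \<otimes> y \<otimes> q) = len (x \<otimes> y) + len q" "q \<in> carrier G"
    "\<And>z. pre z h \<Longrightarrow> len (x \<otimes> y \<otimes> z) = len (x \<otimes> y) + len z \<Longrightarrow> pre z q"
    using fit[of "x \<otimes> y" h] x y h by (auto simp: q_def)
  have "pre y v" using v(4)[of y] pre_mult[OF y u(3)] u(2) xy by simp
  then have v': "v = y \<otimes> u'" "len v = len y + len u'" "u' \<in> carrier G"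
    using y v(3) by (auto simp: u'_def pre_def)
  have u'u: "pre u' u" using pre_unshift(2)[OF y v'(3), of "y \<otimes> u"] v(1) v' y u by simp
  have "len (x \<otimes> y \<otimes> u') = len (x \<otimes> y) + len u'"
    using v(2) v' x y xy by (simp add: m_assoc)
  then have u'q: "pre u' q" using q(4) pre_trans[OF u'u u(1)] by blast
  have "len (x \<otimes> (y \<otimes> q)) = len x + len y + len q" using q(2) xy x y q(3) by (simp add: m_assoc)
  moreover have "len (x \<otimes> (y \<otimes> q)) \<le> len x + len (y \<otimes> q)" "len (y \<otimes> q) \<le> len y + len q"
    using len_mult x y q(3) by simp_all
  ultimately have yq: "len (y \<otimes> q) = len y + len q" "len (x \<otimes> (y \<otimes> q)) = len x + len (y \<otimes> q)" by simp_all
  have qu: "pre q u" using u(4) q(1) yq by blast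
  have "pre (y \<otimes> q) (y \<otimes> u)"
    using pre_shift(1)[of y "y \<otimes> u" q] qu y u by (simp add: pre_mult)
  then have "pre (y \<otimes> q) v" using v(4) yq by blast
  then have "pre q u'" using pre_unshift(2)[OF y q(3), of v] yq v' y by simp
  then have "q = u'" using u'q pre_antisym by blast
  then show "fit x (y \<otimes> fit y h) = y \<otimes> fit (x \<otimes> y) h" "pre (fit (x \<otimes> y) h) (fit y h)"
    using v'(1) qu by (simp_all add: u_def v_def q_def)
qed

section \<open>Cancellation in the braid monoid\<close>

text \<open>A braid is recorded as a pair of a simple head and a word for the tail. An element \<open>x\<close> of the
  Coxeter group acts by multiplying to the head as much of it as possible and pushing the rest of
  the head into the tail.\<close>

definition push :: "'a \<Rightarrow> 'a \<times> 'a list \<Rightarrow> 'a \<times> 'a list" where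
  "push x p = (x \<otimes> fit x (fst p), rw (inv (fit x (fst p)) \<otimes> fst p) @ snd p)"

definition good :: "'a \<times> 'a list \<Rightarrow> bool" where
  "good p \<longleftrightarrow> fst p \<in> carrier G \<and> set (snd p) \<subseteq> S"

definition peq :: "'a \<times> 'a list \<Rightarrow> 'a \<times> 'a list \<Rightarrow> bool" where
  "peq p q \<longleftrightarrow> fst p = fst q \<and> snd p \<sim> snd q"

lemma peq_refl [simp]: "peq p p" by (simp add: peq_def)
lemma peq_sym: "peq p q \<Longrightarrow> peq q p" by (auto simp: peq_def be_sym)
lemma peq_trans [trans]: "peq p q \<Longrightarrow> peq q r \<Longrightarrow> peq p r" by (auto simp: peq_def intro: be_trans)

lemma push_good [simp]: "x \<in> carrier G \<Longrightarrow> good p \<Longrightarrow> good (push x p)"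
  using fit(4)[of x "fst p"] by (simp add: good_def push_def)

lemma push_cong: "peq p q \<Longrightarrow> peq (push x p) (push x q)"
  by (auto simp: peq_def push_def be_left)

lemma push_one: "good p \<Longrightarrow> push \<one> p = p"
  by (simp add: push_def good_def fit_one)

lemma rw_split: "pre x h \<Longrightarrow> rw x @ rw (inv x \<otimes> h) \<sim> rw h"
  using rw_mult[of x "inv x \<otimes> h"] by (auto simp: pre_def)

lemma push_mult:
  assumes x: "x \<in> carrier G" and y: "y \<in> carrier G" and xy: "len (x \<otimes> y) = len x + len y" and p: "good p"
  shows "peq (push (x \<otimes> y) p) (push x (push y p))"
proof -
  obtain h k where p': "p = (h, k)" "h \<in> carrier G" "set k \<subseteq> S" using p by (cases p) (auto simp: good_def)
  define u where "u = fit y h"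
  define q where "q = fit (x \<otimes> y) h"
  have c: "u \<in> carrier G" "q \<in> carrier G" using fit(4) x y p' by (auto simp: u_def q_def)
  have f: "fit x (y \<otimes> u) = y \<otimes> q" "pre q u" using fit_mult[OF x y xy p'(2)] by (auto simp: u_def q_def)
  have "pre u h" using fit(1)[OF y p'(2)] by (simp add: u_def)
  then have "pre (inv q \<otimes> u) (inv q \<otimes> h)" 
  proof -
    assume "pre u h"
    then have "pre (q \<otimes> (inv q \<otimes> u)) h" using c by simp
    moreover have "len (q \<otimes> (inv q \<otimes> u)) = len q + len (inv q \<otimes> u)" using f(2) c by (simp add: pre_def)
    ultimately show ?thesis using pre_unshift(2)[of q "inv q \<otimes> u" h] c by simp
  qed
  then have "rw (inv q \<otimes> u) @ rw (inv (inv q \<otimes> u) \<otimes> (inv q \<otimes> h)) \<sim> rw (inv q \<otimes> h)" by (rule rw_split)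
  then have r: "rw (inv q \<otimes> u) @ rw (inv u \<otimes> h) \<sim> rw (inv q \<otimes> h)"
    using c p' by (simp add: inv_mult_group m_assoc)
  have "inv (y \<otimes> q) \<otimes> (y \<otimes> u) = inv q \<otimes> u" using c y by (simp add: inv_mult_group m_assoc)
  then have "push x (push y p) = (x \<otimes> (y \<otimes> q), rw (inv q \<otimes> u) @ rw (inv u \<otimes> h) @ k)"
    using f by (simp add: push_def p' u_def[symmetric])
  moreover have "push (x \<otimes> y) p = (x \<otimes> y \<otimes> q, rw (inv q \<otimes> h) @ k)"
    by (simp add: push_def p' q_def[symmetric])
  ultimately show ?thesis using be_right[OF be_sym[OF r], of k] x y c by (simp add: peq_def m_assoc)
qed

lemma foldr_push_good: "set u \<subseteq> S \<Longrightarrow> good p \<Longrightarrow> good (foldr push u p)"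
  by (induct u) auto

lemma foldr_push_reduced: "reduced u \<Longrightarrow> good p \<Longrightarrow> peq (foldr push u p) (push (lp u) p)"
proof (induct u)
  case Nil then show ?case by (simp add: push_one)
next
  case (Cons s u)
  have s: "s \<in> S" "set u \<subseteq> S" using Cons.prems(1) by simp_all
  have red: "reduced u" using Cons.prems(1) by (rule reduced_ConsD)
  have "length (s # u) = len (lp (s # u))" "length u = len (lp u)" using Cons.prems(1) red by blast+
  then have l: "len (s \<otimes> lp u) = len s + len (lp u)"
    unfolding lp_Cons list.size len_S[OF s(1)] by linarith
  have "peq (push s (foldr push u p)) (push s (push (lp u) p))"
    using Cons.hyps[OF red Cons.prems(2)] by (rule push_cong)
  also have "peq \<dots> (push (s \<otimes> lp u) p)"
    by (rule peq_sym[OF push_mult[OF S_closed[OF s(1)] lp_closed[OF s(2)] l Cons.prems(2)]])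
  finally show ?case by simp
qed

lemma foldr_push_cong:
  "u \<sim> v \<Longrightarrow> set u \<subseteq> S \<Longrightarrow> good p \<Longrightarrow> good q \<Longrightarrow> peq p q \<Longrightarrow> peq (foldr push u p) (foldr push v q)"
proof (induct arbitrary: p q rule: word_cong.induct)
  case (rel u v)
  then obtain s t where st: "u = alternating (m s t) s t" "v = alternating (m s t) t s"
    "s \<in> S" "t \<in> S" "s \<noteq> t" "m s t \<noteq> 0" by (metis braid_relE)
  have ts: "m t s = m s t" using ord_swap st by simp
  have r: "reduced u" "reduced v" using reduced_alternating[of s t] reduced_alternating[of t s] st ts by auto
  have "lp u = lp v" using lp_alternating_eq st by simp
  then have "peq (foldr push u p) (push (lp v) p)" using foldr_push_reduced[OF r(1) rel(3)] by simp
  also have "peq \<dots> (push (lp v) q)" using rel push_cong by simp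
  also have "peq \<dots> (foldr push v q)" using foldr_push_reduced[OF r(2) rel(4)] peq_sym by blast
  finally show ?case .
next
  case (refl u)
  then show ?case
  proof (induct u)
    case (Cons s u) then show ?case by (simp add: push_cong)
  qed simp
next
  case (sym u v)
  then show ?case using be_set[of u v] peq_sym by metis
next
  case (trans u v w)
  have "peq (foldr push u p) (foldr push v p)" using trans(2)[of p p] trans(5,6) by simp
  also have "peq \<dots> (foldr push w q)" using trans(4)[of p q] trans(5-8) be_set[OF trans(1)] by simp
  finally show ?case .
next
  case (append u u' v v')
  have s: "set v' \<subseteq> S" "set u \<subseteq> S" "set v \<subseteq> S" using append be_set[of v v'] by auto
  have "set u' \<subseteq> S" using be_set[OF append(1)] s(2) by simp
  then have "peq (foldr push u (foldr push v p)) (foldr push u' (foldr push v' q))"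
    using append(2)[OF s(2)] append(4)[OF s(3) append(6-8)] foldr_push_good append(6,7) s by blast
  then show ?case by simp
qed

text \<open>The braid relations act trivially because both of their sides are reduced words of one element; so the
  head and, up to braid equivalence, the tail depend on the braid only.\<close>

definition nf :: "'a list \<Rightarrow> 'a \<times> 'a list" where "nf u = foldr push u (\<one>, [])"

lemma good_one: "good (\<one>, [])" by (simp add: good_def)

lemma nf_good: "set u \<subseteq> S \<Longrightarrow> fst (nf u) \<in> carrier G" "set u \<subseteq> S \<Longrightarrow> set (snd (nf u)) \<subseteq> S"
  using foldr_push_good[OF _ good_one] by (auto simp: nf_def good_def)

lemma nf_cong: "u \<sim> v \<Longrightarrow> set u \<subseteq> S \<Longrightarrow> peq (nf u) (nf v)"
  unfolding nf_def by (rule foldr_push_cong) (auto simp: good_one)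

lemma nf_word: "set u \<subseteq> S \<Longrightarrow> u \<sim> rw (fst (nf u)) @ snd (nf u)"
proof (induct u)
  case Nil then show ?case by (simp add: nf_def)
next
  case (Cons s u)
  define h k where "h = fst (nf u)" and "k = snd (nf u)"
  have s: "s \<in> S" "set u \<subseteq> S" using Cons by auto
  have h: "h \<in> carrier G" using nf_good s by (simp add: h_def)
  let ?y = "fit s h"
  have n: "nf (s # u) = (s \<otimes> ?y, rw (inv ?y \<otimes> h) @ k)"
    by (simp add: nf_def push_def h_def k_def)
  note f = fit[OF S_closed[OF s(1)] h]
  have "reduced (s # rw ?y)" "lp (s # rw ?y) = s \<otimes> ?y" using s f by auto
  then have "s # rw ?y \<sim> rw (s \<otimes> ?y)" using matsumoto[of "s # rw ?y" "rw (s \<otimes> ?y)"] rw[of "s \<otimes> ?y"] s f by simp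
  have "s # u \<sim> s # rw h @ k" using Cons s by (simp add: h_def k_def be_Cons)
  also have "\<dots> \<sim> s # (rw ?y @ rw (inv ?y \<otimes> h)) @ k"
    by (intro be_Cons be_right be_sym[OF rw_split] f)
  also have "\<dots> = (s # rw ?y) @ rw (inv ?y \<otimes> h) @ k" by simp
  also have "\<dots> \<sim> rw (s \<otimes> ?y) @ rw (inv ?y \<otimes> h) @ k"
    using \<open>s # rw ?y \<sim> rw (s \<otimes> ?y)\<close> by (rule be_right)
  finally show ?case by (simp add: n)
qed

text \<open>The head is the largest simple left divisor: pushing \<open>d\<close> last leaves \<open>d\<close> as a prefix of the head.\<close>

lemma nf_head: assumes "reduced d" "set e \<subseteq> S" "u \<sim> d @ e" shows "pre (lp d) (fst (nf u))"
proof -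
  have "set u \<subseteq> S" using be_set[OF assms(3)] assms by auto
  then have "peq (nf u) (foldr push d (nf e))" using nf_cong[OF assms(3)] by (simp add: nf_def)
  also have "peq \<dots> (push (lp d) (nf e))"
    by (rule foldr_push_reduced) (use assms nf_good in \<open>auto simp: good_def\<close>)
  finally have "fst (nf u) = lp d \<otimes> fit (lp d) (fst (nf e))" by (simp add: peq_def push_def)
  then show ?thesis using fit[of "lp d" "fst (nf e)"] nf_good assms by (simp add: pre_mult)
qed

text \<open>The head and tail of \<open>s u\<close> determine those of \<open>u\<close> up to regrouping.\<close>

lemma left_cancel_letter: assumes "s # u \<sim> s # v" "set u \<subseteq> S" "s \<in> S" shows "u \<sim> v"
proof -
  have v: "set v \<subseteq> S" using be_set[OF assms(1)] assms by auto
  define h k h' k' where "h = fst (nf u)" "k = snd (nf u)" "h' = fst (nf v)" "k' = snd (nf v)"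
  note d = this
  have c: "h \<in> carrier G" "h' \<in> carrier G" using nf_good assms v by (auto simp: d)
  have "peq (push s (nf u)) (push s (nf v))" using nf_cong[OF assms(1)] assms by (simp add: nf_def)
  then have *: "s \<otimes> fit s h = s \<otimes> fit s h'" "rw (inv (fit s h) \<otimes> h) @ k \<sim> rw (inv (fit s h') \<otimes> h') @ k'"
    by (auto simp: peq_def push_def d)
  then have e: "fit s h = fit s h'" using fit(4)[of s h] fit(4)[of s h'] assms c by simp
  have "u \<sim> rw h @ k" using nf_word[OF assms(2)] by (simp add: d)
  also have "\<dots> \<sim> (rw (fit s h) @ rw (inv (fit s h) \<otimes> h)) @ k"
    using c assms by (intro be_right be_sym[OF rw_split] fit) auto
  also have "\<dots> \<sim> rw (fit s h) @ rw (inv (fit s h') \<otimes> h') @ k'"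
    using be_left[OF *(2)] by simp
  also have "\<dots> = (rw (fit s h') @ rw (inv (fit s h') \<otimes> h')) @ k'" by (simp add: e)
  also have "\<dots> \<sim> rw h' @ k'"
    using c assms by (intro be_right rw_split fit) auto
  also have "\<dots> \<sim> v" using be_sym[OF nf_word[OF v]] by (simp add: d)
  finally show ?thesis .
qed

lemma left_cancel: "w @ u \<sim> w @ v \<Longrightarrow> set w \<subseteq> S \<Longrightarrow> set u \<subseteq> S \<Longrightarrow> u \<sim> v"
proof (induct w)
  case (Cons s w) then show ?case using left_cancel_letter[of s "w @ u" "w @ v"] by simp
qed simp

lemma right_cancel: "u @ w \<sim> v @ w \<Longrightarrow> set w \<subseteq> S \<Longrightarrow> set u \<subseteq> S \<Longrightarrow> u \<sim> v"
  using left_cancel[of "rev w" "rev u" "rev v"] be_rev[of "u @ w" "v @ w"] be_rev[of "rev u" "rev v"] by simp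

section \<open>Greatest common divisors\<close>

definition ldiv :: "'a list \<Rightarrow> 'a list \<Rightarrow> bool" where "ldiv d u \<longleftrightarrow> (\<exists>e. u \<sim> d @ e)"
definition rdiv :: "'a list \<Rightarrow> 'a list \<Rightarrow> bool" where "rdiv d u \<longleftrightarrow> (\<exists>e. u \<sim> e @ d)"

lemma rdiv_rev: "rdiv d u \<longleftrightarrow> ldiv (rev d) (rev u)"
proof
  assume "rdiv d u"
  then show "ldiv (rev d) (rev u)" unfolding rdiv_def ldiv_def using be_rev by fastforce
next
  assume "ldiv (rev d) (rev u)"
  then obtain e where "rev u \<sim> rev d @ e" by (auto simp: ldiv_def)
  from be_rev[OF this] show "rdiv d u" by (auto simp: rdiv_def)
qed

lemma left_head:
  assumes "set u \<subseteq> S"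
  obtains h where "reduced h" "ldiv h u" "\<And>d. reduced d \<Longrightarrow> ldiv d u \<Longrightarrow> ldiv d h"
proof -
  let ?h = "rw (fst (nf u))"
  have h: "reduced ?h" "lp ?h = fst (nf u)" using rw nf_good assms by auto
  have max: "ldiv d ?h" if d: "reduced d" "ldiv d u" for d
  proof -
    obtain e where e: "u \<sim> d @ e" using d by (auto simp: ldiv_def)
    have "set e \<subseteq> S" using be_set[OF e] assms by auto
    then have "pre (lp d) (lp ?h)" using nf_head[OF d(1) _ e] h by simp
    then show ?thesis using pre_reduced[OF d(1) h(1)] by (metis ldiv_def)
  qed
  have "ldiv ?h u" using nf_word[OF assms] unfolding ldiv_def by blast
  from that[OF h(1) this max] show thesis .
qed

lemma right_head:
  assumes "set u \<subseteq> S"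
  obtains h where "reduced h" "rdiv h u" "\<And>d. reduced d \<Longrightarrow> rdiv d u \<Longrightarrow> rdiv d h"
proof -
  obtain h where h: "reduced h" "ldiv h (rev u)" "\<And>d. reduced d \<Longrightarrow> ldiv d (rev u) \<Longrightarrow> ldiv d h"
    using left_head[of "rev u"] assms by auto
  show thesis
  proof (rule that[of "rev h"])
    show "reduced (rev h)" using h(1) reduced_rev by blast
    show "rdiv (rev h) u" using h(2) by (simp add: rdiv_rev)
    show "rdiv d (rev h)" if "reduced d" "rdiv d u" for d
      using h(3)[of "rev d"] that reduced_rev[of d] by (simp add: rdiv_rev)
  qed
qed

text \<open>Two letters that left divide a braid left divide its head, and there the lemma on two descents applies.\<close>

lemma common_letters:
  assumes "s \<noteq> t" "s # a \<sim> t # b" "set (s # a) \<subseteq> S"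
  shows "m s t \<noteq> 0 \<and> ldiv (alternating (m s t) s t) (s # a)"
proof -
  let ?u = "s # a" and ?h = "fst (nf (s # a))"
  have st: "s \<in> S" "t \<in> S" "set a \<subseteq> S" "set b \<subseteq> S" using assms be_set[OF assms(2)] by auto
  have h: "?h \<in> carrier G" using nf_good assms by blast
  have "pre s ?h" using nf_head[of "[s]" a ?u] st by simp
  moreover have "pre t ?h" using nf_head[of "[t]" b ?u] st assms by simp
  ultimately have *: "m s t \<noteq> 0" "pre (lp (alternating (m s t) s t)) ?h"
    using two_prefixes[OF h st(1,2) assms(1)] by auto
  then obtain f where "rw ?h \<sim> alternating (m s t) s t @ f"
    using pre_reduced[OF reduced_alternating[OF st(1,2) assms(1)], of "rw ?h"] rw[OF h] by metis
  then have "?u \<sim> alternating (m s t) s t @ f @ snd (nf ?u)"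
    using be_trans[OF nf_word[OF assms(3)]] be_right by fastforce
  then show ?thesis using * by (auto simp: ldiv_def)
qed

lemma ldiv_refl [simp]: "ldiv u u" by (auto simp: ldiv_def intro: exI[of _ "[]"])

lemma ldiv_trans: assumes "ldiv a b" "ldiv b c" shows "ldiv a c"
proof -
  obtain e f where "b \<sim> a @ e" "c \<sim> b @ f" using assms by (auto simp: ldiv_def)
  then have "c \<sim> a @ e @ f" using be_trans be_right by fastforce
  then show ?thesis by (auto simp: ldiv_def)
qed

lemma ldiv_length: "ldiv d u \<Longrightarrow> length d \<le> length u"
  using be_length by (fastforce simp: ldiv_def)

lemma ldiv_set: "ldiv d u \<Longrightarrow> set d \<subseteq> set u"
  using be_set by (fastforce simp: ldiv_def)

lemma left_gcd:
  assumes u: "set u \<subseteq> S" and v: "set v \<subseteq> S"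
  obtains g where "ldiv g u" "ldiv g v" "\<And>d. ldiv d u \<Longrightarrow> ldiv d v \<Longrightarrow> ldiv d g"
proof -
  define C where "C = {d. ldiv d u \<and> ldiv d v}"
  define R where "R d d' \<longleftrightarrow> d \<in> C \<and> d' \<in> C \<and> (\<exists>s. d' = d @ [s])" for d d'
  have CS: "set d \<subseteq> S" "length d \<le> length u" if "d \<in> C" for d
    using that u ldiv_set[of d u] ldiv_length[of d u] by (auto simp: C_def)
  have "\<exists>g\<in>C. ldiv [] g \<and> (\<forall>d\<in>C. ldiv [] d \<longrightarrow> ldiv d g)"
  proof (rule newman_greatest[where f = "\<lambda>d. length u - length d" and R = R])
    show "length u - length y \<le> length u - length x" if "ldiv x y" for x y
      using ldiv_length[OF that] by simp
    show "y \<in> C \<and> y' \<in> C \<and> ldiv y y' \<and> length u - length y' < length u - length y" if R: "R y y'" for y y'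
    proof -
      obtain s where "y' = y @ [s]" "y \<in> C" "y' \<in> C" using R by (auto simp: R_def)
      then show ?thesis using CS(2)[of y'] by (auto simp: ldiv_def)
    qed
    show "ldiv y' y \<or> (\<exists>y1. R y y1 \<and> ldiv y1 y')" if y: "y \<in> C" "y' \<in> C" "ldiv y y'" for y y'
    proof -
      obtain e where e: "y' \<sim> y @ e" using y by (auto simp: ldiv_def)
      show ?thesis
      proof (cases e)
        case Nil
        then have "y \<sim> y' @ []" using e be_sym by simp
        then show ?thesis unfolding ldiv_def by blast
      next
        case (Cons s e')
        then have "ldiv (y @ [s]) y'" using e by (auto simp: ldiv_def)
        moreover from this have "y @ [s] \<in> C" using y ldiv_trans by (auto simp: C_def)
        ultimately show ?thesis using y by (auto simp: R_def)
      qed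
    qed
    show "\<exists>c\<in>C. ldiv a c \<and> ldiv b c" if R: "R y a" "R y b" for y a b
    proof -
      obtain s t where st: "a = y @ [s]" "b = y @ [t]" and y: "y \<in> C" "a \<in> C" "b \<in> C"
        using R by (auto simp: R_def)
      have stS: "s \<in> S" "t \<in> S" "set y \<subseteq> S" using CS(1)[of a] CS(1)[of b] y st by auto
      show ?thesis
      proof (cases "s = t")
        case True then show ?thesis using st y by (intro bexI[of _ a]) auto
      next
        case False
        let ?A = "alternating (m s t) s t"
        have below: "m s t \<noteq> 0 \<and> ldiv (y @ ?A) h" if h: "h = u \<or> h = v" for h
        proof -
          have "ldiv a h" "ldiv b h" using y h by (auto simp: C_def)
          then obtain e f where ef: "h \<sim> y @ s # e" "h \<sim> y @ t # f" using st by (auto simp: ldiv_def)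
          have sub: "set (s # e) \<subseteq> S" using be_set[OF ef(1)] h u v by auto
          have "y @ s # e \<sim> y @ t # f" using ef be_sym be_trans by blast
          then have "s # e \<sim> t # f" using left_cancel stS sub by blast
          then obtain g where g: "m s t \<noteq> 0" "s # e \<sim> ?A @ g"
            using common_letters[OF False _ sub] by (auto simp: ldiv_def)
          then have "h \<sim> (y @ ?A) @ g" using be_trans[OF ef(1) be_left[OF g(2)]] by simp
          then show ?thesis using g(1) by (auto simp: ldiv_def)
        qed
        have m0: "m s t \<noteq> 0" and "y @ ?A \<in> C" using below[of u] below[of v] by (auto simp: C_def)
        obtain i where i: "m s t = Suc i" using m0 by (cases "m s t") auto
        have "y @ ?A \<sim> a @ alternating i t s" unfolding i st by simp
        moreover have "y @ ?A \<sim> b @ alternating i s t"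
          using be_left[OF be_braid[OF stS(1,2) False m0], of y] unfolding i st by simp
        ultimately show ?thesis using \<open>y @ ?A \<in> C\<close> unfolding ldiv_def by blast
      qed
    qed
    show "[] \<in> C" by (auto simp: C_def ldiv_def)
  qed (use ldiv_trans in auto)
  then obtain g where g: "g \<in> C" "\<forall>d\<in>C. ldiv [] d \<longrightarrow> ldiv d g" by blast
  have "ldiv [] d" for d by (auto simp: ldiv_def)
  with g have "ldiv d g" if "ldiv d u" "ldiv d v" for d using that by (simp add: C_def)
  then show thesis using that[of g] g(1) by (simp add: C_def)
qed

end

section \<open>Diagram automorphisms acting on braid words\<close>

context coxeter
begin

lemma map_alternating: "map f (alternating n s t) = alternating n (f s) (f t)"
  by (simp add: alternating_nth)

lemma letter_map_cong:
  assumes f: "\<And>s. s \<in> S \<Longrightarrow> f s \<in> S" "inj_on f S"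
      "\<And>s t. s \<in> S \<Longrightarrow> t \<in> S \<Longrightarrow> m (f s) (f t) = m s t"
  shows "u \<sim> v \<Longrightarrow> set u \<subseteq> S \<Longrightarrow> map f u \<sim> map f v"
proof (induct rule: word_cong.induct)
  case (rel u v)
  then obtain s t where st: "u = alternating (m s t) s t" "v = alternating (m s t) t s"
    "s \<in> S" "t \<in> S" "s \<noteq> t" "m s t \<noteq> 0" by (metis braid_relE)
  have "f s \<noteq> f t" using st f(2) by (auto simp: inj_on_def)
  then have "alternating (m (f s) (f t)) (f s) (f t) \<sim> alternating (m (f s) (f t)) (f t) (f s)"
    using be_braid[of "f s" "f t"] f st by simp
  then show ?case using st f(3) by (simp add: map_alternating)
next
  case (sym u v) then show ?case using be_set[of u v] be_sym by metis
next
  case (trans u v w) then show ?case using be_set[of u v] be_trans by metis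
next
  case (append u u' v v') then show ?case using be_append by simp
qed simp

lemma diag_map_cong: assumes "diag f" "u \<sim> v" "set u \<subseteq> S" shows "map f u \<sim> map f v"
proof (rule letter_map_cong[OF _ _ _ assms(2,3)])
  show "inj_on f S" using assms(1) S_carrier by (auto simp: diag_def intro: inj_on_subset)
qed (use diag_S[OF assms(1)] diag_m[OF assms(1)] in auto)

lemma diag_map_reflect:
  assumes f: "diag f" and uv: "map f u \<sim> map f v" "set u \<subseteq> S" "set v \<subseteq> S" shows "u \<sim> v"
proof -
  let ?g = "inv_into S f"
  have inj: "inj_on f S" using f S_carrier by (auto simp: diag_def intro: inj_on_subset)
  have g: "?g s \<in> S" "f (?g s) = s" if "s \<in> S" for s
  proof -
    have "s \<in> f ` S" using that diag_image[OF f] by simp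
    then show "?g s \<in> S" "f (?g s) = s" by (rule inv_into_into, rule f_inv_into_f)
  qed
  have "inj_on ?g S" using g(2) by (metis inj_onI)
  moreover have "m (?g s) (?g t) = m s t" if "s \<in> S" "t \<in> S" for s t
    using diag_m[OF f g(1)[OF that(1)] g(1)[OF that(2)]] g that by simp
  moreover have "set (map f u) \<subseteq> S" using diag_set[OF f uv(2)] by simp
  ultimately have "map ?g (map f u) \<sim> map ?g (map f v)"
    using letter_map_cong[of ?g, OF g(1) _ _ uv(1)] by blast
  moreover have "map ?g (map f w) = w" if "set w \<subseteq> S" for w
    using that inj by (induct w) (auto simp: inv_into_f_f)
  ultimately show ?thesis using uv by simp
qed

end

section \<open>The Garside element\<close>

context finite_coxeter
begin

definition \<delta>\<^sub>0 :: "'a \<Rightarrow> 'a" where "\<delta>\<^sub>0 x = w0 \<otimes> x \<otimes> w0"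

lemma \<delta>\<^sub>0_involution [simp]: "x \<in> carrier G \<Longrightarrow> \<delta>\<^sub>0 (\<delta>\<^sub>0 x) = x"
proof -
  assume x: "x \<in> carrier G"
  have "\<delta>\<^sub>0 (\<delta>\<^sub>0 x) = (w0 \<otimes> w0) \<otimes> x \<otimes> (w0 \<otimes> w0)"
    unfolding \<delta>\<^sub>0_def using x by (simp only: m_assoc m_closed w0)
  then show ?thesis using x by simp
qed

lemma w0_cancel [simp]: "x \<in> carrier G \<Longrightarrow> w0 \<otimes> (w0 \<otimes> x) = x"
  by (simp add: m_assoc[symmetric])

lemma diag_\<delta>\<^sub>0: "diag \<delta>\<^sub>0"
proof -
  have S: "\<delta>\<^sub>0 s \<in> S" if "s \<in> S" for s
  proof (rule len_1)
    have "len (s \<otimes> w0) + 1 = len w0" using w0_left[of s] that by simp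
    moreover have "len (w0 \<otimes> (s \<otimes> w0)) + len (s \<otimes> w0) = len w0" using w0_right[of "s \<otimes> w0"] that by simp
    ultimately show "len (\<delta>\<^sub>0 s) = 1" using that by (simp add: \<delta>\<^sub>0_def m_assoc)
  qed (use that in \<open>simp add: \<delta>\<^sub>0_def\<close>)
  have "\<delta>\<^sub>0 ` S = S"
  proof
    show "S \<subseteq> \<delta>\<^sub>0 ` S" using S \<delta>\<^sub>0_involution S_closed by (metis image_eqI subsetI)
  qed (use S in auto)
  moreover have "inj_on \<delta>\<^sub>0 (carrier G)" by (rule inj_on_inverseI[of _ \<delta>\<^sub>0]) simp
  moreover have "\<delta>\<^sub>0 \<in> hom G G" by (auto simp: hom_def \<delta>\<^sub>0_def m_assoc)
  ultimately show ?thesis by (simp add: diag_def)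
qed

lemmas [simp] = diag_rules[OF diag_\<delta>\<^sub>0]

abbreviation D :: "'a list" where "D \<equiv> rw w0"

definition dual :: "'a \<Rightarrow> 'a" where "dual x = inv x \<otimes> w0"

lemma dual_closed [simp]: "x \<in> carrier G \<Longrightarrow> dual x \<in> carrier G" by (simp add: dual_def)

lemma len_dual: "x \<in> carrier G \<Longrightarrow> len (dual x) + len x = len w0"
  using w0_left[of "inv x"] by (simp add: dual_def)

lemma D_split: assumes "reduced x" shows "x @ rw (dual (lp x)) \<sim> D"
proof (rule matsumoto)
  have xS: "set x \<subseteq> S" using assms by blast
  then have c: "lp x \<in> carrier G" by blast
  show l: "lp (x @ rw (dual (lp x))) = lp D" using xS c by (simp add: dual_def)
  have "length (x @ rw (dual (lp x))) = len w0"
    using assms len_dual[OF c] rw_length[OF dual_closed[OF c]] by simp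
  then show "reduced (x @ rw (dual (lp x)))" unfolding l using xS c by simp
  show "reduced D" using rw(1)[OF w0] .
qed

lemma D_shift_letter: assumes s: "s \<in> S" shows "s # D \<sim> D @ [\<delta>\<^sub>0 s]"
proof -
  let ?y = "s \<otimes> w0"
  have t: "\<delta>\<^sub>0 s \<in> S" using s by simp
  have y: "len ?y + 1 = len w0" using w0_left[of s] s by simp
  have e: "?y \<otimes> \<delta>\<^sub>0 s = w0" using s by (simp add: \<delta>\<^sub>0_def m_assoc)
  have 1: "s # rw ?y \<sim> D" and 2: "rw ?y @ [\<delta>\<^sub>0 s] \<sim> D"
    by (rule matsumoto; use s t y e rw[OF w0] in simp)+
  have "s # D \<sim> s # rw ?y @ [\<delta>\<^sub>0 s]" using be_Cons[OF be_sym[OF 2]] .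
  also have "\<dots> = (s # rw ?y) @ [\<delta>\<^sub>0 s]" by simp
  also have "\<dots> \<sim> D @ [\<delta>\<^sub>0 s]" using 1 by (rule be_right)
  finally show ?thesis .
qed

lemma D_shift: "set u \<subseteq> S \<Longrightarrow> u @ D \<sim> D @ map \<delta>\<^sub>0 u"
proof (induct u)
  case (Cons s u)
  then have "s # (u @ D) \<sim> s # (D @ map \<delta>\<^sub>0 u)" by (intro be_Cons) simp
  also have "\<dots> = (s # D) @ map \<delta>\<^sub>0 u" by simp
  also have "\<dots> \<sim> (D @ [\<delta>\<^sub>0 s]) @ map \<delta>\<^sub>0 u" using Cons by (intro be_right D_shift_letter) simp
  finally show ?case by simp
qed simp

text \<open>The lift \<open>E\<close> of the longest element of a parabolic subgroup is divisible by each of its letters, and moving a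
  letter across \<open>E\<close> permutes these letters.\<close>

lemma parabolic_garside:
  assumes J: "J \<subseteq> S"
  obtains E where "set E \<subseteq> J" "\<And>s. s \<in> J \<Longrightarrow> \<exists>r. set r \<subseteq> J \<and> E \<sim> s # r"
    "\<And>s. s \<in> J \<Longrightarrow> \<exists>t\<in>J. s # E \<sim> E @ [t]"
proof -
  let ?P = "generate G J"
  obtain d where d: "d \<in> ?P" "\<And>x. x \<in> ?P \<Longrightarrow> len (d \<otimes> x) + len x = len d"
    using longest_element[OF J fin] by blast
  have JG: "J \<subseteq> carrier G" using J S_carrier by blast
  have PG: "?P \<subseteq> carrier G" using generate_incl[OF JG] .
  have dc: "d \<in> carrier G" using d(1) PG by blast
  have "len (d \<otimes> d) = 0" using d(2)[OF d(1)] by simp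
  then have "d \<otimes> d = \<one>" using len_eq_0[of "d \<otimes> d"] dc by simp
  then have di: "inv d = d" using dc by (simp add: inv_equality)
  have dd: "d \<otimes> (d \<otimes> x) = x" if "x \<in> carrier G" for x
    using \<open>d \<otimes> d = \<one>\<close> that dc by (simp add: m_assoc[symmetric])
  obtain E where E: "reduced E" "set E \<subseteq> J" "lp E = d" using parabolic_reduced[OF J d(1)] by metis
  have *: "(\<exists>r. set r \<subseteq> J \<and> E \<sim> s # r) \<and> (\<exists>t\<in>J. s # E \<sim> E @ [t])" if s: "s \<in> J" for s
  proof -
    have sS: "s \<in> S" using J s by blast
    have sP: "s \<in> ?P" using s by (rule generate.incl)
    define y where "y = s \<otimes> d"
    define t where "t = d \<otimes> y"
    have yP: "y \<in> ?P" unfolding y_def using sP d(1) by (rule generate.eng)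
    have tP: "t \<in> ?P" unfolding t_def using d(1) yP by (rule generate.eng)
    have c: "y \<in> carrier G" "t \<in> carrier G" using yP tP PG by auto
    have "len (inv d \<otimes> inv s) = len y" using len_inv_mult[of d s] dc sS by (simp add: y_def)
    then have ly: "len y + 1 = len d" using d(2)[OF sP] di sS by simp
    have "len t + len y = len d" using d(2)[OF yP] by (simp add: t_def)
    then have tS: "t \<in> S" using len_1[OF c(2)] ly by simp
    obtain r where r: "reduced r" "set r \<subseteq> J" "lp r = y" using parabolic_reduced[OF J yP] by metis
    obtain t' where t': "reduced t'" "set t' \<subseteq> J" "lp t' = t" using parabolic_reduced[OF J tP] by metis
    have "length t' = 1" using t' tS by simp
    then have tJ: "t \<in> J" using t' tS by (cases t') auto
    have yt: "y \<otimes> t = d"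
    proof -
      have "y \<otimes> t = s \<otimes> (d \<otimes> (d \<otimes> (s \<otimes> d)))" using dc sS by (simp add: t_def y_def m_assoc)
      also have "\<dots> = d" using dd[of "s \<otimes> d"] dc sS by simp
      finally show ?thesis .
    qed
    have rS: "set r \<subseteq> S" using r by blast
    have ry: "length r = len y" using r by simp
    have "s \<otimes> y = d" using sS dc by (simp add: y_def)
    then have "lp (s # r) = lp E" "reduced (s # r)" using r(3) E(3) rS sS ry ly by simp_all
    then have 1: "E \<sim> s # r" using matsumoto[OF E(1)] by simp
    have "lp (r @ [t]) = lp E" "reduced (r @ [t])" using r(3) E(3) rS tS ry ly yt by simp_all
    then have 2: "E \<sim> r @ [t]" using matsumoto[OF E(1)] by simp
    have "s # E \<sim> s # r @ [t]" using 2 by (rule be_Cons)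
    also have "\<dots> = (s # r) @ [t]" by simp
    also have "\<dots> \<sim> E @ [t]" using be_sym[OF 1] by (rule be_right)
    finally show ?thesis using 1 r(2) tJ by blast
  qed
  show thesis by (rule that[OF E(2)]) (use * in blast)+
qed

text \<open>A common multiple of \<open>a\<close> and \<open>s b\<close>: in \<open>a E = E a'\<close> the letter \<open>s\<close> can be split off from \<open>E\<close> on the left.\<close>

lemma common_right_multiple:
  assumes J: "J \<subseteq> S" and a: "set a \<subseteq> J" and b: "set b \<subseteq> J"
  obtains c d where "set c \<subseteq> J" "set d \<subseteq> J" "a @ c \<sim> b @ d"
proof -
  obtain E where E: "set E \<subseteq> J" "\<And>s. s \<in> J \<Longrightarrow> \<exists>r. set r \<subseteq> J \<and> E \<sim> s # r"
    "\<And>s. s \<in> J \<Longrightarrow> \<exists>t\<in>J. s # E \<sim> E @ [t]" using parabolic_garside[OF J] by blast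
  have shift: "\<exists>u'. set u' \<subseteq> J \<and> u @ E \<sim> E @ u'" if "set u \<subseteq> J" for u
    using that
  proof (induct u)
    case Nil then show ?case by (intro exI[of _ "[]"]) simp
  next
    case (Cons s u)
    then obtain u' t where *: "set u' \<subseteq> J" "u @ E \<sim> E @ u'" "t \<in> J" "s # E \<sim> E @ [t]"
      using E(3)[of s] by auto
    have "s # u @ E \<sim> (s # E) @ u'" using be_Cons[OF *(2)] by simp
    also have "\<dots> \<sim> (E @ [t]) @ u'" using *(4) by (rule be_right)
    finally show ?case using * by (intro exI[of _ "t # u'"]) simp
  qed
  have "set b \<subseteq> J \<Longrightarrow> set a \<subseteq> J \<Longrightarrow> \<exists>c d. set c \<subseteq> J \<and> set d \<subseteq> J \<and> a @ c \<sim> b @ d" for a b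
  proof (induct b arbitrary: a)
    case Nil then show ?case by (intro exI[of _ "[]"] exI[of _ a]) simp
  next
    case (Cons s b)
    obtain a' where a': "set a' \<subseteq> J" "a @ E \<sim> E @ a'" using shift[OF Cons(3)] by blast
    obtain r where r: "set r \<subseteq> J" "E \<sim> s # r" using E(2)[of s] Cons by auto
    obtain c d where cd: "set c \<subseteq> J" "set d \<subseteq> J" "(r @ a') @ c \<sim> b @ d"
      using Cons(1)[of "r @ a'"] Cons(2) r a' by auto
    have "(a @ E) @ c \<sim> (E @ a') @ c" using a'(2) by (rule be_right)
    also have "\<dots> = E @ a' @ c" by simp
    also have "\<dots> \<sim> (s # r) @ a' @ c" using r(2) by (rule be_right)
    also have "\<dots> = s # (r @ a') @ c" by simp
    also have "\<dots> \<sim> s # b @ d" using cd(3) by (rule be_Cons)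
    finally show ?case using cd E(1) by (intro exI[of _ "E @ c"] exI[of _ d]) simp
  qed
  then show thesis using that a b by blast
qed

lemma common_left_multiple:
  assumes a: "set a \<subseteq> S" and b: "set b \<subseteq> S"
  obtains c d where "set c \<subseteq> S" "set d \<subseteq> S" "c @ a \<sim> d @ b"
proof -
  obtain c d where cd: "set c \<subseteq> S" "set d \<subseteq> S" "rev a @ c \<sim> rev b @ d"
    using common_right_multiple[of S "rev a" "rev b"] a b by auto
  show thesis using be_rev[OF cd(3)] cd by (intro that[of "rev c" "rev d"]) simp_all
qed

end

context finite_coxeter
begin

section \<open>Conjugating simple braids by positive braids\<close>

lemma rdivI: "u \<sim> e @ d \<Longrightarrow> rdiv d u" by (auto simp: rdiv_def)
lemma ldivI: "u \<sim> d @ e \<Longrightarrow> ldiv d u" by (auto simp: ldiv_def)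

text \<open>The largest simple right divisor of \<open>\<phi>(\<tau>) x\<close> is of the form \<open>\<phi>(c) x\<close>, with \<open>c\<close> a right divisor of \<open>\<tau>\<close>,
  and hence of \<open>x' \<psi>(\<tau>)\<close>; being maximal it is itself right divisible by \<open>\<psi>(c)\<close>.\<close>

lemma greedy_step:
  assumes \<phi>: "diag \<phi>" and \<psi>: "diag \<psi>" and \<tau>: "set \<tau> \<subseteq> S" and x: "reduced x" and x': "set x' \<subseteq> S"
    and eq: "map \<phi> \<tau> @ x \<sim> x' @ map \<psi> \<tau>"
  obtains e c g where "\<tau> \<sim> e @ c" "reduced (map \<phi> c @ x)" "map \<phi> c @ x \<sim> g @ map \<psi> c"
    "\<And>s. c = [] \<Longrightarrow> rdiv [s] \<tau> \<Longrightarrow> \<not> reduced (\<phi> s # x) \<and> rdiv [\<psi> s] x"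
    "map \<phi> e @ g \<sim> x' @ map \<psi> e"
proof -
  note [simp] = diag_rules[OF \<phi>] diag_rules[OF \<psi>]
  have xS: "set x \<subseteq> S" using x by blast
  have sub: "set (map \<phi> \<tau> @ x) \<subseteq> S" using \<phi> \<tau> xS by simp
  obtain h where h: "reduced h" "rdiv h (map \<phi> \<tau> @ x)"
      "\<And>d. reduced d \<Longrightarrow> rdiv d (map \<phi> \<tau> @ x) \<Longrightarrow> rdiv d h"
    using right_head[OF sub] by blast
  have "rdiv x h" by (rule h(3)[OF x rdivI[OF be_refl]])
  then obtain f where f: "h \<sim> f @ x" by (auto simp: rdiv_def)
  obtain e1 where e1: "map \<phi> \<tau> @ x \<sim> e1 @ h" using h(2) by (auto simp: rdiv_def)
  have "map \<phi> \<tau> @ x \<sim> (e1 @ f) @ x" using be_trans[OF e1 be_left[OF f]] by simp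
  then have ef: "map \<phi> \<tau> \<sim> e1 @ f" using right_cancel[OF _ xS, of "map \<phi> \<tau>"] \<phi> \<tau> by simp
  then have "set e1 \<subseteq> S" "set f \<subseteq> S" using be_set[OF ef] diag_set[OF \<phi> \<tau>] by simp_all
  then obtain e c where ec: "set e \<subseteq> S" "e1 = map \<phi> e" "set c \<subseteq> S" "f = map \<phi> c"
    using diag_word[OF \<phi>] by metis
  have "map \<phi> \<tau> \<sim> map \<phi> (e @ c)" using ef ec by simp
  then have \<tau>ec: "\<tau> \<sim> e @ c" using diag_map_reflect[OF \<phi> _ \<tau>] ec by simp
  have hc: "h \<sim> map \<phi> c @ x" using f ec by simp
  have red: "reduced (map \<phi> c @ x)" using be_reduced[OF hc h(1)] .
  have "reduced (map \<phi> c)" using reduced_append(1)[OF red] .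
  then have cred: "reduced c" using diag_reduced[OF \<phi> ec(3)] by blast
  then have pc: "reduced (map \<psi> c)" using diag_reduced[OF \<psi> ec(3)] by blast
  have \<psi>\<tau>: "map \<psi> \<tau> \<sim> map \<psi> e @ map \<psi> c" using diag_map_cong[OF \<psi> \<tau>ec \<tau>] by simp
  have tot: "map \<phi> \<tau> @ x \<sim> (x' @ map \<psi> e) @ map \<psi> c" using be_trans[OF eq be_left[OF \<psi>\<tau>]] by simp
  then have "rdiv (map \<psi> c) h" by (intro h(3)[OF pc] rdivI)
  then obtain g where "h \<sim> g @ map \<psi> c" by (auto simp: rdiv_def)
  then have g: "map \<phi> c @ x \<sim> g @ map \<psi> c" using be_trans[OF be_sym[OF hc]] by blast
  have "set (map \<phi> c @ x) \<subseteq> S" using diag_set[OF \<phi> ec(3)] xS by simp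
  then have gS: "set g \<subseteq> S" unfolding be_set[OF g] by simp
  have "(map \<phi> e @ g) @ map \<psi> c \<sim> map \<phi> e @ map \<phi> c @ x" using be_left[OF be_sym[OF g]] by simp
  also have "\<dots> = (e1 @ f) @ x" using ec by simp
  also have "\<dots> \<sim> map \<phi> \<tau> @ x" using be_right[OF be_sym[OF ef]] .
  also have "\<dots> \<sim> (x' @ map \<psi> e) @ map \<psi> c" by (rule tot)
  finally have fin: "map \<phi> e @ g \<sim> x' @ map \<psi> e"
    using right_cancel ec gS \<phi> \<psi> by simp
  have last: "\<not> reduced (\<phi> s # x) \<and> rdiv [\<psi> s] x" if c0: "c = []" and s: "rdiv [s] \<tau>" for s
  proof
    obtain \<tau>' where \<tau>': "\<tau> \<sim> \<tau>' @ [s]" using s by (auto simp: rdiv_def)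
    have sS: "s \<in> S" using be_set[OF \<tau>'] \<tau> by simp
    have hx: "h \<sim> x" using hc c0 by simp
    show "\<not> reduced (\<phi> s # x)"
    proof
      assume r: "reduced (\<phi> s # x)"
      have "map \<phi> \<tau> @ x \<sim> map \<phi> \<tau>' @ (\<phi> s # x)" using be_right[OF diag_map_cong[OF \<phi> \<tau>' \<tau>]] by simp
      then have "rdiv (\<phi> s # x) h" by (intro h(3)[OF r] rdivI)
      then obtain e' where "h \<sim> e' @ \<phi> s # x" by (auto simp: rdiv_def)
      then show False using be_length[OF hx] be_length[of h "e' @ \<phi> s # x"] by simp
    qed
    have "map \<phi> \<tau> @ x \<sim> (x' @ map \<psi> \<tau>') @ [\<psi> s]"
      using be_trans[OF eq be_left[OF diag_map_cong[OF \<psi> \<tau>' \<tau>]]] by simp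
    moreover have "reduced [\<psi> s]" using \<psi> sS by simp
    ultimately have "rdiv [\<psi> s] h" using h(3) rdivI by blast
    then obtain e' where "h \<sim> e' @ [\<psi> s]" by (auto simp: rdiv_def)
    then show "rdiv [\<psi> s] x" using rdivI[OF be_trans[OF be_sym[OF hx]]] by blast
  qed
  show thesis by (rule that[OF \<tau>ec red g last fin])
qed

text \<open>From \<open>\<phi>(\<tau>) x = x' \<tau>\<close> one obtains \<open>\<tau> x\<inverse> \<Delta> = x'\<inverse> \<phi>(\<tau>) \<Delta>\<close>, and \<open>\<phi>(\<tau>)\<close> can be moved across \<open>\<Delta>\<close>: the complements of \<open>x\<close>
  and \<open>x'\<close> satisfy an equation of the same kind, with the automorphism now on the other side.\<close>

lemma dual_equation:
  assumes \<phi>: "diag \<phi>" and \<tau>: "set \<tau> \<subseteq> S" and x: "reduced x" and x': "reduced x'"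
    and eq: "map \<phi> \<tau> @ x \<sim> x' @ \<tau>"
  shows "\<tau> @ rw (dual (lp x)) \<sim> rw (dual (lp x')) @ map (\<lambda>s. \<delta>\<^sub>0 (\<phi> s)) \<tau>"
proof -
  note [simp] = diag_rules[OF \<phi>]
  have xS: "set x \<subseteq> S" "set x' \<subseteq> S" using x x' by blast+
  have "x' @ \<tau> @ rw (dual (lp x)) \<sim> (map \<phi> \<tau> @ x) @ rw (dual (lp x))"
    using be_right[OF be_sym[OF eq]] by simp
  also have "\<dots> = map \<phi> \<tau> @ x @ rw (dual (lp x))" by simp
  also have "\<dots> \<sim> map \<phi> \<tau> @ D" by (rule be_left[OF D_split[OF x]])
  also have "\<dots> \<sim> D @ map \<delta>\<^sub>0 (map \<phi> \<tau>)" using \<phi> \<tau> by (intro D_shift) simp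
  also have "\<dots> \<sim> (x' @ rw (dual (lp x'))) @ map \<delta>\<^sub>0 (map \<phi> \<tau>)" by (rule be_right[OF be_sym[OF D_split[OF x']]])
  finally have "x' @ \<tau> @ rw (dual (lp x)) \<sim> x' @ rw (dual (lp x')) @ map \<delta>\<^sub>0 (map \<phi> \<tau>)"
    by (simp only: append_assoc)
  then have "\<tau> @ rw (dual (lp x)) \<sim> rw (dual (lp x')) @ map \<delta>\<^sub>0 (map \<phi> \<tau>)"
    by (rule left_cancel) (use xS \<tau> in simp_all)
  then show ?thesis by (simp only: map_map o_def)
qed

text \<open>The greedy step is applied to \<open>x\<close>, where it gives a strong conjugation, or, if that is trivial, to the
  complement of \<open>x\<close>. In the second case a letter \<open>s\<close> that right divides \<open>\<tau>\<close> also right divides \<open>x\<close>, so \<open>s\<close> can be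
  multiplied to the complement and the step is nontrivial; that \<open>c\<close> times the complement of \<open>x\<close> is simple means that
  \<open>c\<close> right divides \<open>x\<close>, which is a cyclic shift.\<close>

lemma conjugation_step:
  assumes \<phi>: "diag \<phi>" and \<tau>: "set \<tau> \<subseteq> S" "\<tau> \<noteq> []" and x: "reduced x" and x': "reduced x'"
    and eq: "map \<phi> \<tau> @ x \<sim> x' @ \<tau>"
  obtains e c y where "\<tau> \<sim> e @ c" "c \<noteq> []" "reduced c" "reduced y" "map \<phi> e @ y \<sim> x' @ e"
    "map \<phi> c @ x \<sim> y @ c" "reduced (map \<phi> c @ x) \<or> len (lp x \<otimes> inv (lp c)) + len (lp c) = len (lp x)"
proof -
  note [simp] = diag_rules[OF \<phi>]
  have xS: "set x \<subseteq> S" "set x' \<subseteq> S" using x x' by blast+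
  obtain e c g where *: "\<tau> \<sim> e @ c" "reduced (map \<phi> c @ x)" "map \<phi> c @ x \<sim> g @ map (\<lambda>s. s) c"
    "\<And>s. c = [] \<Longrightarrow> rdiv [s] \<tau> \<Longrightarrow> \<not> reduced (\<phi> s # x) \<and> rdiv [s] x"
    "map \<phi> e @ g \<sim> x' @ map (\<lambda>s. s) e"
    using greedy_step[OF \<phi> diag_id \<tau>(1) x xS(2)] eq by auto
  show thesis
  proof (cases "c = []")
    case False
    have cS: "set c \<subseteq> S" using be_set[OF *(1)] \<tau> by auto
    have "reduced c" using reduced_append(1)[OF *(2)] diag_reduced[OF \<phi> cS] by blast
    moreover have "reduced g" using be_reduced[OF *(3,2)] reduced_append(1) by blast
    ultimately show thesis using that[OF *(1) False, of g] * by simp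
  next
    case True
    let ?\<psi> = "\<lambda>s. \<delta>\<^sub>0 (\<phi> s)" and ?X = "lp x"
    have \<psi>: "diag ?\<psi>" using diag_comp[OF diag_\<delta>\<^sub>0 \<phi>] .
    have X: "?X \<in> carrier G" using xS by blast
    have dx: "reduced (rw (dual ?X))" using rw(1)[of "dual ?X"] X by simp
    obtain \<tau>' s where \<tau>': "\<tau> = \<tau>' @ [s]" using \<tau>(2) by (metis rev_exhaust)
    then have s: "rdiv [s] \<tau>" "s \<in> S" using \<tau> by (auto simp: rdiv_def)
    have "rdiv [s] x" using *(4)[OF True s(1)] by blast
    then obtain x1 where x1: "x \<sim> x1 @ [s]" by (auto simp: rdiv_def)
    have x1S: "set x1 \<subseteq> S" using be_set[OF x1] xS by auto
    have "?X = lp x1 \<otimes> s" using be_lp[OF x1 xS(1)] x1S s by simp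
    then have "?X \<otimes> s = lp x1" using x1S s by simp
    then have "len (?X \<otimes> s) + 1 \<le> len ?X" using len_le[OF x1S] be_length[OF x1] x by simp
    then have "len (?X \<otimes> s) + 1 = len ?X" using len_mult_S[OF X s(2)] by linarith
    moreover have "s \<otimes> dual ?X = dual (?X \<otimes> s)" using X s by (simp add: dual_def inv_mult_group m_assoc)
    moreover have "len (dual (?X \<otimes> s)) + len (?X \<otimes> s) = len w0" using len_dual X s by simp
    ultimately have "len (s \<otimes> dual ?X) = len (dual ?X) + 1" using len_dual[OF X] by simp
    then have sx: "reduced (s # rw (dual ?X))" using dx s X by simp
    have eq': "map (\<lambda>s. s) \<tau> @ rw (dual ?X) \<sim> rw (dual (lp x')) @ map ?\<psi> \<tau>"
      using dual_equation[OF \<phi> \<tau>(1) x x' eq] by simp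
    have dS: "set (rw (dual (lp x'))) \<subseteq> S" using xS by simp
    obtain e c g where **: "\<tau> \<sim> e @ c" "reduced (map (\<lambda>s. s) c @ rw (dual ?X))"
      "map (\<lambda>s. s) c @ rw (dual ?X) \<sim> g @ map ?\<psi> c"
      "\<And>s. c = [] \<Longrightarrow> rdiv [s] \<tau> \<Longrightarrow> \<not> reduced (s # rw (dual ?X)) \<and> rdiv [?\<psi> s] (rw (dual ?X))"
      using greedy_step[OF diag_id \<psi> \<tau>(1) dx dS eq'] by metis
    have c0: "c \<noteq> []" using **(4)[OF _ s(1)] sx by blast
    have ecS: "set e \<subseteq> S" "set c \<subseteq> S" using be_set[OF **(1)] \<tau> by auto
    let ?c = "lp c"
    have cc: "?c \<in> carrier G" using ecS by blast
    have cred: "reduced c" using reduced_append(1)[OF **(2)] by simp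
    have red2: "reduced (c @ rw (dual ?X))" using **(2) by simp
    have cd: "?c \<otimes> dual ?X = dual (?X \<otimes> inv ?c)" using X cc by (simp add: dual_def inv_mult_group m_assoc)
    have "len (?c \<otimes> dual ?X) = len ?c + len (dual ?X)" using red2 cred ecS X by simp
    moreover have "len (dual (?X \<otimes> inv ?c)) + len (?X \<otimes> inv ?c) = len w0" using len_dual X cc by simp
    ultimately have lc: "len (?X \<otimes> inv ?c) + len ?c = len ?X" unfolding cd using len_dual[OF X] by linarith
    define y where "y = rw (?X \<otimes> inv ?c)"
    have y: "reduced y" "lp y = ?X \<otimes> inv ?c" using rw[of "?X \<otimes> inv ?c"] X cc by (auto simp: y_def)
    have yS: "set y \<subseteq> S" using y by blast
    have ly: "length y = len (?X \<otimes> inv ?c)" unfolding y_def by (rule rw_length) (use X cc in simp)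
    have lc': "length c = len ?c" using cred by blast
    have L: "lp (y @ c) = ?X" using y(2) yS ecS X cc by (simp add: m_assoc)
    have "length (y @ c) = len ?X" unfolding length_append using ly lc' lc by linarith
    moreover have "set (y @ c) \<subseteq> S" using yS ecS by simp
    ultimately have "reduced (y @ c)" unfolding L by blast
    from matsumoto[OF x this L[symmetric]] have "x \<sim> y @ c" .
    have g: "reduced g" using reduced_append(1)[OF be_reduced[OF **(3,2)]] .
    let ?x1 = "\<phi> ?c \<otimes> (?X \<otimes> inv ?c)"
    have gS: "set g \<subseteq> S" using g by blast
    have "?c \<otimes> dual ?X = lp g \<otimes> \<delta>\<^sub>0 (\<phi> ?c)"
    proof -
      have "lp (c @ rw (dual ?X)) = lp (g @ map ?\<psi> c)" using be_lp[of "c @ rw (dual ?X)" "g @ map ?\<psi> c"] **(3) ecS X by simp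
      moreover have "lp (map ?\<psi> c) = \<delta>\<^sub>0 (\<phi> ?c)" using diag_lp[OF \<psi> ecS(2)] .
      moreover have "set (map ?\<psi> c) \<subseteq> S" using ecS by auto
      ultimately show ?thesis using ecS X gS lp_append[of g "map ?\<psi> c"] by simp
    qed
    then have "lp g = ?c \<otimes> dual ?X \<otimes> inv (\<delta>\<^sub>0 (\<phi> ?c))"
      using gS cc \<phi> X diag_\<delta>\<^sub>0 by (simp add: m_assoc)
    also have "\<dots> = dual ?x1" using cc X \<phi> by (simp add: dual_def \<delta>\<^sub>0_def inv_mult_group m_assoc)
    finally have lg: "lp g = dual ?x1" .
    have "length g = length (rw (dual ?X))" using be_length[OF **(3)] by simp
    moreover have "length g = len (dual ?x1)" using g lg by metis
    ultimately have "len (dual ?x1) = len (dual ?X)" using rw_length[OF dual_closed[OF X]] by linarith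
    then have l1: "len ?x1 = len ?X" using len_dual[OF X] len_dual[of ?x1] cc X \<phi> by simp
    have "reduced (map \<phi> c @ y)"
    proof -
      have L1: "lp (map \<phi> c @ y) = ?x1" using ecS yS y(2) by simp
      have "length (map \<phi> c @ y) = len ?X" unfolding length_append length_map using ly lc' lc by linarith
      moreover have "set (map \<phi> c @ y) \<subseteq> S" using ecS yS by simp
      ultimately show ?thesis unfolding L1 l1 by blast
    qed
    moreover have "map \<phi> e @ map \<phi> c @ y \<sim> x' @ e"
    proof (rule right_cancel[of _ c])
      have "(map \<phi> e @ map \<phi> c @ y) @ c = map \<phi> (e @ c) @ (y @ c)" by simp
      also have "\<dots> \<sim> map \<phi> \<tau> @ x"
        using be_sym[OF \<open>x \<sim> y @ c\<close>] be_sym[OF diag_map_cong[OF \<phi> **(1) \<tau>(1)]] be_append by blast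
      also have "\<dots> \<sim> x' @ \<tau>" by (rule eq)
      also have "\<dots> \<sim> x' @ e @ c" by (rule be_left[OF **(1)])
      finally show "(map \<phi> e @ map \<phi> c @ y) @ c \<sim> (x' @ e) @ c" by simp
    qed (use ecS yS \<phi> in auto)
    moreover have "map \<phi> c @ x \<sim> (map \<phi> c @ y) @ c" using be_left[OF \<open>x \<sim> y @ c\<close>] by simp
    ultimately show thesis using that[OF **(1) c0 cred] lc by blast
  qed
qed

section \<open>Fractions\<close>

text \<open>If \<open>q\<inverse> u = p\<inverse> v\<close> with \<open>q, p\<close> right coprime, this element is positive: every common left multiple
  \<open>f q = h p\<close> is the least common right multiple of \<open>f\<close> and \<open>h\<close>, hence left divides \<open>f u = h v\<close>.\<close>

lemma coprime_fraction:
  assumes S: "set q \<subseteq> S" "set p \<subseteq> S" "set f \<subseteq> S" "set h \<subseteq> S" "set u \<subseteq> S" "set v \<subseteq> S"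
    and fq: "f @ q \<sim> h @ p" and fu: "f @ u \<sim> h @ v"
    and coprime: "\<And>e. rdiv e q \<Longrightarrow> rdiv e p \<Longrightarrow> e = []"
  obtains k where "set k \<subseteq> S" "u \<sim> q @ k" "v \<sim> p @ k"
proof -
  obtain g where g: "ldiv g (f @ q)" "ldiv g (f @ u)"
      "\<And>d. ldiv d (f @ q) \<Longrightarrow> ldiv d (f @ u) \<Longrightarrow> ldiv d g"
    using left_gcd[of "f @ q" "f @ u"] S by auto
  have "ldiv f g" by (rule g(3)[OF ldivI[OF be_refl] ldivI[OF be_refl]])
  moreover have "ldiv h g" by (rule g(3)[OF ldivI[OF fq] ldivI[OF fu]])
  ultimately obtain a b where ab: "g \<sim> f @ a" "g \<sim> h @ b" by (auto simp: ldiv_def)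
  obtain e where e: "f @ q \<sim> g @ e" using g(1) by (auto simp: ldiv_def)
  have "f @ q \<sim> f @ a @ e" using be_trans[OF e be_right[OF ab(1)]] by simp
  then have "q \<sim> a @ e" using left_cancel S by blast
  moreover have "h @ p \<sim> h @ b @ e" using be_trans[OF be_sym[OF fq] be_trans[OF e be_right[OF ab(2)]]] by simp
  then have "p \<sim> b @ e" using left_cancel S by blast
  ultimately have "e = []" using coprime rdivI by blast
  then have "f @ q \<sim> g" using e by simp
  moreover obtain k where "f @ u \<sim> g @ k" using g(2) by (auto simp: ldiv_def)
  ultimately have *: "f @ u \<sim> (f @ q) @ k" using be_trans be_right be_sym by meson
  then have "u \<sim> q @ k" using left_cancel[of f u "q @ k"] S by simp
  moreover have "h @ v \<sim> (h @ p) @ k" using be_trans[OF be_sym[OF fu] be_trans[OF * be_right[OF fq]]] .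
  then have "v \<sim> p @ k" using left_cancel[of h v "p @ k"] S by simp
  moreover have "set k \<subseteq> S" using be_set[OF *] S by auto
  ultimately show thesis using that by blast
qed

text \<open>A fraction \<open>p q\<inverse>\<close> in lowest terms conjugating \<open>x\<close> to \<open>x'\<close> does so through a simple braid \<open>k\<close>: both
  \<open>k\<close> and its complement in the longest element are fractions to which the previous lemma applies.\<close>

lemma simple_between:
  assumes \<phi>: "diag \<phi>" and q: "set q \<subseteq> S" and p: "set p \<subseteq> S" and x: "reduced x" and x': "reduced x'"
    and fh: "set f \<subseteq> S" "set h \<subseteq> S" "f @ map \<phi> q \<sim> h @ map \<phi> p" "f @ x @ q \<sim> h @ x' @ p"
    and coprime: "\<And>e. rdiv e q \<Longrightarrow> rdiv e p \<Longrightarrow> e = []"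
  obtains k where "reduced k" "map \<phi> q @ k \<sim> x @ q" "map \<phi> p @ k \<sim> x' @ p"
proof -
  note [simp] = diag_rules[OF \<phi>]
  have xS: "set x \<subseteq> S" "set x' \<subseteq> S" using x x' by blast+
  have "\<exists>k. set k \<subseteq> S \<and> x @ q \<sim> map \<phi> q @ k \<and> x' @ p \<sim> map \<phi> p @ k"
  proof (rule coprime_fraction[OF _ _ fh(1,2) _ _ fh(3,4)])
    show "e = []" if e: "rdiv e (map \<phi> q)" "rdiv e (map \<phi> p)" for e
    proof -
      obtain a b where ab: "map \<phi> q \<sim> a @ e" "map \<phi> p \<sim> b @ e" using e by (auto simp: rdiv_def)
      have "set e \<subseteq> S" "set a \<subseteq> S" "set b \<subseteq> S"
        using be_set[OF ab(1)] be_set[OF ab(2)] diag_set[OF \<phi> q] diag_set[OF \<phi> p] by simp_all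
      then obtain e' a' b' where *: "set e' \<subseteq> S" "e = map \<phi> e'" "set a' \<subseteq> S" "a = map \<phi> a'" "set b' \<subseteq> S" "b = map \<phi> b'"
        using diag_word[OF \<phi>] by metis
      have "q \<sim> a' @ e'" "p \<sim> b' @ e'"
        using diag_map_reflect[OF \<phi>, of q "a' @ e'"] diag_map_reflect[OF \<phi>, of p "b' @ e'"] ab * q p by simp_all
      then have "e' = []" using coprime rdivI by blast
      then show ?thesis using * by simp
    qed
  qed (use \<phi> q p xS in auto)
  then obtain k where k: "set k \<subseteq> S" "x @ q \<sim> map \<phi> q @ k" "x' @ p \<sim> map \<phi> p @ k" by blast
  let ?\<psi> = "\<lambda>s. \<delta>\<^sub>0 (\<phi> s)" and ?d = "rw (dual (lp x))" and ?d' = "rw (dual (lp x'))"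
  have \<psi>: "diag ?\<psi>" using diag_comp[OF diag_\<delta>\<^sub>0 \<phi>] .
  have dS: "set ?d \<subseteq> S" "set ?d' \<subseteq> S" using xS by simp_all
  have push: "rw (dual (lp z)) @ map ?\<psi> r @ map \<delta>\<^sub>0 k \<sim> r @ D"
    if z: "reduced z" and r: "set r \<subseteq> S" and e: "z @ r \<sim> map \<phi> r @ k" for z r
  proof (rule left_cancel[of z])
    have zS: "set z \<subseteq> S" using z by blast
    have "z @ rw (dual (lp z)) @ map ?\<psi> r @ map \<delta>\<^sub>0 k = (z @ rw (dual (lp z))) @ map \<delta>\<^sub>0 (map \<phi> r @ k)"
      by (simp add: o_def)
    also have "\<dots> \<sim> D @ map \<delta>\<^sub>0 (z @ r)"
      using be_append[OF D_split[OF z] be_sym[OF diag_map_cong[OF diag_\<delta>\<^sub>0 e]]] zS r by simp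
    also have "\<dots> \<sim> (z @ r) @ D" using be_sym[OF D_shift[of "z @ r"]] zS r by simp
    finally show "z @ rw (dual (lp z)) @ map ?\<psi> r @ map \<delta>\<^sub>0 k \<sim> z @ r @ D" by simp
    show "set z \<subseteq> S" by (rule zS)
    show "set (rw (dual (lp z)) @ map ?\<psi> r @ map \<delta>\<^sub>0 k) \<subseteq> S"
      using zS r k(1) \<psi> diag_\<delta>\<^sub>0 diag_set[OF \<psi> r] by simp
  qed
  obtain f2 h2 where f2: "set f2 \<subseteq> S" "set h2 \<subseteq> S" "f2 @ q \<sim> h2 @ p" using common_left_multiple[OF q p] by blast
  have kk: "set (map \<delta>\<^sub>0 k) \<subseteq> S" using k(1) diag_\<delta>\<^sub>0 by simp
  have qs: "set (map ?\<psi> q) \<subseteq> S" "set (map ?\<psi> p) \<subseteq> S" using diag_set[OF \<psi> q] diag_set[OF \<psi> p] by simp_all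
  have fd: "f2 @ ?d @ map ?\<psi> q \<sim> h2 @ ?d' @ map ?\<psi> p"
  proof (rule right_cancel[OF _ kk])
    have "(f2 @ ?d @ map ?\<psi> q) @ map \<delta>\<^sub>0 k \<sim> f2 @ q @ D" using be_left[OF push[OF x q k(2)]] by simp
    also have "\<dots> \<sim> h2 @ p @ D" using be_right[OF f2(3), of D] by simp
    also have "\<dots> \<sim> (h2 @ ?d' @ map ?\<psi> p) @ map \<delta>\<^sub>0 k" using be_left[OF be_sym[OF push[OF x' p k(3)]]] by simp
    finally show "(f2 @ ?d @ map ?\<psi> q) @ map \<delta>\<^sub>0 k \<sim> (h2 @ ?d' @ map ?\<psi> p) @ map \<delta>\<^sub>0 k" .
  qed (use f2 dS qs in simp)
  have "set (?d @ map ?\<psi> q) \<subseteq> S" "set (?d' @ map ?\<psi> p) \<subseteq> S" using dS qs by simp_all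
  from coprime_fraction[OF q p f2(1,2) this f2(3) fd coprime]
  obtain k' where k': "?d @ map ?\<psi> q \<sim> q @ k'" by metis
  have "k @ k' \<sim> D"
  proof (rule left_cancel[of "map \<phi> q"])
    have "map \<phi> q @ k @ k' \<sim> (x @ q) @ k'" using be_right[OF be_sym[OF k(2)]] by simp
    also have "\<dots> \<sim> x @ ?d @ map ?\<psi> q" using be_left[OF be_sym[OF k']] by simp
    also have "\<dots> = (x @ ?d) @ map \<delta>\<^sub>0 (map \<phi> q)" by (simp add: o_def)
    also have "\<dots> \<sim> D @ map \<delta>\<^sub>0 (map \<phi> q)" by (rule be_right[OF D_split[OF x]])
    also have "\<dots> \<sim> map \<phi> q @ D" using be_sym[OF D_shift[of "map \<phi> q"]] \<phi> q by simp
    finally show "map \<phi> q @ k @ k' \<sim> map \<phi> q @ D" .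
    have "set (q @ k') \<subseteq> S" unfolding be_set[OF k', symmetric] using dS qs by simp
    then have "set k' \<subseteq> S" by simp
    then show "set (k @ k') \<subseteq> S" using k(1) by simp
  qed (use \<phi> q in simp)
  then have "reduced k" using reduced_append(1) be_reduced[OF be_sym] rw(1)[OF w0] by blast
  then show thesis using that be_sym k by blast
qed

end

section \<open>Presented monoids and groups\<close>

lemma in_word_class: "v \<in> word_class R u \<longleftrightarrow> word_cong R u v"
  by (simp add: word_class_def)

lemma word_class_eq: "word_class R u = word_class R v \<longleftrightarrow> word_cong R u v"
  unfolding word_class_def by (blast intro: word_cong.refl word_cong.sym word_cong.trans)

lemma pres_mult: "word_class R u \<otimes>\<^bsub>pres_monoid A R\<^esub> word_class R v = word_class R (u @ v)"
  unfolding pres_monoid_def word_class_def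
  by (auto intro: word_cong.refl) (meson word_cong.append word_cong.trans)

lemma pres_carrier: "carrier (pres_monoid A R) = {word_class R u | u. set u \<subseteq> A}"
  by (auto simp: pres_monoid_def lists_eq_set)

lemma pres_one: "\<one>\<^bsub>pres_monoid A R\<^esub> = word_class R []"
  by (simp add: pres_monoid_def)

definition word_inverse :: "('g \<times> bool) list \<Rightarrow> ('g \<times> bool) list" where
  "word_inverse u = rev (map (\<lambda>(a, e). (a, \<not> e)) u)"

lemma word_inverse_set: "set u \<subseteq> A \<times> UNIV \<Longrightarrow> set (word_inverse u) \<subseteq> A \<times> UNIV"
  by (auto simp: word_inverse_def)

lemma word_inverse_right:
  "set u \<subseteq> A \<times> UNIV \<Longrightarrow> word_cong (group_relations A R) (u @ word_inverse u) []"
proof (induct u)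
  case Nil then show ?case by (simp add: word_inverse_def word_cong.refl)
next
  case (Cons p u)
  obtain a e where p: "p = (a, e)" "a \<in> A" using Cons by (cases p) auto
  have "word_cong (group_relations A R) ([p] @ (u @ word_inverse u) @ [(a, \<not> e)]) ([p] @ [] @ [(a, \<not> e)])"
    using Cons by (intro word_cong.append word_cong.refl) auto
  moreover have "word_cong (group_relations A R) [(a, e), (a, \<not> e)] []"
    using p by (intro word_cong.rel) (auto simp: group_relations_def)
  ultimately show ?case by (auto simp: p word_inverse_def intro: word_cong.trans)
qed

lemma word_inverse_involution: "word_inverse (word_inverse u) = u"
  by (induct u) (auto simp: word_inverse_def)

lemma word_inverse_left:
  "set u \<subseteq> A \<times> UNIV \<Longrightarrow> word_cong (group_relations A R) (word_inverse u @ u) []"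
  using word_inverse_right[OF word_inverse_set, of u A R] by (simp add: word_inverse_involution)

lemma pres_monoid_monoid: "monoid (pres_monoid A R)"
proof (rule monoidI)
  fix x y assume "x \<in> carrier (pres_monoid A R)" "y \<in> carrier (pres_monoid A R)"
  then obtain u v where uv: "x = word_class R u" "set u \<subseteq> A" "y = word_class R v" "set v \<subseteq> A"
    unfolding pres_carrier by blast
  then have "set (u @ v) \<subseteq> A" by simp
  then show "x \<otimes>\<^bsub>pres_monoid A R\<^esub> y \<in> carrier (pres_monoid A R)"
    unfolding uv pres_mult pres_carrier by blast
qed (auto simp: pres_carrier pres_one pres_mult intro: exI[of _ "[]"])

lemma pres_group_group: "group (pres_group A R)"
proof -
  let ?R = "group_relations A R"
  interpret monoid "pres_group A R" unfolding pres_group_def by (rule pres_monoid_monoid)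
  have left: "word_class ?R (word_inverse u) \<otimes>\<^bsub>pres_group A R\<^esub> word_class ?R u = \<one>\<^bsub>pres_group A R\<^esub>"
    if "set u \<subseteq> A \<times> UNIV" for u
    using word_inverse_left[OF that] by (simp add: pres_group_def pres_mult pres_one word_class_eq)
  show ?thesis
  proof (rule groupI)
    fix x assume "x \<in> carrier (pres_group A R)"
    then obtain u where u: "x = word_class ?R u" "set u \<subseteq> A \<times> UNIV"
      unfolding pres_group_def pres_carrier by blast
    have "word_class ?R (word_inverse u) \<in> carrier (pres_group A R)"
      using word_inverse_set[OF u(2)] unfolding pres_group_def pres_carrier by blast
    then show "\<exists>y\<in>carrier (pres_group A R). y \<otimes>\<^bsub>pres_group A R\<^esub> x = \<one>\<^bsub>pres_group A R\<^esub>"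
      using left[OF u(2)] u(1) by blast
  qed (auto simp: m_assoc)
qed

text \<open>A permutation of the letters that respects the relations acts on classes of words.\<close>

lemma map_word_class:
  assumes f: "\<And>u v. word_cong R u v \<Longrightarrow> set u \<subseteq> A \<Longrightarrow> word_cong R (map f u) (map f v)"
    and g: "\<And>u v. word_cong R u v \<Longrightarrow> set u \<subseteq> A \<Longrightarrow> word_cong R (map g u) (map g v)"
    and A: "\<And>u v. word_cong R u v \<Longrightarrow> set u \<subseteq> A \<Longrightarrow> set v \<subseteq> A"
    and fA: "\<And>a. a \<in> A \<Longrightarrow> f a \<in> A" and gf: "\<And>a. a \<in> A \<Longrightarrow> g (f a) = a" and fg: "\<And>a. a \<in> A \<Longrightarrow> f (g a) = a"
    and u: "set u \<subseteq> A"
  shows "map f ` word_class R u = word_class R (map f u)"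
proof (intro equalityI subsetI)
  fix v assume "v \<in> map f ` word_class R u"
  then show "v \<in> word_class R (map f u)" using f u by (auto simp: in_word_class)
next
  fix v assume v: "v \<in> word_class R (map f u)"
  have fu: "set (map f u) \<subseteq> A" using fA u by auto
  have gfu: "map g (map f u) = u" using gf u by (simp add: map_idI subset_iff)
  have "word_cong R (map g (map f u)) (map g v)" using v g fu by (simp only: in_word_class)
  then have "map g v \<in> word_class R u" by (simp only: gfu in_word_class)
  moreover have "set v \<subseteq> A" using A fu v by (simp only: in_word_class)
  then have "map f (map g v) = v" using fg by (simp add: map_idI subset_iff)
  ultimately show "v \<in> map f ` word_class R u" by (metis image_eqI)
qed

section \<open>The braid group\<close>

context coxeter
begin

abbreviation group_eq :: "('a \<times> bool) list \<Rightarrow> ('a \<times> bool) list \<Rightarrow> bool" (infix "\<approx>\<^sub>g" 50) where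
  "u \<approx>\<^sub>g v \<equiv> word_cong (group_relations S (braid_relations G S)) u v"

lemmas ge_refl [simp, intro] = word_cong.refl[of "group_relations S (braid_relations G S)"]
lemmas ge_sym = word_cong.sym[of "group_relations S (braid_relations G S)"]
lemmas ge_trans [trans] = word_cong.trans[of "group_relations S (braid_relations G S)"]
lemmas ge_append = word_cong.append[of "group_relations S (braid_relations G S)"]

lemma ge_left: "u \<approx>\<^sub>g v \<Longrightarrow> w @ u \<approx>\<^sub>g w @ v" by (simp add: ge_append)
lemma ge_right: "u \<approx>\<^sub>g v \<Longrightarrow> u @ w \<approx>\<^sub>g v @ w" by (simp add: ge_append)

lemma group_relE:
  assumes "(u, v) \<in> group_relations S (braid_relations G S)"
  obtains (inverse) s e where "u = [(s, e), (s, \<not> e)]" "v = []" "s \<in> S"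
  | (braid) s t where "u = pos_word (alternating (m s t) s t)" "v = pos_word (alternating (m s t) t s)"
      "s \<in> S" "t \<in> S" "s \<noteq> t" "m s t \<noteq> 0"
  using assms unfolding group_relations_def braid_relations_def by blast

lemma ge_set: "u \<approx>\<^sub>g v \<Longrightarrow> set u \<subseteq> S \<times> UNIV \<longleftrightarrow> set v \<subseteq> S \<times> UNIV"
proof (induct rule: word_cong.induct)
  case (rel u v)
  then show ?case
  proof (cases rule: group_relE)
    case (braid s t)
    have "set (alternating (m s t) s t) \<subseteq> S" "set (alternating (m s t) t s) \<subseteq> S"
      using set_alternating_subset braid by simp_all
    then show ?thesis using braid by auto
  qed simp
qed auto

lemma ge_pos: "u \<sim> v \<Longrightarrow> pos_word u \<approx>\<^sub>g pos_word v"
proof (induct rule: word_cong.induct)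
  case (rel u v)
  then show ?case by (intro word_cong.rel) (auto simp: group_relations_def)
next
  case (sym u v) show ?case using sym(2) by (rule ge_sym)
next
  case (trans u v w) then show ?case by (metis ge_trans)
next
  case (append u u' v v') then show ?case using ge_append by simp
qed simp

lemma ge_inverse: "set u \<subseteq> S \<times> UNIV \<Longrightarrow> u @ word_inverse u \<approx>\<^sub>g []" "set u \<subseteq> S \<times> UNIV \<Longrightarrow> word_inverse u @ u \<approx>\<^sub>g []"
  by (rule word_inverse_right, assumption) (rule word_inverse_left, assumption)

lemma ge_cancel_right: assumes "u @ w \<approx>\<^sub>g v @ w" "set w \<subseteq> S \<times> UNIV" shows "u \<approx>\<^sub>g v"
proof -
  have *: "z @ w @ word_inverse w \<approx>\<^sub>g z" for z using ge_left[OF ge_inverse(1)[OF assms(2)], of z] by simp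
  have "u \<approx>\<^sub>g (u @ w) @ word_inverse w" using ge_sym[OF *] by simp
  also have "\<dots> \<approx>\<^sub>g (v @ w) @ word_inverse w" using assms(1) by (rule ge_right)
  also have "\<dots> \<approx>\<^sub>g v" using * by simp
  finally show ?thesis .
qed

lemma diag_group_map:
  assumes f: "diag f" shows "u \<approx>\<^sub>g v \<Longrightarrow> set u \<subseteq> S \<times> UNIV \<Longrightarrow> map (apfst f) u \<approx>\<^sub>g map (apfst f) v"
proof (induct rule: word_cong.induct)
  case (rel u v)
  from rel(1) show ?case
  proof (cases rule: group_relE)
    case (inverse s e)
    have "f s \<in> S" using diag_S[OF f inverse(3)] .
    then show ?thesis using inverse by (intro word_cong.rel) (auto simp: group_relations_def)
  next
    case (braid s t)
    have fp: "map (apfst f) (pos_word a) = pos_word (map f a)" for a by simp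
    have "set (alternating (m s t) s t) \<subseteq> S" using set_alternating_subset braid by simp
    then show ?thesis unfolding braid fp
      using ge_pos[OF diag_map_cong[OF f be_braid[OF braid(3-6)]]] by simp
  qed
next
  case (sym u v) then show ?case using ge_set[of u v] ge_sym by blast
next
  case (trans u v w) then show ?case using ge_set[of u v] ge_trans by blast
next
  case (append u u' v v') then show ?case using ge_append by simp
qed simp

end

context finite_coxeter
begin

text \<open>The braid monoid embeds into the braid group: replace every inverse letter \<open>s\<inverse>\<close> by the positive
  word \<open>s\<inverse> Z\<close> for the central element \<open>Z = D D\<close>, and compare words after equalising the number of
  factors \<open>Z\<close>.\<close>

definition Z :: "nat \<Rightarrow> 'a list" where "Z n = concat (replicate n (D @ D))"

lemma Z_0 [simp]: "Z 0 = []" by (simp add: Z_def)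
lemma Z_1: "Z (Suc 0) = D @ D" by (simp add: Z_def)
lemma Z_add: "Z (i + j) = Z i @ Z j" by (simp add: Z_def replicate_add)
lemma Z_set [simp]: "set (Z n) \<subseteq> S" by (induct n) (auto simp: Z_def dest: subsetD[OF rw_set[OF w0]])

lemma DD_central: assumes "set u \<subseteq> S" shows "u @ D @ D \<sim> D @ D @ u"
proof -
  have "u @ D @ D \<sim> (D @ map \<delta>\<^sub>0 u) @ D" using be_right[OF D_shift[OF assms]] by simp
  also have "\<dots> = D @ map \<delta>\<^sub>0 u @ D" by simp
  also have "\<dots> \<sim> D @ D @ map \<delta>\<^sub>0 (map \<delta>\<^sub>0 u)" using assms by (intro be_left D_shift) simp
  also have "map \<delta>\<^sub>0 (map \<delta>\<^sub>0 u) = u"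
  proof -
    have "\<delta>\<^sub>0 (\<delta>\<^sub>0 x) = x" if "x \<in> set u" for x using assms that by auto
    then show ?thesis by (simp add: map_idI)
  qed
  finally show ?thesis by simp
qed

lemma Z_central: assumes "set u \<subseteq> S" shows "u @ Z n \<sim> Z n @ u"
proof (induct n)
  case (Suc n)
  have "u @ Z (Suc n) = (u @ D @ D) @ Z n" by (simp add: Z_def)
  also have "\<dots> \<sim> (D @ D @ u) @ Z n" by (rule be_right[OF DD_central[OF assms]])
  also have "\<dots> = (D @ D) @ u @ Z n" by simp
  also have "\<dots> \<sim> (D @ D) @ Z n @ u" using Suc by (rule be_left)
  finally show ?case by (simp add: Z_def)
qed simp

definition inverse_letter :: "'a \<Rightarrow> 'a list" where "inverse_letter s = rw (s \<otimes> w0) @ D"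

lemma inverse_letter_set [simp]: "s \<in> S \<Longrightarrow> set (inverse_letter s) \<subseteq> S"
  by (simp add: inverse_letter_def)

lemma inverse_letter_right: assumes s: "s \<in> S" shows "s # inverse_letter s \<sim> Z (Suc 0)"
proof -
  have "reduced [s]" using s by simp
  from D_split[OF this] have "s # rw (s \<otimes> w0) \<sim> D" using s by (simp add: dual_def)
  from be_right[OF this, of D] show ?thesis by (simp add: inverse_letter_def Z_1)
qed

lemma inverse_letter_left: assumes s: "s \<in> S" shows "inverse_letter s @ [s] \<sim> Z (Suc 0)"
proof (rule left_cancel[of "[s]"])
  have "[s] @ inverse_letter s @ [s] \<sim> Z (Suc 0) @ [s]"
    using be_right[OF inverse_letter_right[OF s], of "[s]"] by simp
  also have "\<dots> \<sim> [s] @ Z (Suc 0)" using be_sym[OF Z_central[of "[s]"]] s by simp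
  finally show "[s] @ inverse_letter s @ [s] \<sim> [s] @ Z (Suc 0)" .
qed (use s in simp_all)

definition positive :: "('a \<times> bool) list \<Rightarrow> 'a list" where
  "positive u = concat (map (\<lambda>(s, e). if e then [s] else inverse_letter s) u)"

definition negatives :: "('a \<times> bool) list \<Rightarrow> nat" where
  "negatives u = length (filter (\<lambda>p. \<not> snd p) u)"

lemma positive_append: "positive (u @ v) = positive u @ positive v"
  and negatives_append: "negatives (u @ v) = negatives u + negatives v"
  by (simp_all add: positive_def negatives_def)

lemma positive_pos: "positive (pos_word u) = u" "negatives (pos_word u) = 0"
  by (induct u) (simp_all add: positive_def negatives_def)

lemma positive_set: "set u \<subseteq> S \<times> UNIV \<Longrightarrow> set (positive u) \<subseteq> S"
proof (induct u)
  case (Cons p u)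
  then show ?case using inverse_letter_set[of "fst p"] by (cases p) (simp add: positive_def split: if_splits)
qed (simp add: positive_def)

lemma positive_cong:
  "u \<approx>\<^sub>g v \<Longrightarrow> set u \<subseteq> S \<times> UNIV \<Longrightarrow> positive u @ Z (negatives v) \<sim> positive v @ Z (negatives u)"
proof (induct rule: word_cong.induct)
  case (rel u v)
  from rel(1) show ?case
  proof (cases rule: group_relE)
    case (inverse s e)
    then show ?thesis using inverse_letter_right[of s] inverse_letter_left[of s]
      by (cases e) (simp_all add: positive_def negatives_def)
  next
    case (braid s t)
    then show ?thesis using be_braid[of s t] by (simp add: positive_pos)
  qed
next
  case (sym u v)
  then show ?case using ge_set[of u v] be_sym by metis
next
  case (trans u v w)
  have s: "set v \<subseteq> S \<times> UNIV" "set w \<subseteq> S \<times> UNIV" using trans ge_set by blast+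
  note p = positive_set[OF trans(5)] positive_set[OF s(1)] positive_set[OF s(2)]
  let ?u = "negatives u" and ?v = "negatives v" and ?w = "negatives w"
  have zz: "Z i @ Z j = Z j @ Z i" for i j by (metis Z_add add.commute)
  have "(positive u @ Z ?w) @ Z ?v = (positive u @ Z ?v) @ Z ?w" by (simp only: append_assoc zz[of ?w ?v])
  also have "\<dots> \<sim> (positive v @ Z ?u) @ Z ?w" using trans by (intro be_right) simp
  also have "\<dots> = (positive v @ Z ?w) @ Z ?u" by (simp only: append_assoc zz[of ?u ?w])
  also have "\<dots> \<sim> (positive w @ Z ?v) @ Z ?u" using trans(4) s by (intro be_right) simp
  also have "\<dots> = (positive w @ Z ?u) @ Z ?v" by (simp only: append_assoc zz[of ?v ?u])
  finally show ?case by (rule right_cancel) (use p in simp_all)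
next
  case (append u u' v v')
  have su: "set u \<subseteq> S \<times> UNIV" "set v \<subseteq> S \<times> UNIV" using append by auto
  have s: "set u' \<subseteq> S \<times> UNIV" "set v' \<subseteq> S \<times> UNIV" using append(1,3) su ge_set by blast+
  note p = positive_set[OF su(1)] positive_set[OF su(2)] positive_set[OF s(1)] positive_set[OF s(2)]
  let ?u = "negatives u" and ?v = "negatives v" and ?u' = "negatives u'" and ?v' = "negatives v'"
  have "positive (u @ v) @ Z (negatives (u' @ v')) = positive u @ (positive v @ Z ?u') @ Z ?v'"
    by (simp add: positive_append negatives_append Z_add)
  also have "\<dots> \<sim> positive u @ (Z ?u' @ positive v) @ Z ?v'"
    by (intro be_left be_right Z_central p)
  also have "\<dots> = (positive u @ Z ?u') @ (positive v @ Z ?v')" by simp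
  also have "\<dots> \<sim> (positive u' @ Z ?u) @ (positive v' @ Z ?v)" 
    by (rule be_append[OF append(2)[OF su(1)] append(4)[OF su(2)]])
  also have "\<dots> = positive u' @ (Z ?u @ positive v') @ Z ?v" by simp
  also have "\<dots> \<sim> positive u' @ (positive v' @ Z ?u) @ Z ?v"
    by (intro be_left be_right be_sym[OF Z_central] p)
  also have "\<dots> = positive (u' @ v') @ Z (negatives (u @ v))"
    by (simp add: positive_append negatives_append Z_add)
  finally show ?case .
qed simp

theorem braid_monoid_embeds:
  assumes "pos_word u \<approx>\<^sub>g pos_word v" "set u \<subseteq> S" shows "u \<sim> v"
proof -
  have "set (pos_word u) \<subseteq> S \<times> UNIV" using assms(2) by auto
  from positive_cong[OF assms(1) this] show ?thesis by (simp add: positive_pos)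
qed

lemma fraction_exists:
  assumes J: "J \<subseteq> S" shows "set \<gamma> \<subseteq> J \<times> UNIV \<Longrightarrow> \<exists>p q. set p \<subseteq> J \<and> set q \<subseteq> J \<and> \<gamma> @ pos_word q \<approx>\<^sub>g pos_word p"
proof (induct \<gamma>)
  case Nil then show ?case by (intro exI[of _ "[]"]) simp
next
  case (Cons l \<gamma>)
  obtain s e where l: "l = (s, e)" "s \<in> J" using Cons by (cases l) auto
  obtain p q where pq: "set p \<subseteq> J" "set q \<subseteq> J" "\<gamma> @ pos_word q \<approx>\<^sub>g pos_word p" using Cons by auto
  show ?case
  proof (cases e)
    case True
    then have "(l # \<gamma>) @ pos_word q \<approx>\<^sub>g pos_word (s # p)"
      using ge_left[OF pq(3), of "[(s, True)]"] l by simp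
    then show ?thesis using pq l by (intro exI[of _ "s # p"] exI[of _ q]) simp
  next
    case False
    obtain c d where cd: "set c \<subseteq> J" "set d \<subseteq> J" "p @ c \<sim> [s] @ d"
      using common_right_multiple[OF J pq(1), of "[s]"] l by auto
    have "(l # \<gamma>) @ pos_word (q @ c) = [l] @ (\<gamma> @ pos_word q) @ pos_word c" by simp
    also have "\<dots> \<approx>\<^sub>g [l] @ pos_word p @ pos_word c" by (intro ge_left ge_right pq(3))
    also have "\<dots> = [l] @ pos_word (p @ c)" by simp
    also have "\<dots> \<approx>\<^sub>g [l] @ pos_word ([s] @ d)" by (intro ge_left ge_pos cd(3))
    also have "\<dots> = [(s, False), (s, \<not> False)] @ pos_word d" using l False by simp
    also have "\<dots> \<approx>\<^sub>g [] @ pos_word d"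
      using l J by (intro ge_right word_cong.rel) (auto simp: group_relations_def)
    finally show ?thesis using pq cd by (intro exI[of _ d] exI[of _ "q @ c"]) simp
  qed
qed

lemma reduced_fraction:
  assumes J: "J \<subseteq> S" and \<gamma>: "set \<gamma> \<subseteq> J \<times> UNIV"
  obtains p q where "set p \<subseteq> J" "set q \<subseteq> J" "\<gamma> @ pos_word q \<approx>\<^sub>g pos_word p"
    "\<And>e. rdiv e q \<Longrightarrow> rdiv e p \<Longrightarrow> e = []"
proof -
  define F where "F q \<longleftrightarrow> (\<exists>p. set p \<subseteq> J \<and> set q \<subseteq> J \<and> \<gamma> @ pos_word q \<approx>\<^sub>g pos_word p)" for q
  have "\<exists>q. F q" using fraction_exists[OF J \<gamma>] by (auto simp: F_def)
  then obtain q where q: "F q" "\<And>q'. F q' \<Longrightarrow> length q \<le> length q'"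
    using ex_has_least_nat[of F _ length] by blast
  then obtain p where p: "set p \<subseteq> J" "set q \<subseteq> J" "\<gamma> @ pos_word q \<approx>\<^sub>g pos_word p" by (auto simp: F_def)
  have "e = []" if e: "rdiv e q" "rdiv e p" for e
  proof -
    obtain a b where ab: "q \<sim> a @ e" "p \<sim> b @ e" using e by (auto simp: rdiv_def)
    have sets: "set a \<subseteq> J" "set b \<subseteq> J" "set e \<subseteq> J" using be_set[OF ab(1)] be_set[OF ab(2)] p by auto
    have "(\<gamma> @ pos_word a) @ pos_word e = \<gamma> @ pos_word (a @ e)" by simp
    also have "\<dots> \<approx>\<^sub>g \<gamma> @ pos_word q" by (rule ge_left[OF ge_pos[OF be_sym[OF ab(1)]]])
    also have "\<dots> \<approx>\<^sub>g pos_word p" by (rule p(3))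
    also have "\<dots> \<approx>\<^sub>g pos_word (b @ e)" by (rule ge_pos[OF ab(2)])
    also have "\<dots> = pos_word b @ pos_word e" by simp
    finally have "\<gamma> @ pos_word a \<approx>\<^sub>g pos_word b" by (rule ge_cancel_right) (use sets J in auto)
    then have "F a" using sets by (auto simp: F_def)
    then have "length q \<le> length a" by (rule q(2))
    then show ?thesis using be_length[OF ab(1)] by simp
  qed
  then show thesis using that p by blast
qed

text \<open>A braid group element conjugating simple braids does so through a third simple braid, by positive
  braids on both sides.\<close>

lemma conjugate_through_simple:
  assumes \<phi>: "diag \<phi>" and J: "J \<subseteq> S" and \<gamma>: "set \<gamma> \<subseteq> J \<times> UNIV" and x: "reduced x" and x': "reduced x'"
    and eq: "map (apfst \<phi>) \<gamma> @ pos_word x \<approx>\<^sub>g pos_word x' @ \<gamma>"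
  obtains k p q where "reduced k" "set p \<subseteq> J" "set q \<subseteq> J" "map \<phi> q @ k \<sim> x @ q" "map \<phi> p @ k \<sim> x' @ p"
proof -
  obtain p q where pq: "set p \<subseteq> J" "set q \<subseteq> J" "\<gamma> @ pos_word q \<approx>\<^sub>g pos_word p"
    "\<And>e. rdiv e q \<Longrightarrow> rdiv e p \<Longrightarrow> e = []" using reduced_fraction[OF J \<gamma>] by metis
  have S: "set p \<subseteq> S" "set q \<subseteq> S" "set x \<subseteq> S" "set x' \<subseteq> S" using pq J x x' by blast+
  have \<phi>S: "set (map \<phi> p) \<subseteq> S" "set (map \<phi> q) \<subseteq> S" using diag_set[OF \<phi>] S by simp_all
  obtain f h where fh: "set f \<subseteq> S" "set h \<subseteq> S" "f @ map \<phi> q \<sim> h @ map \<phi> p"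
    using common_left_multiple[OF \<phi>S(2,1)] by blast
  let ?\<Gamma> = "map (apfst \<phi>) \<gamma>"
  have \<gamma>S: "set (\<gamma> @ pos_word q) \<subseteq> S \<times> UNIV" using \<gamma> J S by auto
  have fp: "map (apfst \<phi>) (pos_word a) = pos_word (map \<phi> a)" for a by simp
  have \<Gamma>q: "?\<Gamma> @ pos_word (map \<phi> q) \<approx>\<^sub>g pos_word (map \<phi> p)"
    using diag_group_map[OF \<phi> pq(3) \<gamma>S] unfolding map_append fp .
  have "pos_word f @ pos_word (map \<phi> q) = pos_word (f @ map \<phi> q)" by simp
  also have "\<dots> \<approx>\<^sub>g pos_word (h @ map \<phi> p)" by (rule ge_pos[OF fh(3)])
  also have "\<dots> = pos_word h @ pos_word (map \<phi> p)" by simp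
  also have "\<dots> \<approx>\<^sub>g pos_word h @ ?\<Gamma> @ pos_word (map \<phi> q)" by (rule ge_left[OF ge_sym[OF \<Gamma>q]])
  also have "\<dots> = (pos_word h @ ?\<Gamma>) @ pos_word (map \<phi> q)" by simp
  finally have f: "pos_word f \<approx>\<^sub>g pos_word h @ ?\<Gamma>" by (rule ge_cancel_right) (use \<phi>S in auto)
  have "pos_word (f @ x @ q) = pos_word f @ pos_word x @ pos_word q" by simp
  also have "\<dots> \<approx>\<^sub>g (pos_word h @ ?\<Gamma>) @ pos_word x @ pos_word q" by (rule ge_right[OF f])
  also have "\<dots> = pos_word h @ (?\<Gamma> @ pos_word x) @ pos_word q" by simp
  also have "\<dots> \<approx>\<^sub>g pos_word h @ (pos_word x' @ \<gamma>) @ pos_word q" by (rule ge_left[OF ge_right[OF eq]])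
  also have "\<dots> = (pos_word h @ pos_word x') @ \<gamma> @ pos_word q" by simp
  also have "\<dots> \<approx>\<^sub>g (pos_word h @ pos_word x') @ pos_word p" by (rule ge_left[OF pq(3)])
  also have "\<dots> = pos_word (h @ x' @ p)" by simp
  finally have "f @ x @ q \<sim> h @ x' @ p" by (rule braid_monoid_embeds) (use fh S in simp)
  from simple_between[OF \<phi> S(2,1) x x' fh this pq(4)]
  obtain k where "reduced k" "map \<phi> q @ k \<sim> x @ q" "map \<phi> p @ k \<sim> x' @ p" .
  then show thesis by (rule that[OF _ pq(1,2)])
qed

end

section \<open>Twisted braids\<close>

locale finite_twisted = twisted G S \<Omega> + finite_coxeter G S
  for G :: "('a, 'z) monoid_scheme" (structure) and S :: "'a set" and \<Omega> :: "('a \<Rightarrow> 'a) set"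

context twisted
begin

declare Omega_mult [simp del] Omega_closed [simp del] Omega_one [simp del] Omega_inv [simp del]
  Omega_S_closed [simp del] Omega_set [simp del] Omega_lp [simp del] Omega_len [simp del]

abbreviation R :: "('a list \<times> 'a list) set" where "R \<equiv> braid_relations G S"
abbreviation cl :: "'a list \<Rightarrow> 'a list set" where "cl \<equiv> word_class R"
abbreviation gcl :: "('a \<times> bool) list \<Rightarrow> ('a \<times> bool) list set" where "gcl \<equiv> word_class (group_relations S R)"

lemma K_inv_diag: "\<delta> \<in> \<Omega> \<Longrightarrow> diag (inv\<^bsub>K\<^esub> \<delta>)"
  by (rule Omega_diag) simp

lemma cl_image: assumes d: "\<delta> \<in> \<Omega>" and u: "set u \<subseteq> S" shows "map \<delta> ` cl u = cl (map \<delta> u)"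
proof (rule map_word_class[where g = "inv\<^bsub>K\<^esub> \<delta>" and A = S])
  show "\<delta> a \<in> S" if "a \<in> S" for a using diag_S[OF Omega_diag[OF d] that] .
  show "(inv\<^bsub>K\<^esub> \<delta>) (\<delta> a) = a" "\<delta> ((inv\<^bsub>K\<^esub> \<delta>) a) = a" if "a \<in> S" for a using d that by simp_all
qed (use be_set u diag_map_cong[OF Omega_diag[OF d]] diag_map_cong[OF K_inv_diag[OF d]] in auto)

lemma gcl_image: assumes d: "\<delta> \<in> \<Omega>" and u: "set u \<subseteq> S \<times> UNIV"
  shows "map (apfst \<delta>) ` gcl u = gcl (map (apfst \<delta>) u)"
proof (rule map_word_class[where g = "apfst (inv\<^bsub>K\<^esub> \<delta>)" and A = "S \<times> UNIV"])
  show "apfst \<delta> a \<in> S \<times> UNIV" if "a \<in> S \<times> UNIV" for a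
    using diag_S[OF Omega_diag[OF d]] that by (cases a) auto
  show "apfst (inv\<^bsub>K\<^esub> \<delta>) (apfst \<delta> a) = a" "apfst \<delta> (apfst (inv\<^bsub>K\<^esub> \<delta>) a) = a" if "a \<in> S \<times> UNIV" for a
    using d that by (cases a; simp)+
qed (use ge_set u diag_group_map[OF Omega_diag[OF d]] diag_group_map[OF K_inv_diag[OF d]] in auto)

lemma Br_plus_mult:
  assumes "\<epsilon> \<in> \<Omega>" "set u \<subseteq> S"
  shows "(\<delta>, cl u) \<otimes>\<^bsub>Br_plus G S \<Omega>\<^esub> (\<epsilon>, cl v) = (\<delta> \<otimes>\<^bsub>K\<^esub> \<epsilon>, cl (map (inv\<^bsub>K\<^esub> \<epsilon>) u @ v))"
  using assms by (simp add: Br_plus_def semidirect_simps cl_image pres_mult)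

lemma Br_mult:
  assumes "\<epsilon> \<in> \<Omega>" "set u \<subseteq> S \<times> UNIV"
  shows "(\<delta>, gcl u) \<otimes>\<^bsub>Br G S \<Omega>\<^esub> (\<epsilon>, gcl v) = (\<delta> \<otimes>\<^bsub>K\<^esub> \<epsilon>, gcl (map (apfst (inv\<^bsub>K\<^esub> \<epsilon>)) u @ v))"
  using assms by (simp add: Br_def semidirect_simps gcl_image pres_group_def pres_mult)

lemma map_one: "set u \<subseteq> S \<Longrightarrow> map \<one>\<^bsub>K\<^esub> u = u"
  by (rule map_idI) auto

lemma map_apfst_one: "set u \<subseteq> S \<times> UNIV \<Longrightarrow> map (apfst \<one>\<^bsub>K\<^esub>) u = u"
  by (rule map_idI) auto

lemma N_carrier: "carrier (pres_group S R) = {gcl u | u. set u \<subseteq> S \<times> UNIV}"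
  unfolding pres_group_def by (rule pres_carrier)

lemma N_mult: "gcl u \<otimes>\<^bsub>pres_group S R\<^esub> gcl v = gcl (u @ v)"
  unfolding pres_group_def by (rule pres_mult)

lemma apfst_set: "\<delta> \<in> \<Omega> \<Longrightarrow> set u \<subseteq> S \<times> UNIV \<Longrightarrow> set (map (apfst \<delta>) u) \<subseteq> S \<times> UNIV"
  using diag_S[OF Omega_diag] by auto

sublocale Br: group "Br G S \<Omega>"
  unfolding Br_def
proof (rule semidirect_group)
  show "group K" by (rule K.group_axioms)
  show "group (pres_group S R)" by (rule pres_group_group)
next
  fix k x assume "k \<in> carrier K" "x \<in> carrier (pres_group S R)"
  then obtain u where "k \<in> \<Omega>" "x = gcl u" "set u \<subseteq> S \<times> UNIV" unfolding N_carrier K_carrier by blast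
  then show "map (apfst k) ` x \<in> carrier (pres_group S R)"
    unfolding N_carrier using gcl_image apfst_set by blast
next
  fix k x y assume "k \<in> carrier K" "x \<in> carrier (pres_group S R)" "y \<in> carrier (pres_group S R)"
  then obtain u v where uv: "k \<in> \<Omega>" "x = gcl u" "set u \<subseteq> S \<times> UNIV" "y = gcl v" "set v \<subseteq> S \<times> UNIV"
    unfolding N_carrier K_carrier by blast
  have "set (u @ v) \<subseteq> S \<times> UNIV" using uv by simp
  then show "map (apfst k) ` (x \<otimes>\<^bsub>pres_group S R\<^esub> y) =
      map (apfst k) ` x \<otimes>\<^bsub>pres_group S R\<^esub> map (apfst k) ` y"
    unfolding uv(2,4) N_mult using gcl_image[OF uv(1)] uv(3,5) by (simp add: N_mult)
next
  fix k l x assume "k \<in> carrier K" "l \<in> carrier K" "x \<in> carrier (pres_group S R)"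
  then obtain u where u: "k \<in> \<Omega>" "l \<in> \<Omega>" "x = gcl u" "set u \<subseteq> S \<times> UNIV"
    unfolding N_carrier K_carrier by blast
  have kl: "k \<otimes>\<^bsub>K\<^esub> l \<in> \<Omega>" using K.m_closed u by simp
  have e: "map (apfst (k \<otimes>\<^bsub>K\<^esub> l)) u = map (apfst k) (map (apfst l) u)"
    using u by (auto simp: subset_iff)
  show "map (apfst (k \<otimes>\<^bsub>K\<^esub> l)) ` x = map (apfst k) ` map (apfst l) ` x"
    unfolding u(3) gcl_image[OF kl u(4)] gcl_image[OF u(2,4)] gcl_image[OF u(1) apfst_set[OF u(2,4)]] e ..
next
  fix x assume "x \<in> carrier (pres_group S R)"
  then obtain u where u: "x = gcl u" "set u \<subseteq> S \<times> UNIV" unfolding N_carrier by blast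
  then show "map (apfst \<one>\<^bsub>K\<^esub>) ` x = x" using gcl_image[OF K_one_in u(2)] map_apfst_one[OF u(2)] by simp
qed

lemma Br_carrier: "carrier (Br G S \<Omega>) = \<Omega> \<times> {gcl u | u. set u \<subseteq> S \<times> UNIV}"
  by (simp add: Br_def semidirect_simps N_carrier)

lemma Br_one: "\<one>\<^bsub>Br G S \<Omega>\<^esub> = (\<one>\<^bsub>K\<^esub>, gcl [])"
  by (simp add: Br_def semidirect_simps pres_group_def pres_one)

lemma Br_inv_untwisted:
  assumes u: "set u \<subseteq> S \<times> UNIV"
  shows "inv\<^bsub>Br G S \<Omega>\<^esub> (\<one>\<^bsub>K\<^esub>, gcl u) = (\<one>\<^bsub>K\<^esub>, gcl (word_inverse u))"
proof (rule Br.inv_equality)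
  note wi = word_inverse_set[OF u]
  have "map (apfst (inv\<^bsub>K\<^esub> \<one>\<^bsub>K\<^esub>)) (word_inverse u) = word_inverse u" using map_apfst_one[OF wi] by simp
  then show "(\<one>\<^bsub>K\<^esub>, gcl (word_inverse u)) \<otimes>\<^bsub>Br G S \<Omega>\<^esub> (\<one>\<^bsub>K\<^esub>, gcl u) = \<one>\<^bsub>Br G S \<Omega>\<^esub>"
    using Br_mult[OF K_one_in wi] ge_inverse(2)[OF u] by (simp add: Br_one word_class_eq)
qed (use u word_inverse_set[OF u] in \<open>auto simp: Br_carrier\<close>)

lemma braid_plus_rw: "braid_plus G S w = (fst w, cl (rw (snd w)))"
  by (simp add: braid_plus_def rw_def)

lemma braid_rw: "braid G S w = (fst w, gcl (pos_word (rw (snd w))))"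
  by (simp add: braid_def rw_def)

lemma pos_set: "set u \<subseteq> J \<Longrightarrow> set (pos_word u) \<subseteq> J \<times> UNIV" by auto

lemma braid_closed: assumes "w \<in> carrier W" shows "braid G S w \<in> carrier (Br G S \<Omega>)"
proof -
  have "fst w \<in> \<Omega>" "snd w \<in> carrier G" using assms by (auto simp: W_carrier)
  then show ?thesis unfolding braid_rw Br_carrier using pos_set[OF rw_set] by blast
qed

text \<open>Lifting to braids is multiplicative when lengths add up, by Matsumoto's theorem.\<close>

lemma braid_mult:
  assumes v: "v \<in> carrier W" and w: "w \<in> carrier W" and l: "tlen (v \<otimes>\<^bsub>W\<^esub> w) = tlen v + tlen w"
  shows "braid G S v \<otimes>\<^bsub>Br G S \<Omega>\<^esub> braid G S w = braid G S (v \<otimes>\<^bsub>W\<^esub> w)"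
proof -
  obtain \<delta> x \<epsilon> y where e: "v = (\<delta>, x)" "w = (\<epsilon>, y)" "\<delta> \<in> \<Omega>" "\<epsilon> \<in> \<Omega>" "x \<in> carrier G" "y \<in> carrier G"
    using v w by (auto simp: W_carrier)
  let ?\<phi> = "inv\<^bsub>K\<^esub> \<epsilon>"
  note [simp] = diag_rules[OF K_inv_diag[OF e(4)]]
  have de: "\<delta> \<otimes>\<^bsub>K\<^esub> \<epsilon> \<in> \<Omega>" using e K.m_closed by simp
  have "len (?\<phi> x \<otimes> y) = len x + len y"
    using l e de by (simp add: W_mult tl_len)
  then have l': "len (?\<phi> x \<otimes> y) = len (?\<phi> x) + len y" using e by simp
  have "rw (?\<phi> x) @ rw y \<sim> rw (?\<phi> x \<otimes> y)" using rw_mult[OF _ e(6) l'] e by simp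
  moreover have "map ?\<phi> (rw x) \<sim> rw (?\<phi> x)"
  proof -
    have "lp (map ?\<phi> (rw x)) = ?\<phi> x" using e by simp
    moreover have "reduced (map ?\<phi> (rw x))" using diag_reduced[OF K_inv_diag[OF e(4)] rw_set[OF e(5)]] rw(1)[OF e(5)] by blast
    ultimately show ?thesis using matsumoto[of "map ?\<phi> (rw x)" "rw (?\<phi> x)"] rw[of "?\<phi> x"] e by simp
  qed
  ultimately have "map ?\<phi> (rw x) @ rw y \<sim> rw (?\<phi> x \<otimes> y)" using be_trans be_right by blast
  from ge_pos[OF this] have "map (apfst ?\<phi>) (pos_word (rw x)) @ pos_word (rw y) \<approx>\<^sub>g pos_word (rw (?\<phi> x \<otimes> y))"
    by (simp add: o_def)
  then show ?thesis using Br_mult[OF e(4) pos_set[OF rw_set[OF e(5)]]] e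
    by (simp add: braid_rw W_mult word_class_eq)
qed

lemma Br_sub_carrier: "Br_sub G S \<Omega> P \<subseteq> carrier (Br G S \<Omega>)" "subgroup (Br_sub G S \<Omega> P) (Br G S \<Omega>)"
proof -
  have "(\<lambda>s. (\<one>\<^bsub>AutoGroup G\<^esub>, gcl [(s, True)])) ` (S \<inter> P) \<subseteq> carrier (Br G S \<Omega>)"
    unfolding Br_carrier K_one[symmetric] by (auto intro!: exI[of _ "[(_, True)]"])
  then show "Br_sub G S \<Omega> P \<subseteq> carrier (Br G S \<Omega>)" "subgroup (Br_sub G S \<Omega> P) (Br G S \<Omega>)"
    unfolding Br_sub_def by (rule Br.generate_incl, rule Br.generate_is_subgroup)
qed

lemma Br_sub_word:
  assumes "set u \<subseteq> S \<inter> P" shows "(\<one>\<^bsub>K\<^esub>, gcl (pos_word u)) \<in> Br_sub G S \<Omega> P"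
  using assms
proof (induct u)
  case Nil
  then show ?case using generate.one[of "Br G S \<Omega>"] by (simp add: Br_sub_def Br_one)
next
  case (Cons s u)
  have "(\<one>\<^bsub>K\<^esub>, gcl [(s, True)]) \<in> Br_sub G S \<Omega> P"
    unfolding Br_sub_def K_one using Cons by (intro generate.incl) auto
  then have "(\<one>\<^bsub>K\<^esub>, gcl [(s, True)]) \<otimes>\<^bsub>Br G S \<Omega>\<^esub> (\<one>\<^bsub>K\<^esub>, gcl (pos_word u)) \<in> Br_sub G S \<Omega> P"
    using Cons unfolding Br_sub_def by (intro generate.eng) auto
  moreover have s: "set [(s, True)] \<subseteq> S \<times> UNIV" using Cons by simp
  have "map (apfst (inv\<^bsub>K\<^esub> \<one>\<^bsub>K\<^esub>)) [(s, True)] = [(s, True)]" using map_apfst_one[OF s] by simp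
  then have "(\<one>\<^bsub>K\<^esub>, gcl [(s, True)]) \<otimes>\<^bsub>Br G S \<Omega>\<^esub> (\<one>\<^bsub>K\<^esub>, gcl (pos_word u)) = (\<one>\<^bsub>K\<^esub>, gcl (pos_word (s # u)))"
    using Br_mult[OF K_one_in s] by simp
  ultimately show ?case by simp
qed

lemma Br_sub_elem:
  assumes "g \<in> Br_sub G S \<Omega> P" obtains \<gamma> where "set \<gamma> \<subseteq> (S \<inter> P) \<times> UNIV" "g = (\<one>\<^bsub>K\<^esub>, gcl \<gamma>)"
proof -
  have "\<exists>\<gamma>. set \<gamma> \<subseteq> (S \<inter> P) \<times> UNIV \<and> g = (\<one>\<^bsub>K\<^esub>, gcl \<gamma>)"
    using assms unfolding Br_sub_def
  proof induct
    case one then show ?case by (intro exI[of _ "[]"]) (simp add: Br_one)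
  next
    case (incl h)
    then obtain s where "s \<in> S \<inter> P" "h = (\<one>\<^bsub>K\<^esub>, gcl [(s, True)])" by (auto simp: K_one)
    then show ?case by (intro exI[of _ "[(s, True)]"]) simp
  next
    case (inv h)
    then obtain s where s: "s \<in> S \<inter> P" "h = (\<one>\<^bsub>K\<^esub>, gcl [(s, True)])" by (auto simp: K_one)
    have "set [(s, True)] \<subseteq> S \<times> UNIV" using s by simp
    from Br_inv_untwisted[OF this] show ?case using s
      by (intro exI[of _ "[(s, False)]"]) (simp add: word_inverse_def)
  next
    case (eng h1 h2)
    then obtain u v where uv: "set u \<subseteq> (S \<inter> P) \<times> UNIV" "h1 = (\<one>\<^bsub>K\<^esub>, gcl u)"
      "set v \<subseteq> (S \<inter> P) \<times> UNIV" "h2 = (\<one>\<^bsub>K\<^esub>, gcl v)" by blast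
    then have u: "set u \<subseteq> S \<times> UNIV" by blast
    have "map (apfst (inv\<^bsub>K\<^esub> \<one>\<^bsub>K\<^esub>)) u = u" using map_apfst_one[OF u] by simp
    then show ?case using Br_mult[OF K_one_in u] uv by (intro exI[of _ "u @ v"]) simp
  qed
  then show thesis using that by blast
qed

lemma Br_plus_sub_elem:
  assumes "g \<in> Br_plus_sub G S \<Omega> P" obtains t where "set t \<subseteq> S \<inter> P" "g = (\<one>\<^bsub>K\<^esub>, cl t)"
proof -
  let ?H = "{(\<one>\<^bsub>K\<^esub>, cl t) | t. set t \<subseteq> S \<inter> P}"
  have mult: "(\<one>\<^bsub>K\<^esub>, cl u) \<otimes>\<^bsub>Br_plus G S \<Omega>\<^esub> (\<one>\<^bsub>K\<^esub>, cl v) = (\<one>\<^bsub>K\<^esub>, cl (u @ v))" if "set u \<subseteq> S" for u v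
    using Br_plus_mult[OF K_one_in that] map_one[OF that] by simp
  have "submonoid ?H (Br_plus G S \<Omega>)"
  proof
    show "?H \<subseteq> carrier (Br_plus G S \<Omega>)"
      by (auto simp: Br_plus_def semidirect_simps pres_carrier)
    show "\<one>\<^bsub>Br_plus G S \<Omega>\<^esub> \<in> ?H"
      by (auto simp: Br_plus_def semidirect_simps pres_one intro: exI[of _ "[]"])
    fix x y assume "x \<in> ?H" "y \<in> ?H"
    then obtain u v where uv: "x = (\<one>\<^bsub>K\<^esub>, cl u)" "set u \<subseteq> S \<inter> P" "y = (\<one>\<^bsub>K\<^esub>, cl v)" "set v \<subseteq> S \<inter> P" by blast
    then have "x \<otimes>\<^bsub>Br_plus G S \<Omega>\<^esub> y = (\<one>\<^bsub>K\<^esub>, cl (u @ v))" "set (u @ v) \<subseteq> S \<inter> P" using mult[of u v] by auto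
    then show "x \<otimes>\<^bsub>Br_plus G S \<Omega>\<^esub> y \<in> ?H" by blast
  qed
  moreover have "(\<lambda>s. (\<one>\<^bsub>AutoGroup G\<^esub>, cl [s])) ` (S \<inter> P) \<subseteq> ?H"
    unfolding K_one[symmetric] by (auto intro!: exI[of _ "[_]"])
  ultimately have "g \<in> ?H" using assms unfolding Br_plus_sub_def monoid_generate_def by blast
  then show thesis using that by blast
qed

section \<open>Sequences of mixed shifts\<close>

lemma tran_prepend:
  assumes "(\<tau>s, v) \<in> tran_mixed G S \<Omega> P w1" "\<tau> \<in> P" "mixed_step G S \<Omega> \<tau> w w1"
  shows "(\<tau>s @ [\<tau>], v) \<in> tran_mixed G S \<Omega> P w"
  using assms(1)
proof induct
  case Nil then show ?case using tran_mixed.Cons[OF tran_mixed.Nil assms(2,3)] by simp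
next
  case (Cons \<tau>s v \<tau>' v')
  then show ?case using tran_mixed.Cons by fastforce
qed

lemma tran_append:
  assumes "(\<sigma>s, u) \<in> tran_mixed G S \<Omega> P v" "(\<tau>s, v) \<in> tran_mixed G S \<Omega> P w"
  shows "(\<sigma>s @ \<tau>s, u) \<in> tran_mixed G S \<Omega> P w"
  using assms(1) by induct (use assms(2) tran_mixed.Cons in fastforce)+

lemma tran_reverse:
  assumes "(\<tau>s, v) \<in> tran_mixed G S \<Omega> P w" and P: "subgroup P G" and w: "w \<in> carrier W"
  shows "v \<in> carrier W \<and> (\<exists>\<sigma>s. (\<sigma>s, w) \<in> tran_mixed G S \<Omega> P v)"
  using assms(1)
proof induct
  case Nil then show ?case using w tran_mixed.Nil by blast
next
  case (Cons \<tau>s v \<tau> v')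
  have \<tau>: "\<tau> \<in> carrier G" using Cons P subgroup.mem_carrier by metis
  have "mixed_step G S \<Omega> (inv \<tau>) v' v" using mixed_step_sym Cons \<tau> by blast
  moreover have "inv \<tau> \<in> P" using subgroup.m_inv_closed[OF P] Cons by blast
  ultimately show ?case using Cons tran_prepend mixed_step_closed[of v \<tau> v'] \<tau> by blast
qed

lemma mixed_step_intro:
  assumes d: "\<delta> \<in> \<Omega>" and c: "c \<in> carrier G" "x \<in> carrier G" "y \<in> carrier G"
    and eq: "(inv\<^bsub>K\<^esub> \<delta>) c \<otimes> x = y \<otimes> c" and l: "len x = len y"
    and shift: "len ((inv\<^bsub>K\<^esub> \<delta>) c \<otimes> x) = len x + len c \<or> len (x \<otimes> inv c) + len c = len x"
  shows "mixed_step G S \<Omega> c (\<delta>, x) (\<delta>, y)"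
proof -
  note [simp] = diag_rules[OF K_inv_diag[OF d]]
  have u: "untwisted G c = (\<one>\<^bsub>K\<^esub>, c)" by (simp add: untwisted_def K_one)
  have ui: "inv\<^bsub>W\<^esub> (\<one>\<^bsub>K\<^esub>, c) = (\<one>\<^bsub>K\<^esub>, inv c)" using W_inv[OF K_one_in c(1)] c by simp
  have tw: "(\<one>\<^bsub>K\<^esub>, c) \<otimes>\<^bsub>W\<^esub> (\<delta>, x) = (\<delta>, (inv\<^bsub>K\<^esub> \<delta>) c \<otimes> x)" using d by (simp add: W_mult)
  have wt: "(\<delta>, z) \<otimes>\<^bsub>W\<^esub> (\<one>\<^bsub>K\<^esub>, inv c) = (\<delta>, z \<otimes> inv c)" if "z \<in> carrier G" for z
    using d that by (simp add: W_mult)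
  have "y = (inv\<^bsub>K\<^esub> \<delta>) c \<otimes> x \<otimes> inv c" unfolding eq using c by (simp add: m_assoc)
  moreover have "(inv\<^bsub>K\<^esub> \<delta>) c \<otimes> x \<in> carrier G" using c by simp
  ultimately show ?thesis using shift l d c
    unfolding mixed_step_def strong_conj_step_def cyclic_shift_step_def Let_def u ui tw
    by (simp add: wt tl_len) blast
qed

text \<open>Read in the braid group, a mixed shift by \<open>\<tau>\<close> is conjugation by the lift of \<open>\<tau>\<close> or by the inverse
  of the lift of \<open>\<tau>\<inverse>\<close>, depending on the side from which \<open>\<tau>\<close> is multiplied.\<close>

lemma mixed_step_braid:
  assumes w: "w \<in> carrier W" and \<tau>: "\<tau> \<in> generate G J" and J: "J \<subseteq> S" and P: "J \<subseteq> P"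
    and st: "mixed_step G S \<Omega> \<tau> w w'"
  shows "\<exists>g\<in>Br_sub G S \<Omega> P. g \<otimes>\<^bsub>Br G S \<Omega>\<^esub> braid G S w = braid G S w' \<otimes>\<^bsub>Br G S \<Omega>\<^esub> g"
proof -
  let ?b = "braid G S" and ?t = "untwisted G \<tau>"
  have JG: "J \<subseteq> carrier G" using J S_carrier by blast
  have \<tau>c: "\<tau> \<in> carrier G" using \<tau> generate_in_carrier[OF JG] by blast
  have t: "?t \<in> carrier W" using \<tau>c by simp
  have lift: "?b (untwisted G \<rho>) \<in> Br_sub G S \<Omega> P" if \<rho>: "\<rho> \<in> generate G J" for \<rho>
  proof -
    obtain u where u: "reduced u" "set u \<subseteq> J" "lp u = \<rho>" using parabolic_reduced[OF J \<rho>] by metis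
    have "set (rw \<rho>) = set u" using be_set[OF rw_eq[OF u(1)]] u(3) by simp
    then have "set (rw \<rho>) \<subseteq> S \<inter> P" using u(2) J P by blast
    from Br_sub_word[OF this] show ?thesis by (simp add: braid_rw untwisted_def K_one)
  qed
  have w': "w' = ?t \<otimes>\<^bsub>W\<^esub> w \<otimes>\<^bsub>W\<^esub> inv\<^bsub>W\<^esub> ?t" and l: "tlen w' = tlen w"
    and sh: "strong_conj_step G S \<Omega> \<tau> w \<or> cyclic_shift_step G S \<Omega> \<tau> w"
    using st by (auto simp: mixed_step_def)
  have w'c: "w' \<in> carrier W" using w' w t by simp
  let ?ti = "inv\<^bsub>W\<^esub> ?t"
  have ti: "?ti \<in> carrier W" "tlen ?ti = tlen ?t" using t tl_inv by simp_all
  have a: "w' \<otimes>\<^bsub>W\<^esub> ?t = ?t \<otimes>\<^bsub>W\<^esub> w" "?ti \<otimes>\<^bsub>W\<^esub> w' = w \<otimes>\<^bsub>W\<^esub> ?ti"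
    unfolding w' using w t by (simp_all add: W.m_assoc)
  have bt: "?b ?t \<in> Br_sub G S \<Omega> P" using lift \<tau> .
  have "inv \<tau> \<in> generate G J" using generate_m_inv_closed[OF JG \<tau>] .
  from lift[OF this] have bti: "?b ?ti \<in> Br_sub G S \<Omega> P" by (simp add: untwisted_inv \<tau>c)
  have left: ?thesis if "?b ?t \<otimes>\<^bsub>Br G S \<Omega>\<^esub> ?b w = ?b w' \<otimes>\<^bsub>Br G S \<Omega>\<^esub> ?b ?t"
    using that bt by blast
  have right: ?thesis if e: "?b w \<otimes>\<^bsub>Br G S \<Omega>\<^esub> ?b ?ti = ?b ?ti \<otimes>\<^bsub>Br G S \<Omega>\<^esub> ?b w'"
  proof (rule bexI)
    let ?g = "inv\<^bsub>Br G S \<Omega>\<^esub> (?b ?ti)"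
    have c: "?b ?ti \<in> carrier (Br G S \<Omega>)" "?b w \<in> carrier (Br G S \<Omega>)" "?b w' \<in> carrier (Br G S \<Omega>)"
      using braid_closed ti w w'c by blast+
    have "?g \<otimes>\<^bsub>Br G S \<Omega>\<^esub> ?b w = ?g \<otimes>\<^bsub>Br G S \<Omega>\<^esub> (?b w \<otimes>\<^bsub>Br G S \<Omega>\<^esub> ?b ?ti) \<otimes>\<^bsub>Br G S \<Omega>\<^esub> ?g"
      using c by (simp add: Br.m_assoc)
    also have "\<dots> = (?g \<otimes>\<^bsub>Br G S \<Omega>\<^esub> ?b ?ti) \<otimes>\<^bsub>Br G S \<Omega>\<^esub> ?b w' \<otimes>\<^bsub>Br G S \<Omega>\<^esub> ?g"
      unfolding e using c by (simp only: Br.m_assoc Br.m_closed Br.inv_closed)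
    also have "\<dots> = ?b w' \<otimes>\<^bsub>Br G S \<Omega>\<^esub> ?g" using c by simp
    finally show "?g \<otimes>\<^bsub>Br G S \<Omega>\<^esub> ?b w = ?b w' \<otimes>\<^bsub>Br G S \<Omega>\<^esub> ?g" .
    show "?g \<in> Br_sub G S \<Omega> P" using subgroup.m_inv_closed[OF Br_sub_carrier(2) bti] .
  qed
  consider (strong_left) "tlen (?t \<otimes>\<^bsub>W\<^esub> w) = tlen w + tlen ?t"
    | (strong_right) "tlen (w \<otimes>\<^bsub>W\<^esub> ?ti) = tlen w + tlen ?t"
    | (shift_left) "tlen (?t \<otimes>\<^bsub>W\<^esub> w) + tlen ?t = tlen w"
    | (shift_right) "tlen (w \<otimes>\<^bsub>W\<^esub> ?ti) + tlen ?t = tlen w"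
    using sh unfolding strong_conj_step_def cyclic_shift_step_def Let_def by blast
  then show ?thesis
  proof cases
    case strong_left
    have "?b ?t \<otimes>\<^bsub>Br G S \<Omega>\<^esub> ?b w = ?b (?t \<otimes>\<^bsub>W\<^esub> w)" using strong_left by (intro braid_mult t w) simp
    also have "\<dots> = ?b w' \<otimes>\<^bsub>Br G S \<Omega>\<^esub> ?b ?t"
      using strong_left l a(1) by (simp add: braid_mult[OF w'c t])
    finally show ?thesis by (rule left)
  next
    case strong_right
    have "?b w \<otimes>\<^bsub>Br G S \<Omega>\<^esub> ?b ?ti = ?b (w \<otimes>\<^bsub>W\<^esub> ?ti)" using strong_right ti by (intro braid_mult w) simp_all
    also have "\<dots> = ?b ?ti \<otimes>\<^bsub>Br G S \<Omega>\<^esub> ?b w'"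
      using strong_right l a(2) ti by (simp add: braid_mult[OF ti(1) w'c])
    finally show ?thesis by (rule right)
  next
    case shift_left
    let ?y = "?t \<otimes>\<^bsub>W\<^esub> w"
    have y: "?y \<in> carrier W" using t w by simp
    have "?b w = ?b ?ti \<otimes>\<^bsub>Br G S \<Omega>\<^esub> ?b ?y"
      using braid_mult[OF ti(1) y] shift_left ti t w by simp
    moreover have "?b w' = ?b ?y \<otimes>\<^bsub>Br G S \<Omega>\<^esub> ?b ?ti"
      using braid_mult[OF y ti(1)] shift_left ti l unfolding w' by simp
    ultimately show ?thesis
      using braid_closed[OF y] braid_closed[OF ti(1)] by (intro right) (simp add: Br.m_assoc)
  next
    case shift_right
    let ?y = "w \<otimes>\<^bsub>W\<^esub> ?ti"
    have y: "?y \<in> carrier W" using t w by simp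
    have "?b w = ?b ?y \<otimes>\<^bsub>Br G S \<Omega>\<^esub> ?b ?t"
      using braid_mult[OF y t] shift_right t w by (simp add: W.m_assoc)
    moreover have "?t \<otimes>\<^bsub>W\<^esub> ?y = w'" unfolding w' using t w by (simp add: W.m_assoc)
    then have "?b w' = ?b ?t \<otimes>\<^bsub>Br G S \<Omega>\<^esub> ?b ?y"
      using braid_mult[OF t y] shift_right l by simp
    ultimately show ?thesis
      using braid_closed[OF y] braid_closed[OF t] by (intro left) (simp add: Br.m_assoc)
  qed
qed

lemma tran_mixed_braid:
  assumes "(\<tau>s, v) \<in> tran_mixed G S \<Omega> (generate G J) w" and J: "J \<subseteq> S" "J \<subseteq> P" and w: "w \<in> carrier W"
  shows "v \<in> carrier W \<and>
    (\<exists>g\<in>Br_sub G S \<Omega> P. g \<otimes>\<^bsub>Br G S \<Omega>\<^esub> braid G S w = braid G S v \<otimes>\<^bsub>Br G S \<Omega>\<^esub> g)"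
  using assms(1)
proof induct
  case Nil
  have "\<one>\<^bsub>Br G S \<Omega>\<^esub> \<in> Br_sub G S \<Omega> P" by (simp add: Br_sub_def generate.one)
  then show ?case using w braid_closed[OF w] by (intro conjI bexI[of _ "\<one>\<^bsub>Br G S \<Omega>\<^esub>"]) simp_all
next
  case (Cons \<tau>s v \<tau> v')
  let ?B = "Br G S \<Omega>" and ?b = "braid G S"
  obtain g where g: "g \<in> Br_sub G S \<Omega> P" "g \<otimes>\<^bsub>?B\<^esub> ?b w = ?b v \<otimes>\<^bsub>?B\<^esub> g" and v: "v \<in> carrier W" using Cons by blast
  obtain h where h: "h \<in> Br_sub G S \<Omega> P" "h \<otimes>\<^bsub>?B\<^esub> ?b v = ?b v' \<otimes>\<^bsub>?B\<^esub> h"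
    using mixed_step_braid[OF v Cons(3) J Cons(4)] by blast
  have "\<tau> \<in> carrier G" using Cons(3) generate_in_carrier[of J \<tau>] J S_carrier by blast
  then have v': "v' \<in> carrier W" using mixed_step_closed[OF v _ Cons(4)] by blast
  have c: "g \<in> carrier ?B" "h \<in> carrier ?B" "?b w \<in> carrier ?B" "?b v \<in> carrier ?B" "?b v' \<in> carrier ?B"
    using Br_sub_carrier(1) g h braid_closed w v v' by blast+
  have "(h \<otimes>\<^bsub>?B\<^esub> g) \<otimes>\<^bsub>?B\<^esub> ?b w = h \<otimes>\<^bsub>?B\<^esub> (?b v \<otimes>\<^bsub>?B\<^esub> g)" using c g by (simp add: Br.m_assoc)
  also have "\<dots> = (h \<otimes>\<^bsub>?B\<^esub> ?b v) \<otimes>\<^bsub>?B\<^esub> g" using c by (simp add: Br.m_assoc)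
  also have "\<dots> = ?b v' \<otimes>\<^bsub>?B\<^esub> (h \<otimes>\<^bsub>?B\<^esub> g)" unfolding h(2) using c by (simp add: Br.m_assoc)
  finally have "(h \<otimes>\<^bsub>?B\<^esub> g) \<otimes>\<^bsub>?B\<^esub> ?b w = ?b v' \<otimes>\<^bsub>?B\<^esub> (h \<otimes>\<^bsub>?B\<^esub> g)" .
  moreover have "h \<otimes>\<^bsub>?B\<^esub> g \<in> Br_sub G S \<Omega> P" using subgroup.m_closed[OF Br_sub_carrier(2)] g h by blast
  ultimately show ?case using v' by blast
qed

end

context finite_twisted
begin

text \<open>Conjugation steps are split off from the braid \<open>t\<close> until nothing is left; their letters stay in \<open>J\<close> because
  braid relations preserve the set of letters.\<close>

theorem tran_exists:
  assumes d: "\<delta> \<in> \<Omega>" and J: "J \<subseteq> S"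
  shows "set t \<subseteq> J \<Longrightarrow> reduced x \<Longrightarrow> reduced x' \<Longrightarrow> map (inv\<^bsub>K\<^esub> \<delta>) t @ x \<sim> x' @ t \<Longrightarrow>
    \<exists>\<tau>s. set \<tau>s \<subseteq> generate G J \<and> (\<tau>s, (\<delta>, lp x')) \<in> tran_mixed G S \<Omega> (generate G J) (\<delta>, lp x) \<and>
      concat (map rw \<tau>s) \<sim> t"
proof (induct "length t" arbitrary: t x rule: less_induct)
  case less
  let ?\<phi> = "inv\<^bsub>K\<^esub> \<delta>" and ?P = "generate G J"
  have \<phi>: "diag ?\<phi>" using K_inv_diag[OF d] .
  have tS: "set t \<subseteq> S" using less.prems J by blast
  show ?case
  proof (cases "t = []")
    case True
    then have "x \<sim> x'" using less.prems by simp
    moreover have "set x \<subseteq> S" using less.prems(2) by blast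
    ultimately have "lp x = lp x'" by (rule be_lp)
    then show ?thesis using True tran_mixed.Nil by (intro exI[of _ "[]"]) simp
  next
    case False
    obtain e c y where *: "t \<sim> e @ c" "c \<noteq> []" "reduced c" "reduced y" "map ?\<phi> e @ y \<sim> x' @ e"
      "map ?\<phi> c @ x \<sim> y @ c" "reduced (map ?\<phi> c @ x) \<or> len (lp x \<otimes> inv (lp c)) + len (lp c) = len (lp x)"
      using conjugation_step[OF \<phi> tS False less.prems(2-4)] by metis
    have ec: "set e \<subseteq> J" "set c \<subseteq> J" using be_set[OF *(1)] less.prems(1) by auto
    have S: "set c \<subseteq> S" "set x \<subseteq> S" "set y \<subseteq> S" using ec J less.prems(2) *(4) by blast+
    note [simp] = diag_rules[OF \<phi>]
    have "length e < length t" using be_length[OF *(1)] *(2) by simp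
    then obtain \<tau>s where \<tau>s: "set \<tau>s \<subseteq> ?P" "(\<tau>s, (\<delta>, lp x')) \<in> tran_mixed G S \<Omega> ?P (\<delta>, lp y)"
      "concat (map rw \<tau>s) \<sim> e" using less.hyps[OF _ ec(1) *(4) less.prems(3) *(5)] by blast
    have cP: "lp c \<in> ?P" using lp_in_generate[OF _ J] ec(2) by (simp add: lists_eq_set)
    have eq: "?\<phi> (lp c) \<otimes> lp x = lp y \<otimes> lp c" using be_lp[OF *(6)] S by simp
    have lx: "length x = len (lp x)" "length y = len (lp y)" "length c = len (lp c)"
      using less.prems(2) *(3,4) by blast+
    have "len (lp x) = len (lp y)" using be_length[OF *(6)] lx by simp
    moreover have "len (?\<phi> (lp c) \<otimes> lp x) = len (lp x) + len (lp c)" if "reduced (map ?\<phi> c @ x)"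
    proof -
      have "length (map ?\<phi> c @ x) = len (lp (map ?\<phi> c @ x))" using that by blast
      moreover have "lp (map ?\<phi> c @ x) = ?\<phi> (lp c) \<otimes> lp x" using S by simp
      ultimately show ?thesis using lx by simp
    qed
    ultimately have "mixed_step G S \<Omega> (lp c) (\<delta>, lp x) (\<delta>, lp y)"
      using *(7) S by (intro mixed_step_intro d eq) auto
    from tran_prepend[OF \<tau>s(2) cP this]
    have "(\<tau>s @ [lp c], (\<delta>, lp x')) \<in> tran_mixed G S \<Omega> ?P (\<delta>, lp x)" .
    moreover have "concat (map rw (\<tau>s @ [lp c])) \<sim> t"
    proof -
      have "concat (map rw (\<tau>s @ [lp c])) = concat (map rw \<tau>s) @ rw (lp c)" by simp
      also have "\<dots> \<sim> e @ c" using \<tau>s(3) rw_eq[OF *(3)] by (rule be_append)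
      also have "\<dots> \<sim> t" using *(1) by (rule be_sym)
      finally show ?thesis .
    qed
    ultimately show ?thesis using \<tau>s(1) cP by (intro exI[of _ "\<tau>s @ [lp c]"]) simp
  qed
qed

lemma lprod_braid_plus:
  assumes "set \<tau>s \<subseteq> carrier G"
  shows "lprod (Br_plus G S \<Omega>) (map (\<lambda>\<tau>. braid_plus G S (untwisted G \<tau>)) \<tau>s) = (\<one>\<^bsub>K\<^esub>, cl (concat (map rw \<tau>s)))"
    (is "?L \<tau>s = _")
  using assms
proof (induct \<tau>s)
  case Nil then show ?case by (simp add: lprod_def Br_plus_def semidirect_simps pres_one)
next
  case (Cons \<tau> \<tau>s)
  have r: "set (rw \<tau>) \<subseteq> S" using Cons by simp
  have "?L (\<tau> # \<tau>s) = (\<one>\<^bsub>K\<^esub>, cl (rw \<tau>)) \<otimes>\<^bsub>Br_plus G S \<Omega>\<^esub> ?L \<tau>s"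
    by (simp add: lprod_def braid_plus_rw untwisted_def K_one)
  also have "\<dots> = (\<one>\<^bsub>K\<^esub>, cl (concat (map rw (\<tau> # \<tau>s))))"
    using Cons Br_plus_mult[OF K_one_in r] map_one[OF r] by simp
  finally show ?case .
qed

context
  fixes J P w w'
  assumes J: "J \<subseteq> S" and P: "P = generate G J" and w: "w \<in> carrier W" and w': "w' \<in> carrier W"
begin

lemma P_letters: "S \<inter> P \<subseteq> S" "J \<subseteq> S \<inter> P" "generate G (S \<inter> P) = P" "P \<subseteq> carrier G" "subgroup P G"
proof -
  have JG: "J \<subseteq> carrier G" using J S_carrier by blast
  show "P \<subseteq> carrier G" "subgroup P G" unfolding P
    using generate_incl[OF JG] generate_is_subgroup[OF JG] .
  show JP: "J \<subseteq> S \<inter> P" unfolding P using J generate.incl[of _ J G] by blast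
  show "S \<inter> P \<subseteq> S" by blast
  show "generate G (S \<inter> P) = P"
  proof
    show "generate G (S \<inter> P) \<subseteq> P" using generate_subgroup_incl[OF _ \<open>subgroup P G\<close>] by blast
    show "P \<subseteq> generate G (S \<inter> P)" unfolding P using mono_generate[OF JP] unfolding P .
  qed
qed

lemma Tran_surjective:
  "Tran_braid G S \<Omega> P (braid_plus G S w) (braid_plus G S w') \<subseteq>
    (\<lambda>\<tau>s. lprod (Br_plus G S \<Omega>) (map (\<lambda>\<tau>. braid_plus G S (untwisted G \<tau>)) \<tau>s)) ` Tran_mixed G S \<Omega> P w w'"
proof
  fix b assume b: "b \<in> Tran_braid G S \<Omega> P (braid_plus G S w) (braid_plus G S w')"
  then obtain t where t: "set t \<subseteq> S \<inter> P" "b = (\<one>\<^bsub>K\<^esub>, cl t)"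
    unfolding Tran_braid_def using Br_plus_sub_elem by blast
  obtain \<delta> x \<delta>' x' where e: "w = (\<delta>, x)" "w' = (\<delta>', x')" "\<delta> \<in> \<Omega>" "\<delta>' \<in> \<Omega>" "x \<in> carrier G" "x' \<in> carrier G"
    using w w' by (auto simp: W_carrier)
  have tS: "set t \<subseteq> S" using t by blast
  have L: "(\<one>\<^bsub>K\<^esub>, cl t) \<otimes>\<^bsub>Br_plus G S \<Omega>\<^esub> (\<delta>, cl (rw x)) = (\<delta>, cl (map (inv\<^bsub>K\<^esub> \<delta>) t @ rw x))"
    using Br_plus_mult[OF e(3) tS, of "\<one>\<^bsub>K\<^esub>" "rw x"] e by simp
  have R: "(\<delta>', cl (rw x')) \<otimes>\<^bsub>Br_plus G S \<Omega>\<^esub> (\<one>\<^bsub>K\<^esub>, cl t) = (\<delta>', cl (rw x' @ t))"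
    using Br_plus_mult[OF K_one_in rw_set[OF e(6)], of \<delta>' t] map_one[OF rw_set[OF e(6)]] e by simp
  have "(\<one>\<^bsub>K\<^esub>, cl t) \<otimes>\<^bsub>Br_plus G S \<Omega>\<^esub> (\<delta>, cl (rw x)) = (\<delta>', cl (rw x')) \<otimes>\<^bsub>Br_plus G S \<Omega>\<^esub> (\<one>\<^bsub>K\<^esub>, cl t)"
    using b t(2) e by (simp add: Tran_braid_def braid_plus_rw)
  then have eq: "\<delta> = \<delta>'" "map (inv\<^bsub>K\<^esub> \<delta>) t @ rw x \<sim> rw x' @ t"
    unfolding L R prod.inject word_class_eq by blast+
  obtain \<tau>s where \<tau>s: "set \<tau>s \<subseteq> P" "(\<tau>s, (\<delta>, lp (rw x'))) \<in> tran_mixed G S \<Omega> P (\<delta>, lp (rw x))"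
      "concat (map rw \<tau>s) \<sim> t"
    using tran_exists[OF e(3) P_letters(1) t(1) rw(1)[OF e(5)] rw(1)[OF e(6)] eq(2)] unfolding P_letters(3) by blast
  have "\<tau>s \<in> Tran_mixed G S \<Omega> P w w'" using \<tau>s(2) eq(1) e by (simp add: Tran_mixed_def)
  moreover have "b = lprod (Br_plus G S \<Omega>) (map (\<lambda>\<tau>. braid_plus G S (untwisted G \<tau>)) \<tau>s)"
    using lprod_braid_plus[of \<tau>s] \<tau>s(1,3) P_letters(4) t(2) by (auto simp: word_class_eq be_sym)
  ultimately show "b \<in> (\<lambda>\<tau>s. lprod (Br_plus G S \<Omega>) (map (\<lambda>\<tau>. braid_plus G S (untwisted G \<tau>)) \<tau>s)) `
      Tran_mixed G S \<Omega> P w w'" by (rule rev_image_eqI)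
qed

lemma mixed_shift_iff_conjugate:
  "mixed_shift_by G S \<Omega> P w w' \<longleftrightarrow>
    (\<exists>g\<in>Br_sub G S \<Omega> P. g \<otimes>\<^bsub>Br G S \<Omega>\<^esub> braid G S w \<otimes>\<^bsub>Br G S \<Omega>\<^esub> inv\<^bsub>Br G S \<Omega>\<^esub> g = braid G S w')"
proof
  assume "mixed_shift_by G S \<Omega> P w w'"
  then obtain \<tau>s where "(\<tau>s, w') \<in> tran_mixed G S \<Omega> (generate G (S \<inter> P)) w"
    unfolding P_letters(3) by (auto simp: mixed_shift_by_def Tran_mixed_def)
  then obtain g where g: "g \<in> Br_sub G S \<Omega> P" "g \<otimes>\<^bsub>Br G S \<Omega>\<^esub> braid G S w = braid G S w' \<otimes>\<^bsub>Br G S \<Omega>\<^esub> g"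
    using tran_mixed_braid[of \<tau>s w' "S \<inter> P" w P] w by blast
  moreover have "g \<in> carrier (Br G S \<Omega>)" using Br_sub_carrier(1) g by blast
  ultimately show "\<exists>g\<in>Br_sub G S \<Omega> P. g \<otimes>\<^bsub>Br G S \<Omega>\<^esub> braid G S w \<otimes>\<^bsub>Br G S \<Omega>\<^esub> inv\<^bsub>Br G S \<Omega>\<^esub> g = braid G S w'"
    using braid_closed[OF w'] by (intro bexI[of _ g]) (simp_all add: Br.m_assoc)
next
  assume "\<exists>g\<in>Br_sub G S \<Omega> P. g \<otimes>\<^bsub>Br G S \<Omega>\<^esub> braid G S w \<otimes>\<^bsub>Br G S \<Omega>\<^esub> inv\<^bsub>Br G S \<Omega>\<^esub> g = braid G S w'"
  then obtain g where g: "g \<in> Br_sub G S \<Omega> P"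
    "g \<otimes>\<^bsub>Br G S \<Omega>\<^esub> braid G S w \<otimes>\<^bsub>Br G S \<Omega>\<^esub> inv\<^bsub>Br G S \<Omega>\<^esub> g = braid G S w'" by blast
  obtain \<gamma> where \<gamma>: "set \<gamma> \<subseteq> (S \<inter> P) \<times> UNIV" "g = (\<one>\<^bsub>K\<^esub>, gcl \<gamma>)" using Br_sub_elem[OF g(1)] .
  have gc: "g \<in> carrier (Br G S \<Omega>)" using Br_sub_carrier(1) g by blast
  have comm: "g \<otimes>\<^bsub>Br G S \<Omega>\<^esub> braid G S w = braid G S w' \<otimes>\<^bsub>Br G S \<Omega>\<^esub> g"
    using g(2)[symmetric] gc braid_closed[OF w] by (simp add: Br.m_assoc)
  obtain \<delta> x \<delta>' x' where e: "w = (\<delta>, x)" "w' = (\<delta>', x')" "\<delta> \<in> \<Omega>" "\<delta>' \<in> \<Omega>" "x \<in> carrier G" "x' \<in> carrier G"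
    using w w' by (auto simp: W_carrier)
  let ?\<phi> = "inv\<^bsub>K\<^esub> \<delta>"
  have \<gamma>S: "set \<gamma> \<subseteq> S \<times> UNIV" using \<gamma> by blast
  have ps: "set (pos_word (rw x')) \<subseteq> S \<times> UNIV" using pos_set[OF rw_set[OF e(6)]] .
  have L: "(\<one>\<^bsub>K\<^esub>, gcl \<gamma>) \<otimes>\<^bsub>Br G S \<Omega>\<^esub> (\<delta>, gcl (pos_word (rw x))) = (\<delta>, gcl (map (apfst ?\<phi>) \<gamma> @ pos_word (rw x)))"
    using Br_mult[OF e(3) \<gamma>S, of "\<one>\<^bsub>K\<^esub>" "pos_word (rw x)"] e by simp
  have R: "(\<delta>', gcl (pos_word (rw x'))) \<otimes>\<^bsub>Br G S \<Omega>\<^esub> (\<one>\<^bsub>K\<^esub>, gcl \<gamma>) = (\<delta>', gcl (pos_word (rw x') @ \<gamma>))"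
    using Br_mult[OF K_one_in ps, of \<delta>' \<gamma>] K.r_one[of \<delta>'] e(4)
    unfolding K.inv_one map_apfst_one[OF ps] by simp
  have "(\<one>\<^bsub>K\<^esub>, gcl \<gamma>) \<otimes>\<^bsub>Br G S \<Omega>\<^esub> (\<delta>, gcl (pos_word (rw x))) =
      (\<delta>', gcl (pos_word (rw x'))) \<otimes>\<^bsub>Br G S \<Omega>\<^esub> (\<one>\<^bsub>K\<^esub>, gcl \<gamma>)"
    using comm e(1,2) \<gamma>(2) by (simp only: braid_rw fst_conv snd_conv)
  then have eq: "\<delta> = \<delta>'" "map (apfst ?\<phi>) \<gamma> @ pos_word (rw x) \<approx>\<^sub>g pos_word (rw x') @ \<gamma>"
    unfolding L R prod.inject word_class_eq by blast+
  note r = rw(1)[OF e(5)] rw(1)[OF e(6)]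
  obtain k p q where k: "reduced k" "set p \<subseteq> S \<inter> P" "set q \<subseteq> S \<inter> P"
      "map ?\<phi> q @ k \<sim> rw x @ q" "map ?\<phi> p @ k \<sim> rw x' @ p"
    using conjugate_through_simple[OF K_inv_diag[OF e(3)] P_letters(1) \<gamma>(1) r eq(2)] .
  obtain \<tau>s where "(\<tau>s, (\<delta>, lp (rw x))) \<in> tran_mixed G S \<Omega> P (\<delta>, lp k)"
    using tran_exists[OF e(3) P_letters(1) k(3) k(1) r(1) k(4)] unfolding P_letters(3) by blast
  then have 1: "(\<tau>s, w) \<in> tran_mixed G S \<Omega> P (\<delta>, lp k)" using e by simp
  obtain \<sigma>s where "(\<sigma>s, (\<delta>, lp (rw x'))) \<in> tran_mixed G S \<Omega> P (\<delta>, lp k)"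
    using tran_exists[OF e(3) P_letters(1) k(2) k(1) r(2) k(5)] unfolding P_letters(3) by blast
  then have 2: "(\<sigma>s, w') \<in> tran_mixed G S \<Omega> P (\<delta>, lp k)" using e eq(1) by simp
  have "set k \<subseteq> S" using k(1) by blast
  then have "(\<delta>, lp k) \<in> carrier W" using e(3) by (simp add: W_carrier)
  then obtain \<rho>s where "(\<rho>s, (\<delta>, lp k)) \<in> tran_mixed G S \<Omega> P w"
    using tran_reverse[OF 1 P_letters(5)] by blast
  then have "(\<sigma>s @ \<rho>s, w') \<in> tran_mixed G S \<Omega> P w" using tran_append[OF 2] by blast
  then show "mixed_shift_by G S \<Omega> P w w'" unfolding mixed_shift_by_def Tran_mixed_def by blast
qed

end

end

theorem proposition1:
  fixes G :: "('a, 'z) monoid_scheme" and S :: "'a set" and \<Omega> :: "('a \<Rightarrow> 'a) set"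
    and w w' :: "('a \<Rightarrow> 'a) \<times> 'a"
  assumes "twisted_coxeter G S \<Omega>"
    and "w \<in> carrier (tw_group G \<Omega>)" and "w' \<in> carrier (tw_group G \<Omega>)"
  shows
    "(\<forall>\<tau>s \<in> Tran_mixed G S \<Omega> (carrier G) w w'.
        tw_act G S (lprod (tw_group G \<Omega>) (map (untwisted G) \<tau>s)) ` stable_roots G S \<Omega> w
          = stable_roots G S \<Omega> w') \<and>
     (mixed_shift G S \<Omega> w w' \<and> convex_elt G S \<Omega> w \<and> convex_elt G S \<Omega> w' \<longrightarrow>
        (firmly_convex G S \<Omega> w \<longleftrightarrow> firmly_convex G S \<Omega> w')) \<and>
     (\<forall>W'. standard_parabolic G S W' \<and> finite (carrier G) \<longrightarrow>
        Tran_braid G S \<Omega> W' (braid_plus G S w) (braid_plus G S w')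
          \<subseteq> (\<lambda>\<tau>s. lprod (Br_plus G S \<Omega>) (map (\<lambda>\<tau>. braid_plus G S (untwisted G \<tau>)) \<tau>s))
              ` Tran_mixed G S \<Omega> W' w w' \<and>
        (mixed_shift_by G S \<Omega> W' w w' \<longleftrightarrow>
          (\<exists>g \<in> Br_sub G S \<Omega> W'.
             g \<otimes>\<^bsub>Br G S \<Omega>\<^esub> braid G S w \<otimes>\<^bsub>Br G S \<Omega>\<^esub> inv\<^bsub>Br G S \<Omega>\<^esub> g = braid G S w')))"
proof -
  have cs: "coxeter_system G S" using assms(1) by (simp add: twisted_coxeter_def)
  interpret group G using cs by (simp add: coxeter_system_def)
  interpret twisted G S \<Omega> by unfold_locales (use cs assms(1) in auto)
  have stable: "tw_act G S (lprod (tw_group G \<Omega>) (map (untwisted G) \<tau>s)) ` stable_roots G S \<Omega> w = stable_roots G S \<Omega> w'"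
    if "\<tau>s \<in> Tran_mixed G S \<Omega> (carrier G) w w'" for \<tau>s
    using that tran_mixed_stable[of \<tau>s w' "carrier G" w] assms(2) by (simp add: Tran_mixed_def)
  have firm: "firmly_convex G S \<Omega> w \<longleftrightarrow> firmly_convex G S \<Omega> w'"
    if "mixed_shift G S \<Omega> w w'" "convex_elt G S \<Omega> w" "convex_elt G S \<Omega> w'"
    using that firm_transfer[of _ w' "carrier G" w] assms(2)
    by (auto simp: firmly_convex_def mixed_shift_by_def Tran_mixed_def)
  have braids: "Tran_braid G S \<Omega> P (braid_plus G S w) (braid_plus G S w')
        \<subseteq> (\<lambda>\<tau>s. lprod (Br_plus G S \<Omega>) (map (\<lambda>\<tau>. braid_plus G S (untwisted G \<tau>)) \<tau>s)) ` Tran_mixed G S \<Omega> P w w' \<and>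
      (mixed_shift_by G S \<Omega> P w w' \<longleftrightarrow>
        (\<exists>g \<in> Br_sub G S \<Omega> P.
           g \<otimes>\<^bsub>Br G S \<Omega>\<^esub> braid G S w \<otimes>\<^bsub>Br G S \<Omega>\<^esub> inv\<^bsub>Br G S \<Omega>\<^esub> g = braid G S w'))"
    if P: "standard_parabolic G S P" and fin: "finite (carrier G)" for P
  proof -
    interpret finite_twisted G S \<Omega> by unfold_locales (rule fin)
    obtain J where J: "J \<subseteq> S" "P = generate G J" using P by (auto simp: standard_parabolic_def)
    show ?thesis
      using Tran_surjective[OF J assms(2,3)] mixed_shift_iff_conjugate[OF J assms(2,3)] by (rule conjI)
  qed
  show ?thesis
  proof (intro conjI ballI impI allI)
    fix P assume "standard_parabolic G S P \<and> finite (carrier G)"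
    then have "standard_parabolic G S P" "finite (carrier G)" by blast+
    note * = braids[OF this]
    show "Tran_braid G S \<Omega> P (braid_plus G S w) (braid_plus G S w')
        \<subseteq> (\<lambda>\<tau>s. lprod (Br_plus G S \<Omega>) (map (\<lambda>\<tau>. braid_plus G S (untwisted G \<tau>)) \<tau>s)) ` Tran_mixed G S \<Omega> P w w'"
      using * by (rule conjunct1)
    show "mixed_shift_by G S \<Omega> P w w' \<longleftrightarrow>
        (\<exists>g \<in> Br_sub G S \<Omega> P.
           g \<otimes>\<^bsub>Br G S \<Omega>\<^esub> braid G S w \<otimes>\<^bsub>Br G S \<Omega>\<^esub> inv\<^bsub>Br G S \<Omega>\<^esub> g = braid G S w')"
      using * by (rule conjunct2)
  qed (use stable firm in blast)+
qed

end
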